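(* Let $(\mathbf u,\mathbf W)$ be a minimizer for $J$ in $\mathcal F(\Omega)$, suppose that $f_1$ and $g_1$ are bounded, and that there are $\lambda>0$ and $\varepsilon>0$ such that the following nondegeneracy condition holds: for each measurable set $A\subset W_1$ with $0<|A|\le\varepsilon$, there are disjoint subsets $A_j\subset A$, $2\le j\le N$, such that $$F(W_1\setminus A,W_2\cup A_2,\dots,W_N\cup A_N)\le F(\mathbf W)-\lambda|A|.$$ Let $x\in\mathbb R^n$ and $r>0$ be such that $\mathbf u$ is continuous on $B(x,r)$, $r\le\min(1,\varepsilon^{1/n})$, and $B(x,r/2)$ meets the boundary of $\Omega_1=\{y\in\Omega: u_1(y)>0\}$. Then, with $u_{1,+}=\max(0,u_1)$, $$\frac1{|B(x,r)|}\int_{B(x,r)}|u_{1,+}|^2\ge c_1r^2\qquad\text{and}\qquad|\Omega_1\cap B(x,r)|\ge c_2r^n,$$ with constants $c_1>0$ and $c_2>0$ that depend only on $n$, $\lambda$, $\|f_1\|_\infty$, $\|g_1\|_\infty$, and an upper bound for $\frac1{|B(x,r)|}\int_{B(x,r)}|\nabla u_{1,+}|^2$.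
   Context: $n\ge2$ and $N\ge1$ are integers; $|A|$ is the Lebesgue measure of $A$; $B(x,r)$ is the open ball; $\Omega\subset\mathbb R^n$ is a Borel set with $|\Omega|<+\infty$. $W^{1,2}(\mathbb R^n)$ denotes the set of functions in $L^2_{loc}(\mathbb R^n)$ whose distributional gradient lies in $L^2(\mathbb R^n)$. $\mathcal W(\Omega)$ is the set of $N$-tuples $\mathbf W=(W_1,\dots,W_N)$ of pairwise disjoint Borel subsets of $\Omega$. $\mathcal F(\Omega)$ is the set of pairs $(\mathbf u,\mathbf W)$ with $\mathbf W\in\mathcal W(\Omega)$ and $\mathbf u=(u_1,\dots,u_N)$ an $N$-tuple of real-valued functions $u_i\in W^{1,2}(\mathbb R^n)$ such that $u_i(x)=0$ for almost every $x\in\mathbb R^n\setminus W_i$. Given measurable functions $f_i,g_i$ on $\Omega$ (such that the integrals below converge) and $F:\mathcal W(\Omega)\to\mathbb R$, $$J(\mathbf u,\mathbf W)=\sum_{i=1}^N\int|\nabla u_i|^2\,dx+\sum_{i=1}^N\int[u_i^2f_i-u_ig_i]\,dx+F(W_1,\dots,W_N).$$ A minimizer for $J$ in $\mathcal F(\Omega)$ is a pair $(\mathbf u,\mathbf W)\in\mathcal F(\Omega)$ such that $J(\mathbf u,\mathbf W)\le J(\mathbf u^*,\mathbf W^* )$ for all $(\mathbf u^*,\mathbf W^* )\in\mathcal F(\Omega)$. *)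

theory Defs
  imports "HOL-Probability.Essential_Supremum"
begin

section \<open>The space W^{1,2} on Euclidean space\<close>

definition partial_deriv :: "'n::finite \<Rightarrow> (real^'n \<Rightarrow> real) \<Rightarrow> real^'n \<Rightarrow> real" where
  "partial_deriv i \<phi> x = frechet_derivative \<phi> (at x) (axis i 1)"

text \<open>Smoothness: every iterated partial derivative exists and is (totally) differentiable
  everywhere.\<close>

definition smooth :: "(real^'n::finite \<Rightarrow> real) \<Rightarrow> bool" where
  "smooth \<phi> \<longleftrightarrow> (\<forall>is. foldr partial_deriv is \<phi> differentiable_on UNIV)"

definition test_function :: "(real^'n::finite \<Rightarrow> real) \<Rightarrow> bool" where
  "test_function \<phi> \<longleftrightarrow> smooth \<phi> \<and> compact (closure {x. \<phi> x \<noteq> 0})"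

definition L1_loc :: "(real^'n::finite \<Rightarrow> 'b::euclidean_space) \<Rightarrow> bool" where
  "L1_loc G \<longleftrightarrow> G \<in> borel_measurable lebesgue \<and> (\<forall>K. compact K \<longrightarrow> integrable (lebesgue_on K) G)"

definition L2_loc :: "(real^'n::finite \<Rightarrow> real) \<Rightarrow> bool" where
  "L2_loc u \<longleftrightarrow> u \<in> borel_measurable lebesgue \<and>
     (\<forall>K. compact K \<longrightarrow> integrable (lebesgue_on K) (\<lambda>x. (u x)\<^sup>2))"

definition L2 :: "(real^'n::finite \<Rightarrow> real^'n) \<Rightarrow> bool" where
  "L2 G \<longleftrightarrow> G \<in> borel_measurable lebesgue \<and> integrable lebesgue (\<lambda>x. (norm (G x))\<^sup>2)"

definition has_weak_gradient :: "(real^'n::finite \<Rightarrow> real) \<Rightarrow> (real^'n \<Rightarrow> real^'n) \<Rightarrow> bool" where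
  "has_weak_gradient u G \<longleftrightarrow> L1_loc G \<and>
     (\<forall>\<phi> i. test_function \<phi> \<longrightarrow>
        (LINT x|lebesgue. u x * partial_deriv i \<phi> x) = - (LINT x|lebesgue. G x $ i * \<phi> x))"

definition W12 :: "(real^'n::finite \<Rightarrow> real) set" where
  "W12 = {u. L2_loc u \<and> (\<exists>G. has_weak_gradient u G \<and> L2 G)}"

text \<open>The weak gradient is unique up to null sets, so the choice does not affect integrals.\<close>

definition weak_gradient :: "(real^'n::finite \<Rightarrow> real) \<Rightarrow> real^'n \<Rightarrow> real^'n" where
  "weak_gradient u = (SOME G. has_weak_gradient u G)"

section \<open>Admissible pairs, the functional, and its minimizers\<close>

text \<open>An \<open>N\<close>-tuple is an extensional function on \<open>{1..N}\<close>, so that a functional of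
  an \<open>N\<close>-tuple of sets cannot depend on values at other indices.\<close>

definition set_tuples :: "nat \<Rightarrow> (real^'n::finite) set \<Rightarrow> (nat \<Rightarrow> (real^'n) set) set" where
  "set_tuples N \<Omega> =
     {W \<in> {1..N} \<rightarrow>\<^sub>E {A. A \<in> sets borel \<and> A \<subseteq> \<Omega>}. disjoint_family_on W {1..N}}"

definition admissible_pairs ::
  "nat \<Rightarrow> (real^'n::finite) set \<Rightarrow> ((nat \<Rightarrow> real^'n \<Rightarrow> real) \<times> (nat \<Rightarrow> (real^'n) set)) set" where
  "admissible_pairs N \<Omega> =
     {(u, W). W \<in> set_tuples N \<Omega> \<and> u \<in> {1..N} \<rightarrow>\<^sub>E W12 \<and>
        (\<forall>i\<in>{1..N}. AE x in lebesgue. x \<notin> W i \<longrightarrow> u i x = 0)}"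

text \<open>The functions \<open>f i\<close>, \<open>g i\<close> only matter on \<open>\<Omega>\<close>; since the components of an
  admissible \<open>u\<close> vanish almost everywhere off \<open>\<Omega>\<close>, the lower-order term is integrated there.\<close>

definition lower_order_converges ::
  "nat \<Rightarrow> (real^'n::finite) set \<Rightarrow> (nat \<Rightarrow> real^'n \<Rightarrow> real) \<Rightarrow> (nat \<Rightarrow> real^'n \<Rightarrow> real) \<Rightarrow> bool" where
  "lower_order_converges N \<Omega> f g \<longleftrightarrow>
     (\<forall>(u, W) \<in> admissible_pairs N \<Omega>. \<forall>i\<in>{1..N}.
        integrable (lebesgue_on \<Omega>) (\<lambda>x. (u i x)\<^sup>2 * f i x - u i x * g i x))"

definition J_functional ::
  "nat \<Rightarrow> (real^'n::finite) set \<Rightarrow> (nat \<Rightarrow> real^'n \<Rightarrow> real) \<Rightarrow> (nat \<Rightarrow> real^'n \<Rightarrow> real) \<Rightarrow>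
   ((nat \<Rightarrow> (real^'n) set) \<Rightarrow> real) \<Rightarrow>
   (nat \<Rightarrow> real^'n \<Rightarrow> real) \<Rightarrow> (nat \<Rightarrow> (real^'n) set) \<Rightarrow> real" where
  "J_functional N \<Omega> f g F u W =
     (\<Sum>i=1..N. LINT x|lebesgue. (norm (weak_gradient (u i) x))\<^sup>2)
     + (\<Sum>i=1..N. LINT x|lebesgue_on \<Omega>. (u i x)\<^sup>2 * f i x - u i x * g i x)
     + F W"

definition J_minimizer ::
  "nat \<Rightarrow> (real^'n::finite) set \<Rightarrow> (nat \<Rightarrow> real^'n \<Rightarrow> real) \<Rightarrow> (nat \<Rightarrow> real^'n \<Rightarrow> real) \<Rightarrow>
   ((nat \<Rightarrow> (real^'n) set) \<Rightarrow> real) \<Rightarrow>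
   (nat \<Rightarrow> real^'n \<Rightarrow> real) \<Rightarrow> (nat \<Rightarrow> (real^'n) set) \<Rightarrow> bool" where
  "J_minimizer N \<Omega> f g F u W \<longleftrightarrow>
     (u, W) \<in> admissible_pairs N \<Omega> \<and>
     (\<forall>(u', W') \<in> admissible_pairs N \<Omega>. J_functional N \<Omega> f g F u W \<le> J_functional N \<Omega> f g F u' W')"

text \<open>All sets are Borel here, so that the modified tuple stays in the domain
  \<open>set_tuples N \<Omega>\<close> of \<open>F\<close>.\<close>

definition nondegenerate1 ::
  "nat \<Rightarrow> ((nat \<Rightarrow> (real^'n::finite) set) \<Rightarrow> real) \<Rightarrow> (nat \<Rightarrow> (real^'n) set) \<Rightarrow> real \<Rightarrow> real \<Rightarrow> bool" where
  "nondegenerate1 N F W lam \<epsilon> \<longleftrightarrow>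
     (\<forall>A \<in> sets borel. A \<subseteq> W 1 \<and> 0 < measure lebesgue A \<and> measure lebesgue A \<le> \<epsilon> \<longrightarrow>
        (\<exists>A'. (\<forall>j\<in>{2..N}. A' j \<in> sets borel \<and> A' j \<subseteq> A) \<and> disjoint_family_on A' {2..N} \<and>
              F (\<lambda>i\<in>{1..N}. if i = 1 then W 1 - A else W i \<union> A' i)
                \<le> F W - lam * measure lebesgue A))"

section \<open>Norms and averages\<close>

definition Linf_norm :: "(real^'n::finite) set \<Rightarrow> (real^'n \<Rightarrow> real) \<Rightarrow> ereal" where
  "Linf_norm \<Omega> h = esssup (lebesgue_on \<Omega>) (\<lambda>x. ereal \<bar>h x\<bar>)"

definition ball_average :: "real^'n::finite \<Rightarrow> real \<Rightarrow> (real^'n \<Rightarrow> real) \<Rightarrow> real" where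
  "ball_average x r h = (1 / measure lebesgue (ball x r)) * (LINT y|lebesgue_on (ball x r). h y)"

end

theory Submission
  imports Defs "HOL-Probability.Probability_Measure"
begin

text \<open>The proof is a De Giorgi iteration for \<open>v = max 0 u\<^sub>1\<close>. Fix a centre \<open>y\<close>, write \<open>B\<^sub>t\<close> for the ball
  of radius \<open>t\<close> around it, and consider the energy
  \<open>E(t) = \<integral>\<^bsub>B(t)\<^esub> |\<nabla>v|\<^sup>2 + \<lambda> |B\<^sub>t \<inter> {u\<^sub>1 > 0}|\<close> and the mass \<open>m(t) = \<integral>\<^bsub>B(t)\<^esub> v\<^sup>2\<close>. Two estimates
  play against each other.

  \<^item> Minimality bounds the energy by the mass of a larger ball. For \<open>s < t\<close> take a cutoff
  \<open>\<psi>\<close> that is 1 on \<open>B\<^sub>s\<close> and vanishes outside \<open>B\<^sub>t\<close>, replace \<open>u\<^sub>1\<close> by \<open>u\<^sub>1 - \<psi>v\<close>, and hand the set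
  \<open>W\<^sub>1 \<inter> B\<^sub>s \<inter> {u\<^sub>1 > 0}\<close> over to the other components. Nondegeneracy rewards this with \<open>\<lambda>\<close> times the measure
  of the set, so \<open>E(s)\<close> is at most the price paid for the cutoff (\<open>energy_inequality\<close>), whence
  \<open>E(s) \<le> \<theta> E(t) + K m(t) / (\<theta> (t - s)\<^sup>2)\<close> (\<open>energy_decay\<close>).

  \<^item> Conversely, a small energy forces \<open>v\<close> to vanish on most of \<open>B\<^sub>t\<close>, and then a Poincare inequality
  bounds \<open>m(t)\<close> by \<open>h\<^sup>2 E(t)\<close> up to a constant, where \<open>h\<^sup>n\<close> is proportional to a bound for the measure of the support
  (\<open>poincare_small_support\<close>, \<open>mass_le_energy\<close>).

  The combination is superlinear: if the mass of a ball of radius \<open>\<rho>\<close> is below a threshold that depends on a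
  bound for its energy, then \<open>E(\<rho>/2) = 0\<close> (\<open>decay_threshold_exists\<close>). The ball \<open>B(x,r/2)\<close> contains a point
  \<open>y\<close> with \<open>u\<^sub>1(y) > 0\<close>, and continuity makes the energy of every ball around \<open>y\<close> positive. So the mass
  of \<open>B(y,r/2) \<subseteq> B(x,r)\<close> exceeds the threshold, which is the first assertion (\<open>mass_lower_bound\<close>). Working in
  the ball of radius \<open>r/2\<close> also guarantees that the sets handed over have measure at most \<open>r\<^sup>n \<le> \<epsilon>\<close>.
  If \<open>\<Omega>\<^sub>1 \<inter> B(x,r)\<close> had very small measure, the Poincare inequality on \<open>B(x,r)\<close> and the bound for the mean
  of \<open>|\<nabla>v|\<^sup>2\<close> would contradict the first assertion; this is the second one (\<open>positive_set_lower_bound\<close>).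

  The facts on Sobolev functions all come from one identity,
  \<open>u(x + z) - u(x) = \<integral>\<^sub>0\<^sup>1 \<nabla>u(x + sz) \<bullet> z ds\<close> for almost every \<open>x\<close> (\<open>L1_weak_gradient_increment\<close>):
  it gives the convergence of difference quotients in L1, hence the chain rule for the positive part, and
  the bound on increments behind the Poincare inequality.\<close>

section \<open>Smooth functions and cutoffs\<close>

lemma partial_deriv_eq:
  "(f has_derivative f') (at x) \<Longrightarrow> partial_deriv i f x = f' (axis i 1)"
  unfolding partial_deriv_def by (metis frechet_derivative_at)

lemma smooth_coinduct:
  assumes "f \<in> C" and "\<And>g. g \<in> C \<Longrightarrow> g differentiable_on UNIV"
    and "\<And>g i. g \<in> C \<Longrightarrow> partial_deriv i g \<in> C"
  shows "smooth f"
proof -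
  have "foldr partial_deriv is f \<in> C" for "is"
    by (induction "is") (auto simp: assms)
  then show ?thesis
    unfolding smooth_def using assms(2) by blast
qed

lemma smooth_differentiable: "smooth f \<Longrightarrow> f differentiable (at x)"
  unfolding smooth_def by (metis UNIV_I differentiable_on_def foldr_Nil id_apply)

lemma smooth_partial_deriv: "smooth f \<Longrightarrow> smooth (partial_deriv i f)"
  unfolding smooth_def
proof
  fix "is" assume "\<forall>is. foldr partial_deriv is f differentiable_on UNIV"
  then have "foldr partial_deriv (is @ [i]) f differentiable_on UNIV" by blast
  then show "foldr partial_deriv is (partial_deriv i f) differentiable_on UNIV" by simp
qed

text \<open>A family of functions that is closed under partial derivatives consists of smooth
  functions, so closure properties of smoothness are proved all at once, for the algebra generated
  by smooth functions and by compositions with a real function together with all its derivatives.\<close>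

inductive_set smooth_algebra :: "(real^'n::finite \<Rightarrow> real) set" where
  base: "smooth f \<Longrightarrow> f \<in> smooth_algebra"
| add: "f \<in> smooth_algebra \<Longrightarrow> g \<in> smooth_algebra \<Longrightarrow> (\<lambda>x. f x + g x) \<in> smooth_algebra"
| mult: "f \<in> smooth_algebra \<Longrightarrow> g \<in> smooth_algebra \<Longrightarrow> (\<lambda>x. f x * g x) \<in> smooth_algebra"
| comp: "(\<And>k t. t \<in> S \<Longrightarrow> (D k has_real_derivative D (Suc k) t) (at t)) \<Longrightarrow> f \<in> smooth_algebra \<Longrightarrow>
    range f \<subseteq> S \<Longrightarrow> (\<lambda>x. D k (f x)) \<in> smooth_algebra"

lemma has_derivative_comp_real:
  assumes "f differentiable (at x)" and "(g has_real_derivative d) (at (f x))"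
  shows "((\<lambda>x. g (f x)) has_derivative (\<lambda>h. d * frechet_derivative f (at x) h)) (at x)"
  using diff_chain_at[OF assms(1)[unfolded frechet_derivative_works] assms(2)[unfolded has_field_derivative_def]]
  by (simp add: o_def)

lemma partial_deriv_comp:
  assumes "f differentiable (at x)" and "(g has_real_derivative d) (at (f x))"
  shows "partial_deriv i (\<lambda>x. g (f x)) x = d * partial_deriv i f x"
  using partial_deriv_eq[OF has_derivative_comp_real[OF assms]] by (simp add: partial_deriv_def)

lemma smooth_algebra_differentiable: "f \<in> smooth_algebra \<Longrightarrow> f differentiable (at x)"
proof (induction rule: smooth_algebra.induct)
  case (comp S D f k)
  then show ?case
    using has_derivative_comp_real[of f x "D k" "D (Suc k) (f x)"] 
    unfolding differentiable_def by blast
qed (auto intro: smooth_differentiable)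

lemma smooth_algebra_partial_deriv: "f \<in> smooth_algebra \<Longrightarrow> partial_deriv i f \<in> smooth_algebra"
proof (induction rule: smooth_algebra.induct)
  case (base f)
  then show ?case by (intro smooth_algebra.base smooth_partial_deriv)
next
  case (add f g)
  have "partial_deriv i (\<lambda>x. f x + g x) = (\<lambda>x. partial_deriv i f x + partial_deriv i g x)"
    using add.hyps[THEN smooth_algebra_differentiable, unfolded frechet_derivative_works]
    by (intro ext, subst partial_deriv_eq[OF has_derivative_add]) (auto simp: partial_deriv_def)
  then show ?case using add by (auto intro: smooth_algebra.intros)
next
  case (mult f g)
  have "partial_deriv i (\<lambda>x. f x * g x) = (\<lambda>x. f x * partial_deriv i g x + partial_deriv i f x * g x)"
    using mult.hyps[THEN smooth_algebra_differentiable, unfolded frechet_derivative_works]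
    by (intro ext, subst partial_deriv_eq[OF has_derivative_mult]) (auto simp: partial_deriv_def)
  then show ?case using mult by (auto intro: smooth_algebra.intros)
next
  case (comp S D f k)
  have "partial_deriv i (\<lambda>x. D k (f x)) = (\<lambda>x. D (Suc k) (f x) * partial_deriv i f x)"
    using comp.hyps(3) by (intro ext partial_deriv_comp smooth_algebra_differentiable comp.hyps) auto
  moreover have "(\<lambda>x. D (Suc k) (f x)) \<in> smooth_algebra"
    by (rule smooth_algebra.comp[where S=S]) (use comp in auto)
  ultimately show ?case using comp.IH by (auto intro: smooth_algebra.mult)
qed

lemma smooth_algebra_smooth: "f \<in> smooth_algebra \<Longrightarrow> smooth f"
  by (rule smooth_coinduct[of _ smooth_algebra])
    (auto simp: differentiable_on_def intro: smooth_algebra_differentiable smooth_algebra_partial_deriv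
        differentiable_at_withinI)

lemma smooth_add: "smooth f \<Longrightarrow> smooth g \<Longrightarrow> smooth (\<lambda>x. f x + g x)"
  and smooth_mult: "smooth f \<Longrightarrow> smooth g \<Longrightarrow> smooth (\<lambda>x. f x * g x)"
  and smooth_comp: "(\<And>k t. t \<in> S \<Longrightarrow> (D k has_real_derivative D (Suc k) t) (at t)) \<Longrightarrow> smooth f \<Longrightarrow>
    range f \<subseteq> S \<Longrightarrow> smooth (\<lambda>x. D k (f x))"
  by (rule smooth_algebra_smooth, rule smooth_algebra.intros, simp_all add: smooth_algebra.base)+

lemma smooth_const [simp]: "smooth (\<lambda>x::real^'n::finite. c)"
proof (rule smooth_coinduct[of _ "range (\<lambda>c x. c)"])
  fix g :: "real^'n \<Rightarrow> real" and i assume "g \<in> range (\<lambda>c x. c)"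
  then obtain c where g: "g = (\<lambda>x. c)" by auto
  show "partial_deriv i g \<in> range (\<lambda>c x. c)"
    unfolding g by (intro image_eqI[of _ _ 0] ext) (simp_all add: partial_deriv_def)
qed auto

lemma partial_deriv_coordinate: "partial_deriv i (\<lambda>x. x $ j) = (\<lambda>x. if i = j then 1 else 0)"
  by (intro ext, subst partial_deriv_eq[OF bounded_linear_imp_has_derivative[OF bounded_linear_vec_nth]])
    (auto simp: axis_def)

lemma smooth_coordinate [simp]: "smooth (\<lambda>x::real^'n::finite. x $ j)"
proof (rule smooth_coinduct[of _ "{(\<lambda>x. x $ j)} \<union> {f. smooth f}"])
  fix g :: "real^'n \<Rightarrow> real" and i assume g: "g \<in> {(\<lambda>x. x $ j)} \<union> {f. smooth f}"
  then show "partial_deriv i g \<in> {(\<lambda>x. x $ j)} \<union> {f. smooth f}"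
    by (auto simp: smooth_partial_deriv partial_deriv_coordinate)
  show "g differentiable_on UNIV"
    using g by (auto simp: differentiable_on_def smooth_differentiable bounded_linear_imp_differentiable bounded_linear_vec_nth)
qed auto

lemma smooth_diff: "smooth f \<Longrightarrow> smooth g \<Longrightarrow> smooth (\<lambda>x. f x - g x)"
  using smooth_add[of f "\<lambda>x. (-1) * g x"] smooth_mult[of "\<lambda>x. -1" g] by simp

lemma smooth_sum: "finite I \<Longrightarrow> (\<And>i. i \<in> I \<Longrightarrow> smooth (f i)) \<Longrightarrow> smooth (\<lambda>x. \<Sum>i\<in>I. f i x)"
  by (induction I rule: finite_induct) (auto intro: smooth_add)

lemma smooth_prod: "finite I \<Longrightarrow> (\<And>i. i \<in> I \<Longrightarrow> smooth (f i)) \<Longrightarrow> smooth (\<lambda>x. \<Prod>i\<in>I. f i x)"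
  by (induction I rule: finite_induct) (auto intro: smooth_mult)

lemma smooth_power: "smooth f \<Longrightarrow> smooth (\<lambda>x. f x ^ k)"
  by (induction k) (auto intro: smooth_mult)

lemma has_derivative_translation:
  fixes f :: "real^'n::finite \<Rightarrow> real"
  assumes "smooth f"
  shows "((\<lambda>x. f (x + a)) has_derivative frechet_derivative f (at (x + a))) (at x)"
proof -
  have "((\<lambda>x. x + a) has_derivative (\<lambda>x. x)) (at x)"
    by (auto intro!: derivative_eq_intros)
  moreover have "(f has_derivative frechet_derivative f (at (x + a))) (at (x + a))"
    using smooth_differentiable[OF assms] frechet_derivative_works by blast
  ultimately show ?thesis using diff_chain_at by (fastforce simp: o_def)
qed

lemma partial_deriv_translation:
  assumes "smooth f" shows "partial_deriv i (\<lambda>x. f (x + a)) x = partial_deriv i f (x + a)"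
  using partial_deriv_eq[OF has_derivative_translation[OF assms]] by (simp only: partial_deriv_def[of i f])

lemma smooth_translation:
  fixes f :: "real^'n::finite \<Rightarrow> real"
  assumes "smooth f" shows "smooth (\<lambda>x. f (x + a))"
proof (rule smooth_coinduct[of _ "(\<lambda>g x. g (x + a)) ` {g. smooth g}"])
  fix g :: "real^'n \<Rightarrow> real" and i assume "g \<in> (\<lambda>g x. g (x + a)) ` {g. smooth g}"
  then obtain h where g: "g = (\<lambda>x. h (x + a))" and h: "smooth h" by auto
  show "g differentiable_on UNIV"
    unfolding g differentiable_on_def differentiable_def using has_derivative_translation[OF h] by auto
  have "partial_deriv i g = (\<lambda>x. partial_deriv i h (x + a))"
    unfolding g using partial_deriv_translation[OF h] by auto
  then show "partial_deriv i g \<in> (\<lambda>g x. g (x + a)) ` {g. smooth g}"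
    using smooth_partial_deriv[OF h] by auto
qed (use assms in auto)

lemma smooth_continuous: "smooth f \<Longrightarrow> continuous_on UNIV f"
  by (simp add: continuous_at_imp_continuous_on differentiable_imp_continuous_within smooth_differentiable)

lemma smooth_has_derivative:
  fixes f :: "real^'n::finite \<Rightarrow> real"
  assumes "smooth f"
  shows "(f has_derivative (\<lambda>h. \<Sum>i\<in>UNIV. h $ i * partial_deriv i f x)) (at x)"
proof -
  have "(f has_derivative frechet_derivative f (at x)) (at x)"
    using smooth_differentiable[OF assms] frechet_derivative_works by blast
  moreover have "frechet_derivative f (at x) = (\<lambda>h. \<Sum>i\<in>UNIV. h $ i * partial_deriv i f x)"
  proof
    fix h :: "real^'n"
    have lin: "linear (frechet_derivative f (at x))"
      using smooth_differentiable[OF assms] linear_frechet_derivative by blast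
    have "h = (\<Sum>i\<in>UNIV. h $ i *\<^sub>R axis i 1)"
      using basis_expansion[of h] by (simp add: scalar_mult_eq_scaleR)
    then have "frechet_derivative f (at x) h = frechet_derivative f (at x) (\<Sum>i\<in>UNIV. h $ i *\<^sub>R axis i 1)"
      by simp
    then show "frechet_derivative f (at x) h = (\<Sum>i\<in>UNIV. h $ i * partial_deriv i f x)"
      using lin by (simp add: linear_sum linear_cmul partial_deriv_def)
  qed
  ultimately show ?thesis by simp
qed

lemma partial_deriv_mult:
  assumes "smooth f" "smooth g"
  shows "partial_deriv i (\<lambda>x. f x * g x) x = f x * partial_deriv i g x + partial_deriv i f x * g x"
  using assms[THEN smooth_differentiable, unfolded frechet_derivative_works]
  by (subst partial_deriv_eq[OF has_derivative_mult]) (auto simp: partial_deriv_def)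

subsection \<open>A smooth step\<close>

text \<open>The polynomials such that \<open>P\<^sub>k(1/t) e\<^bsup>-1/t\<^esup>\<close> is the \<open>k\<close>-th derivative of \<open>e\<^bsup>-1/t\<^esup>\<close>.\<close>

primrec flat_exp_poly :: "nat \<Rightarrow> real poly" where
  "flat_exp_poly 0 = 1"
| "flat_exp_poly (Suc k) = [:0, 0, 1:] * (flat_exp_poly k - pderiv (flat_exp_poly k))"

definition flat_exp :: "nat \<Rightarrow> real \<Rightarrow> real" where
  "flat_exp k t = (if t > 0 then poly (flat_exp_poly k) (1 / t) * exp (- (1 / t)) else 0)"

lemma poly_exp_tendsto_0: "((\<lambda>s. poly p s * exp (- s)) \<longlongrightarrow> (0::real)) at_top"
proof -
  have "((\<lambda>s. \<Sum>i\<le>degree p. coeff p i * (s ^ i / exp s)) \<longlongrightarrow> (\<Sum>i\<le>degree p. coeff p i * 0)) at_top"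
    by (intro tendsto_intros tendsto_power_div_exp_0)
  then show ?thesis
    by (simp add: poly_altdef exp_minus sum_distrib_right divide_inverse mult.assoc)
qed

text \<open>At \<open>t = 0\<close> the difference quotient from the right is a polynomial in \<open>1/t\<close> times \<open>e\<^bsup>-1/t\<^esup>\<close>, which
  tends to 0.\<close>

lemma flat_exp_has_derivative: "(flat_exp k has_real_derivative flat_exp (Suc k) t) (at t)"
proof -
  consider "t > 0" | "t < 0" | "t = 0" by linarith
  then show ?thesis
  proof cases
    case 1
    have "((\<lambda>t. poly (flat_exp_poly k) (1 / t) * exp (- (1 / t))) has_real_derivative flat_exp (Suc k) t) (at t)"
      using 1 by (auto intro!: derivative_eq_intros simp: flat_exp_def power2_eq_square field_simps)
    then show ?thesis
      by (rule has_field_derivative_transform_within_open[of _ _ _ "{0<..}"]) (auto simp: flat_exp_def 1)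
  next
    case 2
    have "((\<lambda>t. 0) has_real_derivative flat_exp (Suc k) t) (at t)"
      using 2 by (auto simp: flat_exp_def)
    then show ?thesis
      by (rule has_field_derivative_transform_within_open[of _ _ _ "{..<0}"]) (auto simp: flat_exp_def 2)
  next
    case 3
    have "((\<lambda>s. poly ([:0,1:] * flat_exp_poly k) s * exp (- s)) \<longlongrightarrow> 0) at_top"
      by (rule poly_exp_tendsto_0)
    then have "((\<lambda>t. poly ([:0,1:] * flat_exp_poly k) (inverse t) * exp (- inverse t)) \<longlongrightarrow> 0) (at_right 0)"
      by (rule filterlim_compose) (rule filterlim_inverse_at_top_right)
    then have r: "((\<lambda>t. (flat_exp k t - flat_exp k 0) / (t - 0)) \<longlongrightarrow> 0) (at_right 0)"
      by (rule Lim_transform_eventually)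
        (auto simp: eventually_at_filter flat_exp_def field_simps intro!: always_eventually)
    have l: "((\<lambda>t. (flat_exp k t - flat_exp k 0) / (t - 0)) \<longlongrightarrow> 0) (at_left 0)"
      by (rule Lim_transform_eventually[OF tendsto_const])
        (auto simp: eventually_at_filter flat_exp_def intro!: always_eventually)
    show ?thesis
      using l r 3 by (simp add: has_field_derivative_iff filterlim_at_split flat_exp_def)
  qed
qed

lemma flat_exp_pos: "flat_exp 0 t > 0 \<longleftrightarrow> t > 0" and flat_exp_nonneg: "flat_exp 0 t \<ge> 0"
  and flat_exp_nonpos: "t \<le> 0 \<Longrightarrow> flat_exp k t = 0" and flat_exp_le_1: "flat_exp 0 t \<le> 1"
  by (auto simp: flat_exp_def)

lemma flat_exp_cont: "continuous_on S (flat_exp k)"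
  using flat_exp_has_derivative[of k] DERIV_continuous_on has_field_derivative_at_within by blast

lemma smooth_flat_exp: "smooth f \<Longrightarrow> smooth (\<lambda>x. flat_exp k (f x))"
  by (rule smooth_comp[of UNIV flat_exp]) (auto intro: flat_exp_has_derivative)

lemma smooth_inverse:
  assumes "smooth f" "\<And>x. f x \<noteq> 0" shows "smooth (\<lambda>x. inverse (f x))"
proof -
  define D :: "nat \<Rightarrow> real \<Rightarrow> real" where "D k t = (-1)^k * fact k * inverse t ^ (Suc k)" for k t
  have "(D k has_real_derivative D (Suc k) t) (at t)" if "t \<in> -{0}" for k t
    unfolding D_def using that
    by (auto intro!: derivative_eq_intros simp: field_simps power2_eq_square simp del: power_Suc)
       (auto simp: field_simps power_Suc)
  from smooth_comp[of "-{0}" D, OF this assms(1), of 0] show ?thesis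
    using assms(2) by (force simp: D_def)
qed

definition smooth_step :: "real \<Rightarrow> real" where
  "smooth_step t = flat_exp 0 (1 - t) * inverse (flat_exp 0 t + flat_exp 0 (1 - t))"

definition smooth_step_deriv :: "real \<Rightarrow> real" where
  "smooth_step_deriv t = - (flat_exp 1 (1 - t) * flat_exp 0 t + flat_exp 0 (1 - t) * flat_exp 1 t)
     / (flat_exp 0 t + flat_exp 0 (1 - t))^2"

lemma flat_exp_denominator: "flat_exp 0 t + flat_exp 0 (1 - t) > 0"
  using flat_exp_pos[of t] flat_exp_pos[of "1-t"] flat_exp_nonneg[of t] flat_exp_nonneg[of "1-t"]
  by (cases "t > 0") linarith+

lemma smooth_step_has_derivative: "(smooth_step has_real_derivative smooth_step_deriv t) (at t)"
proof -
  have c: "((\<lambda>t. flat_exp 0 (1 - t)) has_real_derivative - flat_exp 1 (1 - t)) (at t)"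
    using DERIV_chain2[where f="flat_exp 0" and g="\<lambda>t. 1 - t" and x=t and Db="-1",
        OF flat_exp_has_derivative[of 0 "1 - t"]]
      DERIV_diff[OF DERIV_const[of 1] DERIV_ident, of t UNIV] by simp
  show ?thesis
    unfolding smooth_step_def[abs_def] smooth_step_deriv_def
    using flat_exp_denominator[of t] flat_exp_has_derivative[of 0 t]
    by (auto intro!: derivative_eq_intros c simp: field_simps power2_eq_square)
qed

lemma smooth_step_bounds: "0 \<le> smooth_step t" "smooth_step t \<le> 1"
  and smooth_step_1: "t \<le> 0 \<Longrightarrow> smooth_step t = 1" and smooth_step_0: "t \<ge> 1 \<Longrightarrow> smooth_step t = 0"
  and smooth_step_deriv_0: "t \<notin> {0<..<1} \<Longrightarrow> smooth_step_deriv t = 0"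
  using flat_exp_denominator[of t] flat_exp_nonneg[of t] flat_exp_nonneg[of "1-t"]
  by (auto simp: smooth_step_def smooth_step_deriv_def divide_inverse[symmetric] flat_exp_nonpos not_less)

lemma smooth_step_deriv_bounded: "\<exists>C>0. \<forall>t. \<bar>smooth_step_deriv t\<bar> \<le> C"
proof -
  have "continuous_on {0..1} smooth_step_deriv"
    unfolding smooth_step_deriv_def[abs_def] using less_imp_neq[OF flat_exp_denominator]
    by (intro continuous_intros continuous_on_compose2[OF flat_exp_cont[of UNIV]]) force+
  then have "bounded (smooth_step_deriv ` {0..1})"
    by (intro compact_imp_bounded compact_continuous_image) auto
  then obtain C where C: "C > 0" "\<And>t. t \<in> {0..1} \<Longrightarrow> \<bar>smooth_step_deriv t\<bar> \<le> C"
    unfolding bounded_pos by auto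
  have "\<bar>smooth_step_deriv t\<bar> \<le> C" for t
    using C smooth_step_deriv_0[of t] by (cases "t \<in> {0..1}") auto
  with C(1) show ?thesis by blast
qed

subsection \<open>Test functions\<close>

lemma test_functionI:
  assumes "smooth f" "\<And>x. x \<notin> S \<Longrightarrow> f x = 0" "bounded S"
  shows "test_function f"
proof -
  have "{x. f x \<noteq> 0} \<subseteq> S" using assms(2) by auto
  then show ?thesis
    unfolding test_function_def using assms bounded_subset by (auto simp: compact_closure)
qed

lemma test_function_support:
  assumes "test_function f" obtains R where "R > 0" "\<And>x. x \<notin> ball 0 R \<Longrightarrow> f x = 0"
proof -
  have "bounded {x. f x \<noteq> 0}"
    using assms unfolding test_function_def by (simp add: compact_closure)
  then obtain R where "R > 0" "{x. f x \<noteq> 0} \<subseteq> ball 0 R"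
    using bounded_subset_ballD by blast
  then show ?thesis by (intro that[of R]) auto
qed

lemma test_function_smooth: "test_function f \<Longrightarrow> smooth f"
  by (simp add: test_function_def)

lemma partial_deriv_zero_on_open:
  assumes "open S" "x \<in> S" "\<And>y. y \<in> S \<Longrightarrow> f y = c"
  shows "partial_deriv i f x = 0"
proof -
  have "((\<lambda>_. c) has_derivative (\<lambda>_. 0)) (at x)" by simp
  then have "(f has_derivative (\<lambda>_. 0)) (at x)"
    by (rule has_derivative_transform_within_open[OF _ assms(1,2)]) (use assms(3) in auto)
  then show ?thesis by (simp add: partial_deriv_eq)
qed

lemma test_function_partial_deriv:
  assumes "test_function f" shows "test_function (partial_deriv i f)"
proof -
  obtain R where R: "R > 0" "\<And>x. x \<notin> ball 0 R \<Longrightarrow> f x = 0" using test_function_support[OF assms] by blast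
  have "partial_deriv i f x = 0" if "x \<notin> cball 0 R" for x
    by (rule partial_deriv_zero_on_open[of "-cball 0 R"]) (use that R in auto)
  then show ?thesis
    using smooth_partial_deriv[OF test_function_smooth[OF assms]] by (intro test_functionI[of _ "cball 0 R"]) auto
qed

lemma test_function_mult:
  assumes "smooth f" "test_function g" shows "test_function (\<lambda>x. f x * g x)"
proof -
  obtain R where R: "\<And>x. x \<notin> ball 0 R \<Longrightarrow> g x = 0" using test_function_support[OF assms(2)] by blast
  show ?thesis
    by (rule test_functionI[of _ "ball 0 R"])
      (use R assms in \<open>auto intro: smooth_mult test_function_smooth\<close>)
qed

lemma test_function_translation:
  assumes "test_function f" shows "test_function (\<lambda>x. f (x + a))"
proof -
  obtain R where R: "\<And>x. x \<notin> ball 0 R \<Longrightarrow> f x = 0" using test_function_support[OF assms(1)] by blast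
  show ?thesis
  proof (rule test_functionI[of _ "ball (-a) R"])
    fix x assume "x \<notin> ball (-a) R"
    then show "f (x + a) = 0" by (intro R) (auto simp: dist_norm norm_minus_commute add.commute)
  qed (use assms in \<open>auto intro: smooth_translation test_function_smooth\<close>)
qed

lemma test_function_bounded:
  assumes "test_function f" obtains B where "B > 0" "\<And>x. \<bar>f x\<bar> \<le> B"
proof -
  obtain R where R: "\<And>x. x \<notin> ball 0 R \<Longrightarrow> f x = 0" using test_function_support[OF assms(1)] by blast
  have "bounded (f ` cball 0 R)"
    using smooth_continuous[OF test_function_smooth[OF assms]]
    by (intro compact_imp_bounded compact_continuous_image) (auto intro: continuous_on_subset)
  then obtain B where B: "B > 0" "\<And>x. x \<in> cball 0 R \<Longrightarrow> \<bar>f x\<bar> \<le> B"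
    unfolding bounded_pos by auto
  show ?thesis
  proof (rule that[OF B(1)])
    fix x show "\<bar>f x\<bar> \<le> B" using B R[of x] by (cases "x \<in> cball 0 R") auto
  qed
qed

lemma test_function_measurable: "test_function f \<Longrightarrow> f \<in> borel_measurable borel"
  by (intro borel_measurable_continuous_onI smooth_continuous test_function_smooth)

definition grad :: "(real^'n::finite \<Rightarrow> real) \<Rightarrow> real^'n \<Rightarrow> real^'n" where
  "grad \<psi> x = (\<chi> i. partial_deriv i \<psi> x)"

text \<open>Bumps that pass from 1 to 0 between concentric spheres, with the optimal order \<open>1/(t - s)\<close> of the
  gradient: the iteration needs this order because it uses ever closer spheres.\<close>

definition cutoff_bound :: "'n::finite itself \<Rightarrow> real \<Rightarrow> bool" where
  "cutoff_bound _ C \<longleftrightarrow> C > 0 \<and> (\<forall>(y::real^'n) s t. 0 < s \<and> s < t \<longrightarrow> (\<exists>\<psi>. test_function \<psi> \<and> (\<forall>x. 0 \<le> \<psi> x \<and> \<psi> x \<le> 1) \<and>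
     (\<forall>x\<in>ball y s. \<psi> x = 1) \<and> (\<forall>x. x \<notin> ball y t \<longrightarrow> \<psi> x = 0 \<and> grad \<psi> x = 0) \<and>
     (\<forall>x. norm (grad \<psi> x) \<le> C / (t - s))))"

text \<open>Compose the step with \<open>(|x - y|\<^sup>2 - s\<^sup>2) / (t\<^sup>2 - s\<^sup>2)\<close>, whose gradient \<open>2(x - y) / (t\<^sup>2 - s\<^sup>2)\<close> has norm at most
  \<open>2 / (t - s)\<close> in the larger ball.\<close>

lemma cutoff_bound_exists: "\<exists>C. cutoff_bound TYPE('n::finite) C"
proof -
  obtain C where C: "C > 0" "\<And>t. \<bar>smooth_step_deriv t\<bar> \<le> C"
    using smooth_step_deriv_bounded by blast
  show ?thesis
    unfolding cutoff_bound_def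
  proof (intro exI[of _ "2 * C"] conjI allI impI)
    show "2 * C > 0" using C by simp
    fix y :: "real^'n" and s t :: real assume st: "0 < s \<and> s < t"
    define q where "q x = (\<Sum>i\<in>UNIV. (x $ i - y $ i)\<^sup>2) * inverse (t\<^sup>2 - s\<^sup>2) - s\<^sup>2 * inverse (t\<^sup>2 - s\<^sup>2)" for x
    define \<psi> where "\<psi> x = smooth_step (q x)" for x
    have ts: "t\<^sup>2 - s\<^sup>2 > 0" using st by (simp add: power_strict_mono)
    have q: "q x = ((dist y x)\<^sup>2 - s\<^sup>2) / (t\<^sup>2 - s\<^sup>2)" for x
      by (simp add: q_def dist_vec_def L2_set_def sum_nonneg dist_real_def divide_inverse
          left_diff_distrib power2_commute)
    have sq: "smooth q"
      unfolding q_def[abs_def]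
      by (intro smooth_diff smooth_mult smooth_sum smooth_power smooth_const smooth_coordinate) auto
    have s\<psi>: "smooth \<psi>"
      unfolding \<psi>_def[abs_def] smooth_step_def
      by (intro smooth_mult smooth_flat_exp smooth_diff smooth_const sq smooth_inverse smooth_add
          less_imp_neq[OF flat_exp_denominator, symmetric])
    have q0: "q x \<le> 0" if "x \<in> ball y s" for x
      unfolding q using that ts by (auto simp: divide_le_0_iff power_mono)
    have q1: "q x \<ge> 1" if "x \<notin> ball y t" for x
      unfolding q using that ts st by (auto simp: le_divide_eq intro!: power_mono)
    have dq: "(q has_derivative (\<lambda>h. (\<Sum>i\<in>UNIV. 2 * (x $ i - y $ i) * h $ i) * inverse (t\<^sup>2 - s\<^sup>2))) (at x)" for x
      unfolding q_def
      by (auto intro!: derivative_eq_intros bounded_linear_imp_has_derivative[OF bounded_linear_vec_nth]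
          simp: algebra_simps)
    have "partial_deriv i q x = 2 * (x $ i - y $ i) / (t\<^sup>2 - s\<^sup>2)" for x i
      by (subst partial_deriv_eq[OF dq]) (simp add: axis_def if_distrib divide_inverse cong: if_cong)
    moreover have "partial_deriv i \<psi> x = smooth_step_deriv (q x) * partial_deriv i q x" for x i
      unfolding \<psi>_def[abs_def]
      by (intro partial_deriv_comp smooth_differentiable sq smooth_step_has_derivative)
    ultimately have g\<psi>: "grad \<psi> x = (smooth_step_deriv (q x) * 2 / (t\<^sup>2 - s\<^sup>2)) *\<^sub>R (x - y)" for x
      by (simp add: grad_def vec_eq_iff)
    have g0: "grad \<psi> x = 0" if "x \<notin> ball y t" for x
      using q1[OF that] by (simp add: g\<psi> smooth_step_deriv_0)
    have bnd: "norm (grad \<psi> x) \<le> 2 * C / (t - s)" for x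
    proof (cases "x \<in> ball y t")
      case True
      then have "norm (x - y) \<le> t" by (simp add: dist_norm norm_minus_commute)
      then have "2 * norm (x - y) / (t\<^sup>2 - s\<^sup>2) \<le> 2 * t / (t\<^sup>2 - s\<^sup>2)"
        using ts by (intro divide_right_mono) auto
      also have "\<dots> = 2 * t / (t + s) / (t - s)"
        using st by (simp add: power2_eq_square square_diff_square_factored)
      also have "\<dots> \<le> 2 / (t - s)"
        using st by (intro divide_right_mono) (auto simp: divide_le_eq)
      finally have "\<bar>smooth_step_deriv (q x)\<bar> * (2 * norm (x - y) / (t\<^sup>2 - s\<^sup>2)) \<le> C * (2 / (t - s))"
        using C ts by (intro mult_mono) auto
      then show ?thesis unfolding g\<psi> using ts by (simp add: abs_mult mult_ac)
    next
      case False
      then show ?thesis using g0[OF False] C st by simp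
    qed
    have "test_function \<psi>"
      by (rule test_functionI[OF s\<psi>, of "ball y t"]) (simp_all add: \<psi>_def smooth_step_0 q1)
    moreover have "0 \<le> \<psi> x \<and> \<psi> x \<le> 1" for x by (simp add: \<psi>_def smooth_step_bounds)
    moreover have "\<psi> x = 1" if "x \<in> ball y s" for x
      using q0[OF that] by (simp add: \<psi>_def smooth_step_1)
    moreover have "\<psi> x = 0" if "x \<notin> ball y t" for x
      using q1[OF that] by (simp add: \<psi>_def smooth_step_0)
    ultimately show "\<exists>\<psi>. test_function \<psi> \<and> (\<forall>x. 0 \<le> \<psi> x \<and> \<psi> x \<le> 1) \<and>
     (\<forall>x\<in>ball y s. \<psi> x = 1) \<and> (\<forall>x. x \<notin> ball y t \<longrightarrow> \<psi> x = 0 \<and> grad \<psi> x = 0) \<and>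
     (\<forall>x. norm (grad \<psi> x) \<le> 2 * C / (t - s))"
      using g0 bnd by blast
  qed
qed

lemma cutoff_ball:
  fixes R :: real
  assumes "R > 0"
  obtains \<psi> :: "real^'n::finite \<Rightarrow> real" where "test_function \<psi>" "\<And>x. 0 \<le> \<psi> x" "\<And>x. \<psi> x \<le> 1"
    "\<And>x. x \<in> ball 0 R \<Longrightarrow> \<psi> x = 1"
proof -
  have "\<exists>\<psi>::real^'n \<Rightarrow> real. test_function \<psi> \<and> (\<forall>x. 0 \<le> \<psi> x \<and> \<psi> x \<le> 1) \<and> (\<forall>x\<in>ball 0 R. \<psi> x = 1)"
  proof -
    obtain C where "cutoff_bound TYPE('n) C" using cutoff_bound_exists by blast
    then show ?thesis using assms less_add_one[of R] unfolding cutoff_bound_def by blast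
  qed
  then show ?thesis using that by auto
qed

text \<open>If \<open>0 \<le> \<phi> \<le> 1\<close> is positive exactly on the box, then \<open>1 - (1 - \<phi>)\<^sup>k\<close> is a test function
  that increases to the indicator of the box.\<close>

lemma box_indicator_limit_of_test_functions:
  fixes a b :: "real^'n::finite"
  obtains \<phi> :: "nat \<Rightarrow> real^'n \<Rightarrow> real" where "\<And>k. test_function (\<phi> k)" "\<And>k x. \<bar>\<phi> k x\<bar> \<le> 1"
    "\<And>x. (\<lambda>k. \<phi> k x) \<longlonglongrightarrow> indicator (box a b) x"
proof -
  define p where "p x = (\<Prod>i\<in>UNIV. flat_exp 0 (x $ i - a $ i) * flat_exp 0 (b $ i - x $ i))" for x
  have sp: "smooth p" unfolding p_def[abs_def]
    by (intro smooth_prod smooth_mult smooth_flat_exp smooth_diff smooth_const smooth_coordinate) auto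
  have p01: "0 \<le> p x" "p x \<le> 1" for x
    unfolding p_def by (auto intro!: prod_nonneg prod_le_1 mult_le_one simp: flat_exp_nonneg flat_exp_le_1)
  have p0: "p x = 0 \<longleftrightarrow> x \<notin> box a b" for x
  proof -
    have "flat_exp 0 t = 0 \<longleftrightarrow> \<not> t > 0" for t
      using flat_exp_pos[of t] flat_exp_nonneg[of t] by linarith
    then show ?thesis by (auto simp: p_def mem_box_cart)
  qed
  then have p0': "p x = 0" if "x \<notin> box a b" for x using that by simp
  show ?thesis
  proof (rule that[of "\<lambda>k x. 1 - (1 - p x) ^ k"])
    fix k x
    show "test_function (\<lambda>x. 1 - (1 - p x) ^ k)"
      by (rule test_functionI[of _ "box a b"]) (simp_all add: p0' smooth_diff smooth_power sp)
    show "\<bar>1 - (1 - p x) ^ k\<bar> \<le> 1"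
      using p01[of x] by (simp add: power_le_one)
  next
    fix x
    show "(\<lambda>k. 1 - (1 - p x) ^ k) \<longlonglongrightarrow> indicator (box a b) x"
    proof (cases "x \<in> box a b")
      case True
      then have "(\<lambda>k. 1 - (1 - p x) ^ k) \<longlonglongrightarrow> 1 - 0"
        using p01[of x] p0[of x] by (intro tendsto_intros LIMSEQ_realpow_zero) (auto simp: less_le)
      then show ?thesis using True by simp
    qed (simp add: p0')
  qed
qed

section \<open>Translations and the fundamental lemma in L1\<close>

lemma lborel_distr_translate: "distr lborel borel (\<lambda>x. x + c) = (lborel :: 'a::euclidean_space measure)"
proof -
  have "(\<lambda>x. x + c) = (+) c" by (auto simp: fun_eq_iff add.commute)
  then show ?thesis using lborel_distr_plus[of c] by simp
qed

lemma lborel_integral_translate: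
  fixes f :: "'a::euclidean_space \<Rightarrow> 'b::{banach, second_countable_topology}"
  assumes [measurable]: "f \<in> borel_measurable borel"
  shows "(LINT x|lborel. f (x + c)) = (LINT x|lborel. f x)"
  using integral_distr[of "\<lambda>x. x + c" lborel borel f] by (simp add: lborel_distr_translate)

lemma lborel_integrable_translate:
  fixes f :: "'a::euclidean_space \<Rightarrow> 'b::{banach, second_countable_topology}"
  assumes "integrable lborel f"
  shows "integrable lborel (\<lambda>x. f (x + c))"
  using assms integrable_distr_eq[of "\<lambda>x. x + c" lborel borel f] 
  by (simp add: lborel_distr_translate)

lemma lborel_nn_integral_translate:
  fixes f :: "'a::euclidean_space \<Rightarrow> ennreal"
  assumes [measurable]: "f \<in> borel_measurable borel"
  shows "(\<integral>\<^sup>+x. f (x + c) \<partial>lborel) = (\<integral>\<^sup>+x. f x \<partial>lborel)"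
  using nn_integral_distr[of "\<lambda>x. x + c" lborel borel f] by (simp add: lborel_distr_translate)

lemma translate_norm_le:
  fixes f :: "'a::euclidean_space \<Rightarrow> 'b::{banach, second_countable_topology}"
  assumes f: "integrable lborel f"
  shows "(LINT x|lborel. norm (f (x + z) - f x)) \<le> 2 * (LINT x|lborel. norm (f x))"
proof -
  have "(LINT x|lborel. norm (f (x + z) - f x)) \<le> (LINT x|lborel. norm (f (x + z)) + norm (f x))"
    using lborel_integrable_translate[OF f] f by (intro integral_mono) (auto intro: norm_triangle_ineq4)
  also have "\<dots> = 2 * (LINT x|lborel. norm (f x))"
    using lborel_integrable_translate[OF f] f borel_measurable_integrable[OF f]
      lborel_integral_translate[of "\<lambda>x. norm (f x)" z] by simp
  finally show ?thesis .
qed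

text \<open>For an open set \<open>U\<close> of finite measure, \<open>|U \<setminus> (U - z)| \<rightarrow> 0\<close> by dominated convergence, and
  \<open>(U - z) \<setminus> U\<close> has the same measure. Outer regularity and density of simple functions give the
  general case.\<close>

lemma translation_continuous_sequentially:
  fixes f :: "'a::euclidean_space \<Rightarrow> 'b::{banach, second_countable_topology}" and z :: "nat \<Rightarrow> 'a"
  assumes "integrable lborel f" and z: "z \<longlonglongrightarrow> 0"
  shows "(\<lambda>k. LINT x|lborel. norm (f (x + z k) - f x)) \<longlonglongrightarrow> 0"
proof -
  note tr = lborel_integrable_translate
  have subadd: "(LINT x|lborel. norm (f (x + z k) + g (x + z k) - (f x + g x)))
      \<le> (LINT x|lborel. norm (f (x + z k) - f x)) + (LINT x|lborel. norm (g (x + z k) - g x))"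
    if f: "integrable lborel f" and g: "integrable lborel g" for f g :: "'a \<Rightarrow> 'b" and k
  proof -
    have "(LINT x|lborel. norm (f (x + z k) + g (x + z k) - (f x + g x))) \<le>
      (LINT x|lborel. norm (f (x + z k) - f x) + norm (g (x + z k) - g x))"
      using tr[OF f] tr[OF g] f g by (intro integral_mono) (auto simp: add_diff_add norm_triangle_ineq)
    then show ?thesis using tr[OF f] tr[OF g] f g by simp
  qed
  \<comment> \<open>The property is stable under approximation in L1.\<close>
  have approx: "(\<lambda>k. LINT x|lborel. norm (f (x + z k) - f x)) \<longlonglongrightarrow> 0"
    if f: "integrable lborel f" and ap: "\<And>e. e > 0 \<Longrightarrow> \<exists>g. integrable lborel g \<and> (LINT x|lborel. norm (f x - g x)) < e \<and>
      (\<lambda>k. LINT x|lborel. norm (g (x + z k) - g x)) \<longlonglongrightarrow> 0"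
    for f :: "'a \<Rightarrow> 'b"
  proof (rule LIMSEQ_I)
    fix r :: real assume "r > 0"
    then obtain g where g: "integrable lborel g" "(LINT x|lborel. norm (f x - g x)) < r/4"
      "(\<lambda>k. LINT x|lborel. norm (g (x + z k) - g x)) \<longlonglongrightarrow> 0"
      using ap[of "r/4"] by auto
    obtain no where no: "\<And>n. n \<ge> no \<Longrightarrow> norm ((LINT x|lborel. norm (g (x + z n) - g x)) - 0) < r/2"
      using LIMSEQ_D[OF g(3), of "r/2"] \<open>r > 0\<close> by auto
    have fg: "integrable lborel (\<lambda>x. f x - g x)" using f g by auto
    show "\<exists>no. \<forall>n\<ge>no. norm ((LINT x|lborel. norm (f (x + z n) - f x)) - 0) < r"
    proof (intro exI allI impI)
      fix n assume n: "n \<ge> no"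
      have "(LINT x|lborel. norm (f (x + z n) - f x)) \<le> (LINT x|lborel. norm (g (x + z n) - g x))
          + (LINT x|lborel. norm (f (x + z n) - g (x + z n) - (f x - g x)))"
        using subadd[OF g(1) fg, of n] by simp
      moreover have "(LINT x|lborel. norm (g (x + z n) - g x)) < r/2"
        using no[OF n] by (simp add: abs_of_nonneg)
      ultimately show "norm ((LINT x|lborel. norm (f (x + z n) - f x)) - 0) < r"
        using translate_norm_le[OF fg, of "z n"] g(2) by (simp add: abs_of_nonneg)
    qed
  qed
  have openset: "(\<lambda>k. LINT x|lborel. norm (indicator U (x + z k) *\<^sub>R c - indicator U x *\<^sub>R c)) \<longlonglongrightarrow> 0"
    if U: "open U" "emeasure lborel U < \<infinity>" for U :: "'a set" and c :: 'b
  proof -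
    have [measurable]: "U \<in> sets borel" using U by simp
    have iU: "integrable lborel (indicator U :: 'a \<Rightarrow> real)" using U by simp
    have i2: "integrable lborel (\<lambda>x. indicator U x * (indicator U (x + z k) :: real))" for k
      by (rule Bochner_Integration.integrable_bound[OF iU]) (auto simp: indicator_def)
    have l: "(\<lambda>k. LINT x|lborel. indicator U x * (1 - indicator U (x + z k) :: real)) \<longlonglongrightarrow> (LINT x|(lborel::'a measure). 0)"
    proof (rule integral_dominated_convergence[where w="indicator U"])
      show "AE x in lborel. (\<lambda>k. indicator U x * (1 - indicator U (x + z k) :: real)) \<longlonglongrightarrow> 0"
      proof (rule AE_I2)
        fix x :: 'a
        show "(\<lambda>k. indicator U x * (1 - indicator U (x + z k) :: real)) \<longlonglongrightarrow> 0"
        proof (cases "x \<in> U")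
          case True
          have "(\<lambda>k. x + z k) \<longlonglongrightarrow> x" using tendsto_add[OF tendsto_const[of x] z] by simp
          then have "eventually (\<lambda>k. x + z k \<in> U) sequentially"
            using topological_tendstoD U(1) True by blast
          then have "eventually (\<lambda>k. 0 = indicator U x * (1 - indicator U (x + z k) :: real)) sequentially"
            by eventually_elim simp
          then show ?thesis by (rule Lim_transform_eventually[OF tendsto_const])
        qed simp
      qed
      show "AE x in lborel. norm (indicator U x * (1 - indicator U (x + z k) :: real)) \<le> indicator U x" for k
        by (auto simp: indicator_def)
    qed (use iU in auto)
    have "(LINT x|lborel. norm (indicator U (x + z k) *\<^sub>R c - indicator U x *\<^sub>R c)) =
      2 * norm c * (LINT x|lborel. indicator U x * (1 - indicator U (x + z k) :: real))" for k
    proof -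
      have "norm (indicator U (x + z k) *\<^sub>R c - indicator U x *\<^sub>R c) =
        norm c * (indicator U (x + z k) + indicator U x - 2 * (indicator U x * indicator U (x + z k)))" for x
        by (auto simp: indicator_def)
      then have "(LINT x|lborel. norm (indicator U (x + z k) *\<^sub>R c - indicator U x *\<^sub>R c)) =
         (LINT x|lborel. norm c * (indicator U (x + z k) + indicator U x - 2 * (indicator U x * indicator U (x + z k))))"
        by simp
      also have "\<dots> = norm c * ((LINT x|lborel. indicator U (x + z k)) + (LINT x|lborel. indicator U x)
          - 2 * (LINT x|lborel. indicator U x * indicator U (x + z k)))"
        using lborel_integrable_translate[OF iU, of "z k"] iU i2[of k] by simp
      also have "(LINT x|lborel. indicator U (x + z k)) = (LINT x|lborel. (indicator U x :: real))"
        by (rule lborel_integral_translate) simp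
      finally show ?thesis
        using iU i2[of k] by (simp add: right_diff_distrib)
    qed
    then show ?thesis
      using tendsto_mult[OF tendsto_const[of "2 * norm c"] l] by simp
  qed
  from assms(1) show ?thesis
  proof (induction rule: integrable_induct)
    case (base A c)
    then have A: "A \<in> sets borel" by simp
    have iA: "integrable lborel (\<lambda>x. indicator A x *\<^sub>R c)" using base by simp
    show ?case
    proof (rule approx[OF iA])
      fix e :: real assume "e > 0"
      define e' where "e' = e / (norm c + 1)"
      have e': "e' > 0" using \<open>e > 0\<close> by (simp add: e'_def add_nonneg_pos)
      obtain U where U: "open U" "A \<subseteq> U" "emeasure lborel (U - A) < e'"
        using outer_regular_lborel[OF A e'] by metis
      have "emeasure lborel U \<le> emeasure lborel A + emeasure lborel (U - A)"
        using U A by (metis Diff_partition borel_open emeasure_subadditive sets.Diff sets_lborel)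
      then have fU: "emeasure lborel U < \<infinity>"
        using U(3) base(2) by (metis ennreal_add_eq_top infinity_ennreal_def less_top order_le_less_trans ennreal_less_top order_less_trans)
      have fin: "emeasure lborel (U - A) < \<infinity>"
        using U(3) ennreal_less_top order_less_trans by (metis infinity_ennreal_def)
      have "norm (indicator A x *\<^sub>R c - indicator U x *\<^sub>R c) = norm c * indicator (U - A) x" for x
        using U(2) by (auto simp: indicator_def)
      then have "(LINT x|lborel. norm (indicator A x *\<^sub>R c - indicator U x *\<^sub>R c)) = norm c * measure lborel (U - A)"
        by simp
      also have "\<dots> \<le> norm c * e'"
      proof -
        have "measure lborel (U - A) \<le> e'"
          using U(3) e' by (simp add: measure_def enn2real_leI less_imp_le)
        then show ?thesis by (rule mult_left_mono) simp
      qed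
      also have "\<dots> < e"
      proof -
        have "norm c + 1 > 0" by (simp add: add_nonneg_pos)
        then show ?thesis unfolding e'_def using \<open>e > 0\<close> by (simp add: divide_less_eq algebra_simps)
      qed
      finally show "\<exists>g. integrable lborel g \<and> (LINT x|lborel. norm (indicator A x *\<^sub>R c - g x)) < e \<and>
         (\<lambda>k. LINT x|lborel. norm (g (x + z k) - g x)) \<longlonglongrightarrow> 0"
        using openset[OF U(1) fU, of c] fU U(1) by (intro exI[of _ "\<lambda>x. indicator U x *\<^sub>R c"]) simp
    qed
  next
    case (add f g)
    have "(\<lambda>k. (LINT x|lborel. norm (f (x + z k) - f x)) + (LINT x|lborel. norm (g (x + z k) - g x))) \<longlonglongrightarrow> 0 + 0"
      by (intro tendsto_add add.IH)
    then have "(\<lambda>k. (LINT x|lborel. norm (f (x + z k) - f x)) + (LINT x|lborel. norm (g (x + z k) - g x))) \<longlonglongrightarrow> 0"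
      by simp
    then show ?case
    proof (rule tendsto_0_le[where K=1], intro always_eventually allI)
      fix k
      show "norm (LINT x|lborel. norm (f (x + z k) + g (x + z k) - (f x + g x)))
        \<le> norm ((LINT x|lborel. norm (f (x + z k) - f x)) + (LINT x|lborel. norm (g (x + z k) - g x))) * 1"
        using subadd[OF add.hyps, of k] by (simp add: abs_of_nonneg)
    qed
  next
    case (lim f s)
    show ?case
    proof (rule approx[OF lim.hyps(4)])
      fix e :: real assume "e > 0"
      have "(\<lambda>i. LINT x|lborel. norm (f x - s i x)) \<longlonglongrightarrow> (LINT x|(lborel::'a measure). 0)"
      proof (rule integral_dominated_convergence[where w="\<lambda>x. 3 * norm (f x)"])
        show "AE x in lborel. (\<lambda>i. norm (f x - s i x)) \<longlonglongrightarrow> 0"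
        proof (rule AE_I2)
          fix x
          show "(\<lambda>i. norm (f x - s i x)) \<longlonglongrightarrow> 0"
            using tendsto_norm[OF tendsto_diff[OF tendsto_const[of "f x"] lim.hyps(2)[of x]]] by simp
        qed
        show "AE x in lborel. norm (norm (f x - s i x)) \<le> 3 * norm (f x)" for i
        proof (rule AE_I2)
          fix x show "norm (norm (f x - s i x)) \<le> 3 * norm (f x)"
            using lim.hyps(3)[of x i] norm_triangle_ineq4[of "f x" "s i x"] by simp
        qed
      qed (use lim.hyps in auto)
      then obtain i where "norm ((LINT x|lborel. norm (f x - s i x)) - 0) < e"
        using LIMSEQ_D[of _ _ e] \<open>e > 0\<close> by fastforce
      then show "\<exists>g. integrable lborel g \<and> (LINT x|lborel. norm (f x - g x)) < e \<and>
         (\<lambda>k. LINT x|lborel. norm (g (x + z k) - g x)) \<longlonglongrightarrow> 0"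
        using lim.IH lim.hyps(1) by (intro exI[of _ "s i"]) auto
    qed
  qed
qed

text \<open>The sets over which \<open>h\<close> integrates to zero include the boxes, as limits of test functions,
  and form a Dynkin system.\<close>

lemma zero_AE_if_test_integrals_zero:
  fixes h :: "real^'n::finite \<Rightarrow> real"
  assumes h: "integrable lborel h"
    and 0: "\<And>\<phi>. test_function \<phi> \<Longrightarrow> (LINT x|lborel. h x * \<phi> x) = 0"
  shows "AE x in lborel. h x = 0"
proof (rule sigma_finite_measure.density_zero[OF sigma_finite_lborel h])
  have box0: "set_lebesgue_integral lborel (box a b) h = 0" for a b :: "real^'n"
  proof -
    obtain \<phi> :: "nat \<Rightarrow> real^'n \<Rightarrow> real" where \<phi>: "\<And>k. test_function (\<phi> k)" "\<And>k x. \<bar>\<phi> k x\<bar> \<le> 1"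
      "\<And>x. (\<lambda>k. \<phi> k x) \<longlonglongrightarrow> indicator (box a b) x"
      using box_indicator_limit_of_test_functions by blast
    have [measurable]: "\<phi> k \<in> borel_measurable borel" for k by (rule test_function_measurable[OF \<phi>(1)])
    have "(\<lambda>k. LINT x|lborel. h x * \<phi> k x) \<longlonglongrightarrow> (LINT x|lborel. h x * indicator (box a b) x)"
    proof (rule integral_dominated_convergence[where w="\<lambda>x. \<bar>h x\<bar>"])
      show "AE x in lborel. norm (h x * \<phi> k x) \<le> \<bar>h x\<bar>" for k
        using \<phi>(2) by (auto simp: abs_mult intro!: AE_I2 mult_left_le)
    qed (use h \<phi>(3) in \<open>auto intro!: AE_I2 tendsto_mult\<close>)
    then show ?thesis
      unfolding set_lebesgue_integral_def using 0[OF \<phi>(1)]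
      by (simp add: LIMSEQ_const_iff mult.commute)
  qed
  have si: "set_integrable lborel A h" if "A \<in> sets borel" for A
    unfolding set_integrable_def using h that by (intro integrable_mult_indicator) auto
  have "set_lebesgue_integral lborel UNIV h = 0"
  proof (rule LIMSEQ_unique)
    show "(\<lambda>k. LINT x|lborel. indicator (box (- (real k *\<^sub>R One)) (real k *\<^sub>R One)) x * h x) \<longlonglongrightarrow> set_lebesgue_integral lborel UNIV h"
      unfolding set_lebesgue_integral_def
    proof (rule integral_dominated_convergence[where w="\<lambda>x. \<bar>h x\<bar>"])
      show "AE x in lborel. (\<lambda>k. indicator (box (- (real k *\<^sub>R One)) (real k *\<^sub>R One)) x * h x) \<longlonglongrightarrow> indicator UNIV x *\<^sub>R h x"
      proof (rule AE_I2)
        fix x :: "real^'n"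
        obtain N :: nat where N: "norm x < real N" using reals_Archimedean2 by blast
        have "x \<in> box (- (real k *\<^sub>R One)) (real k *\<^sub>R One)" if "k \<ge> N" for k
        proof -
          have "\<bar>x \<bullet> i\<bar> < real k" if "i \<in> Basis" for i
            using Basis_le_norm[OF that, of x] N \<open>k \<ge> N\<close> by linarith
          then show ?thesis by (auto simp: mem_box abs_less_iff minus_less_iff)
        qed
        then have "eventually (\<lambda>k. indicator UNIV x *\<^sub>R h x = indicator (box (- (real k *\<^sub>R One)) (real k *\<^sub>R One)) x * h x) sequentially"
          unfolding eventually_sequentially by (intro exI[of _ N]) simp
        then show "(\<lambda>k. indicator (box (- (real k *\<^sub>R One)) (real k *\<^sub>R One)) x * h x) \<longlonglongrightarrow> indicator UNIV x *\<^sub>R h x"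
          by (rule Lim_transform_eventually[OF tendsto_const])
      qed
    qed (use h in \<open>auto simp: indicator_def\<close>)
    show "(\<lambda>k. LINT x|lborel. indicator (box (- (real k *\<^sub>R One)) (real k *\<^sub>R One)) x * h x) \<longlonglongrightarrow> 0"
      using box0 by (simp add: set_lebesgue_integral_def)
  qed
  note univ0 = this
  fix A :: "(real^'n) set" assume "A \<in> sets lborel"
  then have A: "A \<in> sigma_sets UNIV (range (\<lambda>(a, b). box a b))"
    by (simp add: borel_eq_box)
  have "Int_stable (range (\<lambda>(a, b). box a b :: (real^'n) set))"
    unfolding Int_stable_def by (auto simp: box_Int_box)
  moreover have "range (\<lambda>(a, b). box a b :: (real^'n) set) \<subseteq> Pow UNIV" by simp
  ultimately show "set_lebesgue_integral lborel A h = 0"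
    using A
  proof (induction rule: sigma_sets_induct_disjoint)
    case (basic A)
    then show ?case using box0 by auto
  next
    case (compl A)
    then have A: "A \<in> sets borel" by (simp add: borel_eq_box)
    have "set_lebesgue_integral lborel (A \<union> (UNIV - A)) h = set_lebesgue_integral lborel A h + set_lebesgue_integral lborel (UNIV - A) h"
      using A by (intro set_integral_Un si) auto
    then show ?case using univ0 compl by simp
  next
    case (union A)
    then have A: "A i \<in> sets borel" for i by (simp add: borel_eq_box subset_eq)
    have "set_lebesgue_integral lborel (\<Union>i. A i) h = (\<Sum>i. set_lebesgue_integral lborel (A i) h)"
      using A union(1) si[of "\<Union>i. A i"]
      by (intro lebesgue_integral_countable_add) (auto simp: disjoint_family_on_def)
    then show ?case using union by simp
  qed (auto simp: set_lebesgue_integral_def)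
qed

section \<open>Weak gradients of integrable functions along segments\<close>

lemma integrable_mult_bounded:
  fixes f g :: "'a \<Rightarrow> real"
  assumes "integrable M f" "g \<in> borel_measurable M" "\<And>x. \<bar>g x\<bar> \<le> B"
  shows "integrable M (\<lambda>x. f x * g x)"
proof (rule Bochner_Integration.integrable_bound[of M "\<lambda>x. B * norm (f x)"])
  show "AE x in M. norm (f x * g x) \<le> norm (B * norm (f x))"
  proof (rule AE_I2)
    fix x
    have "\<bar>f x\<bar> * \<bar>g x\<bar> \<le> \<bar>f x\<bar> * B" by (intro mult_left_mono assms) simp
    moreover have "0 \<le> B" using assms(3)[of x] by linarith
    ultimately show "norm (f x * g x) \<le> norm (B * norm (f x))" by (simp add: abs_mult mult.commute)
  qed
qed (use assms in auto)

text \<open>Lebesgue measure on \<open>[0,1]\<close>, as a density: all Borel sets of the line stay measurable, so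
  functions along a segment need no restriction of their domain.\<close>

definition unit_measure :: "real measure" where
  "unit_measure = density lborel (indicator {0..1})"

lemma sets_unit_measure [simp, measurable_cong]: "sets unit_measure = sets borel"
  and space_unit_measure [simp]: "space unit_measure = UNIV"
  by (auto simp: unit_measure_def)

lemma measurable_unit_measure_eq [simp]: "measurable unit_measure N = measurable borel N"
  by (intro measurable_cong_sets) auto

interpretation unit_measure: prob_space unit_measure
  by (rule prob_spaceI) (simp add: unit_measure_def emeasure_density)

lemma prob_unit_measure_UNIV [simp]: "measure unit_measure UNIV = 1"
  using unit_measure.prob_space by simp

lemma AE_unit_measure: "AE s in unit_measure. 0 \<le> s \<and> s \<le> 1"
  unfolding unit_measure_def by (subst AE_density) (auto simp: indicator_def)

lemma integral_unit_measure:
  fixes f :: "real \<Rightarrow> 'b::{banach, second_countable_topology}"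
  assumes "f \<in> borel_measurable borel"
  shows "(LINT s|unit_measure. f s) = (LINT s|lborel. indicator {0..1} s *\<^sub>R f s)"
  unfolding unit_measure_def using integral_density[of f lborel "indicator {0..1}"] assms
  by (simp add: ennreal_indicator)

lemma unit_measure_FTC:
  assumes "\<And>s. (F has_real_derivative f s) (at s)" "continuous_on UNIV f"
  shows "(LINT s|unit_measure. f s) = F 1 - F 0"
proof -
  have "f \<in> borel_measurable borel" by (rule borel_measurable_continuous_onI[OF assms(2)])
  moreover have "(LINT s|lborel. f s * indicator {0..1} s) = F 1 - F 0"
    using assms by (intro integral_FTC_Icc_real) (auto simp: continuous_on_eq_continuous_at)
  ultimately show ?thesis by (simp add: integral_unit_measure mult.commute)
qed

interpretation unit_lborel: pair_sigma_finite unit_measure "lborel :: 'a::euclidean_space measure" ..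

lemma integrable_along_segments:
  fixes f :: "'a::euclidean_space \<Rightarrow> 'b::{banach, second_countable_topology}"
  assumes "integrable lborel f"
  shows "integrable (unit_measure \<Otimes>\<^sub>M lborel) (\<lambda>(s, x). f (x + s *\<^sub>R z))"
proof (rule unit_lborel.Fubini_integrable)
  have [measurable]: "f \<in> borel_measurable borel" using assms by auto
  show "(\<lambda>(s, x). f (x + s *\<^sub>R z)) \<in> borel_measurable (unit_measure \<Otimes>\<^sub>M lborel)" by measurable
  have "(LINT x|lborel. norm (f (x + s *\<^sub>R z))) = (LINT x|lborel. norm (f x))" for s
    by (rule lborel_integral_translate[of "\<lambda>x. norm (f x)"]) simp
  then show "integrable unit_measure (\<lambda>s. LINT x|lborel. norm (case (s, x) of (s, x) \<Rightarrow> f (x + s *\<^sub>R z)))"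
    by simp
qed (use lborel_integrable_translate[OF assms] in auto)

text \<open>Global integrability allows translations and Fubini; local statements are reduced to
  this situation by a cutoff, see \<open>weak_gradient_representative\<close> below.\<close>

definition L1_weak_gradient :: "(real^'n::finite \<Rightarrow> real) \<Rightarrow> (real^'n \<Rightarrow> real^'n) \<Rightarrow> bool" where
  "L1_weak_gradient w H \<longleftrightarrow> integrable lborel w \<and> integrable lborel H \<and>
     (\<forall>\<phi> i. test_function \<phi> \<longrightarrow>
        (LINT x|lborel. w x * partial_deriv i \<phi> x) = - (LINT x|lborel. H x $ i * \<phi> x))"

lemma integrable_vec_nth: "integrable M H \<Longrightarrow> integrable M (\<lambda>x. H x $ i)"
  for H :: "'a \<Rightarrow> real^'n::finite"
  by (rule integrable_bounded_linear[OF bounded_linear_vec_nth])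

lemma smooth_derivative_along_line:
  fixes f :: "real^'n::finite \<Rightarrow> real"
  assumes "smooth f"
  shows "((\<lambda>s. f (x - s *\<^sub>R z)) has_real_derivative - (\<Sum>i\<in>UNIV. z $ i * partial_deriv i f (x - s *\<^sub>R z))) (at s)"
proof -
  have "((\<lambda>s. x - s *\<^sub>R z) has_derivative (\<lambda>t. - t *\<^sub>R z)) (at s)"
    by (auto intro!: derivative_eq_intros)
  from diff_chain_at[OF this smooth_has_derivative[OF assms]]
  show ?thesis
    unfolding has_field_derivative_def o_def
    by (rule has_derivative_eq_rhs) (auto simp: sum_distrib_left sum_negf mult_ac)
qed

lemma integrable_vec_mult_test:
  fixes H :: "real^'n::finite \<Rightarrow> real^'n"
  assumes "integrable lborel H" "test_function \<phi>" shows "integrable lborel (\<lambda>x. H x $ i * \<phi> x)"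
proof -
  obtain B where "\<And>x. \<bar>\<phi> x\<bar> \<le> B" using test_function_bounded[OF assms(2)] by blast
  then show ?thesis
    by (intro integrable_mult_bounded[where B=B])
      (simp_all add: integrable_vec_nth[OF assms(1)] test_function_measurable[OF assms(2)])
qed

text \<open>Tested against \<open>\<phi>\<close>, the increment of \<open>w\<close> becomes an increment of \<open>\<phi>\<close>, to which the fundamental theorem
  of calculus applies. After Fubini, the derivative of \<open>\<phi>\<close> goes back to \<open>w\<close> by the definition of a weak gradient.\<close>

lemma L1_weak_gradient_increment:
  fixes w :: "real^'n::finite \<Rightarrow> real"
  assumes "L1_weak_gradient w H"
  shows "AE x in lborel. w (x + z) - w x = (LINT s|unit_measure. H (x + s *\<^sub>R z) \<bullet> z)"
proof -
  have w: "integrable lborel w" and H: "integrable lborel H"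
    and wg: "\<And>\<phi> i. test_function \<phi> \<Longrightarrow> (LINT x|lborel. w x * partial_deriv i \<phi> x) = - (LINT x|lborel. H x $ i * \<phi> x)"
    using assms by (auto simp: L1_weak_gradient_def)
  have [measurable]: "w \<in> borel_measurable borel" "H \<in> borel_measurable borel" using w H by auto
  have Hz: "integrable lborel (\<lambda>x. H x \<bullet> z)" using H by auto
  define T where "T x = (LINT s|unit_measure. H (x + s *\<^sub>R z) \<bullet> z)" for x
  note seg = integrable_along_segments[OF Hz, of z]
  have T: "integrable lborel T"
    unfolding T_def by (rule unit_lborel.integrable_snd[OF seg])
  have "AE x in lborel. (w (x + z) - w x) - T x = 0"
  proof (rule zero_AE_if_test_integrals_zero)
    show "integrable lborel (\<lambda>x. (w (x + z) - w x) - T x)"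
      using lborel_integrable_translate[OF w] w T by auto
    fix \<phi> :: "real^'n \<Rightarrow> real" assume \<phi>: "test_function \<phi>"
    obtain B where B: "\<And>x. \<bar>\<phi> x\<bar> \<le> B" using test_function_bounded[OF \<phi>] by blast
    have [measurable]: "\<phi> \<in> borel_measurable borel" by (rule test_function_measurable[OF \<phi>])
    define \<psi> where "\<psi> x = (\<Sum>i\<in>UNIV. z $ i * partial_deriv i \<phi> x)" for x
    have \<psi>: "test_function \<psi>"
    proof -
      obtain R where R: "\<And>i x. x \<notin> ball 0 R \<Longrightarrow> partial_deriv i \<phi> x = 0"
      proof -
        obtain R where R: "\<And>x. x \<notin> ball 0 R \<Longrightarrow> \<phi> x = 0" using test_function_support[OF \<phi>] by blast
        have "partial_deriv i \<phi> x = 0" if "x \<notin> ball 0 (R + 1)" for i x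
          by (rule partial_deriv_zero_on_open[of "- cball 0 R"]) (use that R in auto)
        then show ?thesis using that by blast
      qed
      show ?thesis
        unfolding \<psi>_def[abs_def]
        by (rule test_functionI[of _ "ball 0 R"])
          (simp_all add: R smooth_sum smooth_mult smooth_partial_deriv test_function_smooth[OF \<phi>])
    qed
    obtain C where C: "\<And>x. \<bar>\<psi> x\<bar> \<le> C" using test_function_bounded[OF \<psi>] by blast
    have [measurable]: "\<psi> \<in> borel_measurable borel" by (rule test_function_measurable[OF \<psi>])
    have ftc: "\<phi> (x - z) - \<phi> x = - (LINT s|unit_measure. \<psi> (x - s *\<^sub>R z))" for x
    proof -
      have "((\<lambda>s. \<phi> (x - s *\<^sub>R z)) has_real_derivative - \<psi> (x - s *\<^sub>R z)) (at s)" for s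
        unfolding \<psi>_def by (rule smooth_derivative_along_line[OF test_function_smooth[OF \<phi>]])
      moreover have "continuous_on UNIV (\<lambda>s. - \<psi> (x - s *\<^sub>R z))"
        by (intro continuous_intros continuous_on_compose2[OF smooth_continuous[OF test_function_smooth[OF \<psi>]]]) auto
      ultimately show ?thesis
        using unit_measure_FTC[of "\<lambda>s. \<phi> (x - s *\<^sub>R z)" "\<lambda>s. - \<psi> (x - s *\<^sub>R z)"] by simp
    qed
    have inner: "(LINT x|lborel. w x * \<psi> (x - s *\<^sub>R z)) = - (LINT x|lborel. (H (x + s *\<^sub>R z) \<bullet> z) * \<phi> x)" for s
    proof -
      have t\<phi>: "test_function (\<lambda>x. \<phi> (x + - (s *\<^sub>R z)))" by (rule test_function_translation[OF \<phi>])
      have pd: "partial_deriv i (\<lambda>x. \<phi> (x + - (s *\<^sub>R z))) x = partial_deriv i \<phi> (x - s *\<^sub>R z)" for i x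
        using partial_deriv_translation[OF test_function_smooth[OF \<phi>], of i "- (s *\<^sub>R z)" x] by simp
      have i1: "integrable lborel (\<lambda>x. w x * partial_deriv i (\<lambda>x. \<phi> (x + - (s *\<^sub>R z))) x)" for i
      proof -
        note tp = test_function_partial_deriv[OF t\<phi>, of i]
        obtain D where "\<And>x. \<bar>partial_deriv i (\<lambda>x. \<phi> (x + - (s *\<^sub>R z))) x\<bar> \<le> D" 
          using test_function_bounded[OF tp] by blast
        then show ?thesis using test_function_measurable[OF tp] by (intro integrable_mult_bounded[OF w]) auto
      qed
      note i2 = integrable_vec_mult_test[OF H t\<phi>]
      have "(LINT x|lborel. w x * \<psi> (x - s *\<^sub>R z)) =
          (LINT x|lborel. (\<Sum>i\<in>UNIV. z $ i * (w x * partial_deriv i (\<lambda>x. \<phi> (x + - (s *\<^sub>R z))) x)))"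
        by (simp only: \<psi>_def pd sum_distrib_left mult_ac)
      also have "\<dots> = (\<Sum>i\<in>UNIV. z $ i * - (LINT x|lborel. H x $ i * \<phi> (x + - (s *\<^sub>R z))))"
        by (subst Bochner_Integration.integral_sum, rule integrable_mult_right, rule i1)
          (simp only: integral_mult_right_zero wg[OF t\<phi>])
      also have "\<dots> = - (LINT x|lborel. (\<Sum>i\<in>UNIV. z $ i * (H x $ i * \<phi> (x + - (s *\<^sub>R z)))))"
        using i2 by (subst Bochner_Integration.integral_sum) (auto simp: sum_negf)
      also have "(\<lambda>x. \<Sum>i\<in>UNIV. z $ i * (H x $ i * \<phi> (x + - (s *\<^sub>R z)))) = (\<lambda>x. (H x \<bullet> z) * \<phi> (x - s *\<^sub>R z))"
        by (auto simp: inner_vec_def sum_distrib_left sum_distrib_right mult_ac intro!: sum.cong)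
      also have "(LINT x|lborel. (H x \<bullet> z) * \<phi> (x - s *\<^sub>R z)) = (LINT x|lborel. (H (x + s *\<^sub>R z) \<bullet> z) * \<phi> x)"
        using lborel_integral_translate[of "\<lambda>x. (H x \<bullet> z) * \<phi> (x - s *\<^sub>R z)" "s *\<^sub>R z"] by simp
      finally show ?thesis .
    qed
    have F1: "integrable (unit_measure \<Otimes>\<^sub>M lborel) (\<lambda>(s, x). w x * \<psi> (x - s *\<^sub>R z))"
    proof -
      have "integrable (unit_measure \<Otimes>\<^sub>M lborel) (\<lambda>p. (case p of (s, x) \<Rightarrow> w (x + s *\<^sub>R 0)) * (case p of (s, x) \<Rightarrow> \<psi> (x - s *\<^sub>R z)))"
        by (rule integrable_mult_bounded[OF integrable_along_segments[OF w], of _ C]) (auto simp: C)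
      then show ?thesis by (simp add: case_prod_unfold)
    qed
    have F2: "integrable (unit_measure \<Otimes>\<^sub>M lborel) (\<lambda>(s, x). (H (x + s *\<^sub>R z) \<bullet> z) * \<phi> x)"
    proof -
      have "integrable (unit_measure \<Otimes>\<^sub>M lborel) (\<lambda>p. (case p of (s, x) \<Rightarrow> H (x + s *\<^sub>R z) \<bullet> z) * (case p of (s, x) \<Rightarrow> \<phi> x))"
        by (rule integrable_mult_bounded[OF seg, of _ B]) (auto simp: B)
      then show ?thesis by (simp add: case_prod_unfold)
    qed
    have w\<phi>: "integrable lborel (\<lambda>x. w x * \<phi> x)" "integrable lborel (\<lambda>x. w (x + z) * \<phi> x)"
      "integrable lborel (\<lambda>x. T x * \<phi> x)" "integrable lborel (\<lambda>x. w x * \<phi> (x - z))"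
      using lborel_integrable_translate[OF w] w T B by (auto intro!: integrable_mult_bounded[where B=B])
    have "(LINT x|lborel. w (x + z) * \<phi> x) = (LINT x|lborel. w x * \<phi> (x - z))"
      using lborel_integral_translate[of "\<lambda>x. w x * \<phi> (x - z)" z] by simp
    then have "(LINT x|lborel. w (x + z) * \<phi> x) - (LINT x|lborel. w x * \<phi> x) = (LINT x|lborel. w x * (\<phi> (x - z) - \<phi> x))"
      using w\<phi> by (simp add: right_diff_distrib)
    also have "\<dots> = - (LINT x|lborel. LINT s|unit_measure. w x * \<psi> (x - s *\<^sub>R z))"
      by (simp add: ftc)
    also have "\<dots> = - (LINT s|unit_measure. LINT x|lborel. w x * \<psi> (x - s *\<^sub>R z))"
      by (subst unit_lborel.Fubini_integral[OF F1]) simp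
    also have "\<dots> = (LINT s|unit_measure. LINT x|lborel. (H (x + s *\<^sub>R z) \<bullet> z) * \<phi> x)"
      by (simp add: inner)
    also have "\<dots> = (LINT x|lborel. LINT s|unit_measure. (H (x + s *\<^sub>R z) \<bullet> z) * \<phi> x)"
      by (subst unit_lborel.Fubini_integral[OF F2]) simp
    also have "\<dots> = (LINT x|lborel. T x * \<phi> x)"
      by (simp add: T_def)
    finally show "(LINT x|lborel. (w (x + z) - w x - T x) * \<phi> x) = 0"
      using w\<phi> by (simp add: left_diff_distrib)
  qed
  then show ?thesis by (simp add: T_def)
qed

text \<open>The error is an average over \<open>s\<close> of \<open>H(x + s h e\<^sub>i) - H(x)\<close>, which tends to 0 in L1 by continuity
  of translations.\<close>

lemma L1_weak_gradient_difference_quotient: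
  fixes w :: "real^'n::finite \<Rightarrow> real"
  assumes "L1_weak_gradient w H" and h: "\<And>k. h k > 0" "h \<longlonglongrightarrow> 0"
  shows "(\<lambda>k. LINT x|lborel. \<bar>(w (x + h k *\<^sub>R axis i 1) - w x) / h k - H x $ i\<bar>) \<longlonglongrightarrow> 0"
proof -
  have w: "integrable lborel w" and H: "integrable lborel H"
    using assms by (auto simp: L1_weak_gradient_def)
  have [measurable]: "w \<in> borel_measurable borel" "H \<in> borel_measurable borel" using w H by auto
  define e :: "real^'n" where "e = axis i 1"
  define \<tau> where "\<tau> k s = (LINT x|lborel. norm (H (x + s *\<^sub>R (h k *\<^sub>R e)) - H x))" for k s
  have \<tau>m: "(\<lambda>s. \<tau> k s) \<in> borel_measurable borel" for k
    unfolding \<tau>_def by (rule lborel.borel_measurable_lebesgue_integral) measurable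
  have \<tau>b: "norm (\<tau> k s) \<le> 2 * (LINT x|lborel. norm (H x))" for k s
    using translate_norm_le[OF H, of "s *\<^sub>R (h k *\<^sub>R e)"] by (simp add: \<tau>_def abs_of_nonneg)
  have "(\<lambda>k. LINT s|unit_measure. \<tau> k s) \<longlonglongrightarrow> (LINT s|unit_measure. 0)"
  proof (rule integral_dominated_convergence[where w="\<lambda>_. 2 * (LINT x|lborel. norm (H x))"])
    show "AE s in unit_measure. (\<lambda>k. \<tau> k s) \<longlonglongrightarrow> 0"
    proof (rule AE_I2)
      fix s :: real
      have "(\<lambda>k. s *\<^sub>R (h k *\<^sub>R e)) \<longlonglongrightarrow> s *\<^sub>R (0 *\<^sub>R e)" by (intro tendsto_intros h)
      then show "(\<lambda>k. \<tau> k s) \<longlonglongrightarrow> 0"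
        unfolding \<tau>_def using translation_continuous_sequentially[OF H] by simp
    qed
  qed (use \<tau>m \<tau>b in auto)
  then have lim: "(\<lambda>k. LINT s|unit_measure. \<tau> k s) \<longlonglongrightarrow> 0" by simp
  show ?thesis
  proof (rule tendsto_0_le[OF lim, where K=1], intro always_eventually allI)
    fix k
    define z where "z = h k *\<^sub>R e"
    have seg: "integrable (unit_measure \<Otimes>\<^sub>M lborel) (\<lambda>(s, x). norm (H (x + s *\<^sub>R z) - H x))"
    proof -
      have "integrable (unit_measure \<Otimes>\<^sub>M lborel) (\<lambda>p. norm ((case p of (s, x) \<Rightarrow> H (x + s *\<^sub>R z)) - (case p of (s, x) \<Rightarrow> H (x + s *\<^sub>R 0))))"
        by (intro integrable_norm Bochner_Integration.integrable_diff integrable_along_segments H)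
      then show ?thesis by (simp add: case_prod_unfold)
    qed
    have Hs: "AE x in lborel. integrable unit_measure (\<lambda>s. H (x + s *\<^sub>R z))"
      by (rule unit_lborel.AE_integrable_snd[OF integrable_along_segments[OF H]])
    have "AE x in lborel. \<bar>(w (x + z) - w x) / h k - H x $ i\<bar> \<le> (LINT s|unit_measure. norm (H (x + s *\<^sub>R z) - H x))"
      using L1_weak_gradient_increment[OF assms(1), of z] Hs
    proof eventually_elim
      fix x assume 1: "w (x + z) - w x = (LINT s|unit_measure. H (x + s *\<^sub>R z) \<bullet> z)"
        and 2: "integrable unit_measure (\<lambda>s. H (x + s *\<^sub>R z))"
      have "(w (x + z) - w x) / h k - H x $ i = (LINT s|unit_measure. H (x + s *\<^sub>R z) \<bullet> e) - H x $ i"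
        using h(1)[of k] 2 unfolding 1 by (simp add: z_def)
      also have "\<dots> = (LINT s|unit_measure. (H (x + s *\<^sub>R z) - H x) $ i)"
        using integrable_vec_nth[OF 2] by (simp add: e_def inner_axis unit_measure.prob_space)
      also have "\<bar>\<dots>\<bar> \<le> (LINT s|unit_measure. norm (H (x + s *\<^sub>R z) - H x))"
      proof -
        have "\<bar>LINT s|unit_measure. (H (x + s *\<^sub>R z) - H x) $ i\<bar> \<le> (LINT s|unit_measure. \<bar>(H (x + s *\<^sub>R z) - H x) $ i\<bar>)"
          by (rule integral_abs_bound)
        also have "\<dots> \<le> (LINT s|unit_measure. norm (H (x + s *\<^sub>R z) - H x))"
          by (intro integral_mono component_le_norm_cart integrable_abs integrable_vec_nth integrable_norm
              Bochner_Integration.integrable_diff 2) auto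
        finally show ?thesis .
      qed
      finally show "\<bar>(w (x + z) - w x) / h k - H x $ i\<bar> \<le> (LINT s|unit_measure. norm (H (x + s *\<^sub>R z) - H x))" .
    qed
    then have "(LINT x|lborel. \<bar>(w (x + z) - w x) / h k - H x $ i\<bar>) \<le> (LINT x|lborel. LINT s|unit_measure. norm (H (x + s *\<^sub>R z) - H x))"
      using unit_lborel.integrable_snd[OF seg] lborel_integrable_translate[OF w] w integrable_vec_nth[OF H]
      by (intro integral_mono_AE) auto
    also have "\<dots> = (LINT s|unit_measure. \<tau> k s)"
      unfolding \<tau>_def z_def[symmetric] by (rule unit_lborel.Fubini_integral[OF seg])
    finally show "norm (LINT x|lborel. \<bar>(w (x + h k *\<^sub>R axis i 1) - w x) / h k - H x $ i\<bar>) \<le> norm (LINT s|unit_measure. \<tau> k s) * 1"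
      by (simp add: z_def e_def abs_of_nonneg)
  qed
qed

text \<open>Where \<open>w = 0\<close>, the difference quotients of \<open>max 0 w\<close> from the right converge to
  \<open>max 0 H\<^sub>i\<close>, which explains the second case. A weak gradient \<open>H\<close> of \<open>w\<close> vanishes almost everywhere on \<open>{w = 0}\<close>, so the
  function represents the usual gradient, equal to \<open>H\<close> on \<open>{w > 0}\<close> and to 0 elsewhere.\<close>

definition positive_part_gradient :: "(real^'n::finite \<Rightarrow> real) \<Rightarrow> (real^'n \<Rightarrow> real^'n) \<Rightarrow> real^'n \<Rightarrow> real^'n" where
  "positive_part_gradient w H x = (if w x > 0 then H x else if w x = 0 then (\<chi> i. max 0 (H x $ i)) else 0)"

lemma positive_part_gradient_component_le: "\<bar>positive_part_gradient w H x $ i\<bar> \<le> \<bar>H x $ i\<bar>"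
  by (auto simp: positive_part_gradient_def)

lemma positive_part_gradient_measurable:
  fixes w :: "real^'n::finite \<Rightarrow> real"
  assumes [measurable]: "w \<in> borel_measurable M" "H \<in> borel_measurable M"
  shows "positive_part_gradient w H \<in> borel_measurable M"
proof -
  have "(\<lambda>x. \<chi> i. max 0 (H x $ i)) \<in> borel_measurable M"
    by (rule borel_measurable_continuous_on[OF _ assms(2)]) (intro continuous_intros)
  then show ?thesis
    unfolding positive_part_gradient_def[abs_def] by measurable
qed

text \<open>Replace \<open>w(x + h e\<^sub>i)\<close> by \<open>w(x) + h H\<^sub>i(x)\<close> in the difference quotients of \<open>max 0 w\<close>. The positive part is
  1-Lipschitz, so the change is negligible in L1; the new quotients (\<open>S\<close> below) are dominated by \<open>|H\<^sub>i|\<close> and converge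
  at every point.\<close>

lemma L1_weak_gradient_positive_part:
  fixes w :: "real^'n::finite \<Rightarrow> real"
  assumes W: "L1_weak_gradient w H"
  shows "L1_weak_gradient (\<lambda>x. max 0 (w x)) (positive_part_gradient w H)"
  unfolding L1_weak_gradient_def
proof (intro conjI allI impI)
  have w: "integrable lborel w" and H: "integrable lborel H"
    using assms by (auto simp: L1_weak_gradient_def)
  have [measurable]: "w \<in> borel_measurable borel" "H \<in> borel_measurable borel" using w H by auto
  have pm [measurable]: "positive_part_gradient w H \<in> borel_measurable borel"
    by (rule positive_part_gradient_measurable) auto
  show w': "integrable lborel (\<lambda>x. max 0 (w x))"
    using w by auto
  show P: "integrable lborel (positive_part_gradient w H)"
  proof (rule Bochner_Integration.integrable_bound[OF H])
    show "AE x in lborel. norm (positive_part_gradient w H x) \<le> norm (H x)"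
      using positive_part_gradient_component_le[of w H]
      by (intro AE_I2 norm_le_componentwise_cart) simp
  qed simp
  fix \<phi> :: "real^'n \<Rightarrow> real" and i assume \<phi>: "test_function \<phi>"
  define e :: "real^'n" where "e = axis i 1"
  define h where "h k = 1 / real (Suc k)" for k
  have h: "h k > 0" "h \<longlonglongrightarrow> 0" for k
    unfolding h_def[abs_def] using LIMSEQ_inverse_real_of_nat by (auto simp: inverse_eq_divide)
  obtain B where B: "B > 0" "\<And>x. \<bar>\<phi> x\<bar> \<le> B" using test_function_bounded[OF \<phi>] by blast
  have [measurable]: "\<phi> \<in> borel_measurable borel" by (rule test_function_measurable[OF \<phi>])
  note t\<phi>' = test_function_partial_deriv[OF \<phi>, of i]
  obtain C where C: "C > 0" "\<And>x. \<bar>partial_deriv i \<phi> x\<bar> \<le> C" using test_function_bounded[OF t\<phi>'] by blast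
  have [measurable]: "partial_deriv i \<phi> \<in> borel_measurable borel" by (rule test_function_measurable[OF t\<phi>'])
  have der: "((\<lambda>s. \<phi> (x - s *\<^sub>R e)) has_real_derivative - partial_deriv i \<phi> (x - s *\<^sub>R e)) (at s)" for x s
  proof -
    have "(\<Sum>j\<in>UNIV. e $ j * partial_deriv j \<phi> y) = partial_deriv i \<phi> y" for y
      by (subst sum.remove[of _ i]) (auto simp: e_def axis_def intro!: sum.neutral)
    then show ?thesis
      using smooth_derivative_along_line[OF test_function_smooth[OF \<phi>], of x e s] by simp
  qed
  define Q where "Q k x = (max 0 (w (x + h k *\<^sub>R e)) - max 0 (w x)) / h k" for k x
  define S where "S k x = (max 0 (w x + h k * H x $ i) - max 0 (w x)) / h k" for k x
  have Hi: "integrable lborel (\<lambda>x. H x $ i)" by (rule integrable_vec_nth[OF H])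
  then have [measurable]: "(\<lambda>x. H x $ i) \<in> borel_measurable borel" by auto
  have [measurable]: "Q k \<in> borel_measurable borel" "S k \<in> borel_measurable borel" for k
    unfolding Q_def[abs_def] S_def[abs_def] by measurable
  have Qi: "integrable lborel (Q k)" for k
    unfolding Q_def[abs_def] using lborel_integrable_translate[OF w'] w' by auto
  have Sb: "\<bar>S k x\<bar> \<le> \<bar>H x $ i\<bar>" for k x
  proof -
    have "\<bar>max 0 (w x + h k * H x $ i) - max 0 (w x)\<bar> \<le> h k * \<bar>H x $ i\<bar>"
      using h(1)[of k] abs_mult[of "h k" "H x $ i"] by (simp add: max_def abs_if split: if_splits)
    then show ?thesis unfolding S_def using h(1)[of k] by (simp add: abs_divide divide_le_eq mult.commute)
  qed
  have Si: "integrable lborel (S k)" for k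
    by (rule Bochner_Integration.integrable_bound[OF Hi]) (use Sb in auto)
  have Slim: "(\<lambda>k. S k x) \<longlonglongrightarrow> positive_part_gradient w H x $ i" for x
  proof -
    have l: "(\<lambda>k. w x + h k * H x $ i) \<longlonglongrightarrow> w x + 0 * H x $ i" by (intro tendsto_intros h(2))
    consider "w x > 0" | "w x < 0" | "w x = 0" by linarith
    then show ?thesis
    proof cases
      case 1
      with l have "eventually (\<lambda>k. w x + h k * H x $ i > 0) sequentially" by (auto intro: order_tendstoD)
      then have "eventually (\<lambda>k. positive_part_gradient w H x $ i = S k x) sequentially"
        by eventually_elim (use 1 h(1) in \<open>auto simp: S_def positive_part_gradient_def less_imp_neq[THEN not_sym]\<close>)
      then show ?thesis by (rule Lim_transform_eventually[OF tendsto_const])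
    next
      case 2
      with l have "eventually (\<lambda>k. w x + h k * H x $ i < 0) sequentially" by (auto intro: order_tendstoD)
      then have "eventually (\<lambda>k. positive_part_gradient w H x $ i = S k x) sequentially"
        by eventually_elim (use 2 h(1) in \<open>auto simp: S_def positive_part_gradient_def\<close>)
      then show ?thesis by (rule Lim_transform_eventually[OF tendsto_const])
    next
      case 3
      have "S k x = positive_part_gradient w H x $ i" for k
        using 3 h(1)[of k] by (auto simp: S_def positive_part_gradient_def max_def zero_le_mult_iff)
      then show ?thesis by simp
    qed
  qed
  have QS: "\<bar>Q k x - S k x\<bar> \<le> \<bar>(w (x + h k *\<^sub>R e) - w x) / h k - H x $ i\<bar>" for k x
  proof -
    have "Q k x - S k x = (max 0 (w (x + h k *\<^sub>R e)) - max 0 (w x + h k * H x $ i)) / h k"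
      by (simp add: Q_def S_def diff_divide_distrib)
    also have "\<bar>\<dots>\<bar> \<le> \<bar>w (x + h k *\<^sub>R e) - (w x + h k * H x $ i)\<bar> / h k"
      unfolding abs_divide using h(1)[of k] by (intro divide_mono) auto
    also have "\<dots> = \<bar>(w (x + h k *\<^sub>R e) - w x) / h k - H x $ i\<bar>"
      using h(1)[of k] by (subst abs_of_pos[of "h k", symmetric], simp, subst abs_divide[symmetric]) 
        (simp add: field_simps)
    finally show ?thesis .
  qed
  have L1: "(\<lambda>k. LINT x|lborel. max 0 (w x) * ((\<phi> x - \<phi> (x - h k *\<^sub>R e)) / h k)) \<longlonglongrightarrow>
      (LINT x|lborel. max 0 (w x) * partial_deriv i \<phi> x)"
  proof (rule integral_dominated_convergence[where w="\<lambda>x. C * max 0 (w x)"])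
    show "AE x in lborel. (\<lambda>k. max 0 (w x) * ((\<phi> x - \<phi> (x - h k *\<^sub>R e)) / h k)) \<longlonglongrightarrow> max 0 (w x) * partial_deriv i \<phi> x"
    proof (rule AE_I2)
      fix x
      have "((\<lambda>s. (\<phi> (x - s *\<^sub>R e) - \<phi> x) / s) \<longlongrightarrow> - partial_deriv i \<phi> x) (at 0)"
        using der[of x 0] by (simp add: has_field_derivative_iff)
      moreover have "filterlim h (at 0) sequentially"
        unfolding filterlim_at using h less_imp_neq[THEN not_sym] by (auto intro: always_eventually)
      ultimately have "(\<lambda>k. (\<phi> (x - h k *\<^sub>R e) - \<phi> x) / h k) \<longlonglongrightarrow> - partial_deriv i \<phi> x"
        by (rule filterlim_compose)
      then have "(\<lambda>k. - ((\<phi> (x - h k *\<^sub>R e) - \<phi> x) / h k)) \<longlonglongrightarrow> - (- partial_deriv i \<phi> x)"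
        by (rule tendsto_minus)
      then show "(\<lambda>k. max 0 (w x) * ((\<phi> x - \<phi> (x - h k *\<^sub>R e)) / h k)) \<longlonglongrightarrow> max 0 (w x) * partial_deriv i \<phi> x"
        by (intro tendsto_mult tendsto_const) (simp add: minus_divide_left)
    qed
    show "AE x in lborel. norm (max 0 (w x) * ((\<phi> x - \<phi> (x - h k *\<^sub>R e)) / h k)) \<le> C * max 0 (w x)" for k
    proof (rule AE_I2)
      fix x
      obtain s where "\<phi> (x - h k *\<^sub>R e) - \<phi> (x - 0 *\<^sub>R e) = (h k - 0) * - partial_deriv i \<phi> (x - s *\<^sub>R e)"
        using MVT2[OF h(1)[of k], of "\<lambda>s. \<phi> (x - s *\<^sub>R e)" "\<lambda>s. - partial_deriv i \<phi> (x - s *\<^sub>R e)"] der by blast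
      then have "(\<phi> x - \<phi> (x - h k *\<^sub>R e)) / h k = partial_deriv i \<phi> (x - s *\<^sub>R e)"
        using h(1)[of k] by (simp add: field_simps)
      then show "norm (max 0 (w x) * ((\<phi> x - \<phi> (x - h k *\<^sub>R e)) / h k)) \<le> C * max 0 (w x)"
        using mult_right_mono[OF C(2)[of "x - s *\<^sub>R e"], of "max 0 (w x)"]
        by (simp add: abs_mult mult.commute)
    qed
  qed (use w' in auto)
  have eq: "(LINT x|lborel. max 0 (w x) * ((\<phi> x - \<phi> (x - h k *\<^sub>R e)) / h k)) = - (LINT x|lborel. Q k x * \<phi> x)" for k
  proof -
    have i: "integrable lborel (\<lambda>x. max 0 (w x) * \<phi> x)" "integrable lborel (\<lambda>x. max 0 (w x) * \<phi> (x - h k *\<^sub>R e))"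
      "integrable lborel (\<lambda>x. max 0 (w (x + h k *\<^sub>R e)) * \<phi> x)"
      using lborel_integrable_translate[OF w'] w' B(2) by (auto intro!: integrable_mult_bounded[where B=B])
    have "(LINT x|lborel. max 0 (w (x + h k *\<^sub>R e)) * \<phi> x) = (LINT x|lborel. max 0 (w x) * \<phi> (x - h k *\<^sub>R e))"
      using lborel_integral_translate[of "\<lambda>x. max 0 (w x) * \<phi> (x - h k *\<^sub>R e)" "h k *\<^sub>R e"] by simp
    moreover have "(LINT x|lborel. Q k x * \<phi> x) = (LINT x|lborel. (max 0 (w (x + h k *\<^sub>R e)) * \<phi> x - max 0 (w x) * \<phi> x) / h k)"
      by (simp add: Q_def left_diff_distrib)
    moreover have "(LINT x|lborel. max 0 (w x) * ((\<phi> x - \<phi> (x - h k *\<^sub>R e)) / h k)) =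
      (LINT x|lborel. (max 0 (w x) * \<phi> x - max 0 (w x) * \<phi> (x - h k *\<^sub>R e)) / h k)"
      by (simp add: right_diff_distrib)
    ultimately show ?thesis using i by (simp add: diff_divide_distrib)
  qed
  have L2: "(\<lambda>k. LINT x|lborel. S k x * \<phi> x) \<longlonglongrightarrow> (LINT x|lborel. positive_part_gradient w H x $ i * \<phi> x)"
  proof (rule integral_dominated_convergence[where w="\<lambda>x. B * \<bar>H x $ i\<bar>"])
    show "AE x in lborel. norm (S k x * \<phi> x) \<le> B * \<bar>H x $ i\<bar>" for k
      using Sb B by (intro AE_I2) (auto simp: abs_mult mult.commute[of B] intro!: mult_mono)
    show "(\<lambda>x. positive_part_gradient w H x $ i * \<phi> x) \<in> borel_measurable lborel"
      using borel_measurable_integrable[OF integrable_vec_nth[OF P]] by simp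
  qed (use Slim Hi in \<open>auto intro!: AE_I2 tendsto_mult\<close>)
  have L3: "(\<lambda>k. (LINT x|lborel. Q k x * \<phi> x) - (LINT x|lborel. S k x * \<phi> x)) \<longlonglongrightarrow> 0"
  proof (rule tendsto_0_le[OF L1_weak_gradient_difference_quotient[OF W h, of i], where K=B], intro always_eventually allI)
    fix k
    have i: "integrable lborel (\<lambda>x. Q k x * \<phi> x)" "integrable lborel (\<lambda>x. S k x * \<phi> x)"
      using Qi Si B(2) by (auto intro!: integrable_mult_bounded[where B=B])
    have dq: "integrable lborel (\<lambda>x. \<bar>(w (x + h k *\<^sub>R e) - w x) / h k - H x $ i\<bar>)"
      using lborel_integrable_translate[OF w] w Hi by auto
    have "\<bar>(LINT x|lborel. Q k x * \<phi> x) - (LINT x|lborel. S k x * \<phi> x)\<bar> = \<bar>LINT x|lborel. (Q k x - S k x) * \<phi> x\<bar>"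
      using i by (simp add: left_diff_distrib)
    also have "\<dots> \<le> (LINT x|lborel. \<bar>(Q k x - S k x) * \<phi> x\<bar>)" by (rule integral_abs_bound)
    also have "\<dots> \<le> (LINT x|lborel. \<bar>(w (x + h k *\<^sub>R e) - w x) / h k - H x $ i\<bar> * B)"
    proof (rule integral_mono)
      show "integrable lborel (\<lambda>x. \<bar>(Q k x - S k x) * \<phi> x\<bar>)" using i by (simp add: left_diff_distrib)
      show "integrable lborel (\<lambda>x. \<bar>(w (x + h k *\<^sub>R e) - w x) / h k - H x $ i\<bar> * B)"
        by (rule integrable_mult_left[OF dq])
      show "\<bar>(Q k x - S k x) * \<phi> x\<bar> \<le> \<bar>(w (x + h k *\<^sub>R e) - w x) / h k - H x $ i\<bar> * B" for x
        unfolding abs_mult by (intro mult_mono QS B) auto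
    qed
    finally show "norm ((LINT x|lborel. Q k x * \<phi> x) - (LINT x|lborel. S k x * \<phi> x)) \<le>
       norm (LINT x|lborel. \<bar>(w (x + h k *\<^sub>R axis i 1) - w x) / h k - H x $ i\<bar>) * B"
      using B by (simp add: e_def abs_of_nonneg)
  qed
  have "(\<lambda>k. LINT x|lborel. Q k x * \<phi> x) \<longlonglongrightarrow> 0 + (LINT x|lborel. positive_part_gradient w H x $ i * \<phi> x)"
    using tendsto_add[OF L3 L2] by simp
  then have "(\<lambda>k. - (LINT x|lborel. Q k x * \<phi> x)) \<longlonglongrightarrow> - (LINT x|lborel. positive_part_gradient w H x $ i * \<phi> x)"
    by (intro tendsto_minus) simp
  with L1 show "(LINT x|lborel. max 0 (w x) * partial_deriv i \<phi> x) = - (LINT x|lborel. positive_part_gradient w H x $ i * \<phi> x)"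
    unfolding eq by (rule LIMSEQ_unique)
qed

section \<open>Weak gradients of locally integrable functions\<close>

lemma L2_loc_imp_L1_loc:
  fixes u :: "real^'n::finite \<Rightarrow> real"
  assumes "L2_loc u" shows "L1_loc u"
  unfolding L1_loc_def
proof (intro conjI allI impI)
  show m: "u \<in> borel_measurable lebesgue" using assms by (simp add: L2_loc_def)
  fix K :: "(real^'n) set" assume K: "compact K"
  interpret finite_measure "lebesgue_on K"
    by (rule finite_measure_lebesgue_on) (rule lmeasurable_compact[OF K])
  show "integrable (lebesgue_on K) u"
  proof (rule square_integrable_imp_integrable)
    show "u \<in> borel_measurable (lebesgue_on K)" by (rule measurable_restrict_space1[OF m])
    show "integrable (lebesgue_on K) (\<lambda>x. (u x)\<^sup>2)" using assms K by (simp add: L2_loc_def)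
  qed
qed

lemma L1_loc_integrable_mult:
  fixes f :: "real^'n::finite \<Rightarrow> 'b::euclidean_space"
  assumes f: "L1_loc f" and \<phi>: "\<phi> \<in> borel_measurable lebesgue" "\<And>x. \<bar>\<phi> x\<bar> \<le> B" "\<And>x. x \<notin> ball 0 R \<Longrightarrow> \<phi> x = 0"
  shows "integrable lebesgue (\<lambda>x. \<phi> x *\<^sub>R f x)"
proof -
  have "integrable (lebesgue_on (cball 0 R)) f" using f by (simp add: L1_loc_def)
  then have i: "integrable lebesgue (\<lambda>x. indicator (cball 0 R) x *\<^sub>R f x)"
    by (subst (asm) integrable_restrict_space) auto
  show ?thesis
  proof (rule Bochner_Integration.integrable_bound[OF integrable_scaleR_right[OF i, of B]])
    show "(\<lambda>x. \<phi> x *\<^sub>R f x) \<in> borel_measurable lebesgue"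
      using f \<phi>(1) by (intro borel_measurable_scaleR) (auto simp: L1_loc_def)
    have B: "B \<ge> 0" using \<phi>(2)[of 0] by linarith
    show "AE x in lebesgue. norm (\<phi> x *\<^sub>R f x) \<le> norm (B *\<^sub>R indicator (cball 0 R) x *\<^sub>R f x)"
      using \<phi> B by (intro AE_I2) (auto simp: indicator_def intro!: mult_right_mono)
  qed
qed

lemma test_function_measurable_lebesgue: "test_function \<phi> \<Longrightarrow> \<phi> \<in> borel_measurable lebesgue"
  by (intro measurable_completion) (simp add: test_function_measurable)

lemma L1_loc_integrable_mult_test:
  fixes f :: "real^'n::finite \<Rightarrow> 'b::euclidean_space"
  assumes "L1_loc f" "test_function \<phi>"
  shows "integrable lebesgue (\<lambda>x. \<phi> x *\<^sub>R f x)"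
proof -
  obtain B where "\<And>x. \<bar>\<phi> x\<bar> \<le> B" using test_function_bounded[OF assms(2)] by blast
  moreover obtain R where "\<And>x. x \<notin> ball 0 R \<Longrightarrow> \<phi> x = 0" using test_function_support[OF assms(2)] by blast
  ultimately show ?thesis
    using L1_loc_integrable_mult[OF assms(1) test_function_measurable_lebesgue[OF assms(2)]] by blast
qed

lemma L1_locI:
  fixes f :: "real^'n::finite \<Rightarrow> 'b::euclidean_space"
  assumes "f \<in> borel_measurable lebesgue" "L1_loc g" "\<And>x. norm (f x) \<le> norm (g x)"
  shows "L1_loc f"
  unfolding L1_loc_def
proof (intro conjI allI impI)
  fix K :: "(real^'n) set" assume K: "compact K"
  show "integrable (lebesgue_on K) f"
  proof (rule Bochner_Integration.integrable_bound)
    show "integrable (lebesgue_on K) g" using assms(2) K by (simp add: L1_loc_def)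
    show "f \<in> borel_measurable (lebesgue_on K)" by (rule measurable_restrict_space1[OF assms(1)])
  qed (use assms(3) in simp)
qed (rule assms(1))

lemma L1_loc_vec_nth: "L1_loc G \<Longrightarrow> L1_loc (\<lambda>x. G x $ i)"
  for G :: "real^'n::finite \<Rightarrow> real^'n"
  by (rule L1_locI[of _ G])
    (auto simp: L1_loc_def component_le_norm_cart intro!: borel_measurable_continuous_on[OF continuous_on_component[OF continuous_on_id]])

lemma L1_loc_integrable:
  fixes f :: "real^'n::finite \<Rightarrow> 'b::euclidean_space"
  assumes "integrable lebesgue f" shows "L1_loc f"
  unfolding L1_loc_def
proof (intro conjI allI impI)
  fix K :: "(real^'n) set" assume "compact K"
  then have K: "K \<in> sets lebesgue" using lmeasurable_compact by blast
  then show "integrable (lebesgue_on K) f"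
    using integrable_mult_indicator[OF K assms] by (simp add: integrable_restrict_space)
qed (use assms in auto)

lemma borel_representative_real:
  fixes f :: "real^'n::finite \<Rightarrow> real"
  assumes "f \<in> borel_measurable lebesgue"
  obtains g where "g \<in> borel_measurable borel" "AE x in lebesgue. g x = f x"
proof -
  obtain g where "g \<in> borel_measurable lborel" "AE x in lborel. f x = g x"
    using completion_ex_borel_measurable_real[OF assms] by blast
  moreover from this(2) have "AE x in lebesgue. g x = f x"
    by (intro AE_completion) (auto elim: eventually_mono)
  ultimately show ?thesis using that[of g] by simp
qed

lemma borel_representative_vec:
  fixes f :: "real^'n::finite \<Rightarrow> real^'n"
  assumes f: "f \<in> borel_measurable lebesgue"
  obtains g where "g \<in> borel_measurable borel" "AE x in lebesgue. g x = f x"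
proof -
  have "\<exists>g. g \<in> borel_measurable borel \<and> (AE x in lebesgue. g x = f x $ i)" for i
  proof -
    have "(\<lambda>x. f x $ i) \<in> borel_measurable lebesgue"
      by (rule borel_measurable_continuous_on[OF continuous_on_component[OF continuous_on_id] f])
    then show ?thesis using borel_representative_real by blast
  qed
  then obtain g where g: "\<And>i. g i \<in> borel_measurable borel" "\<And>i. AE x in lebesgue. g i x = f x $ i" by metis
  show ?thesis
  proof (rule that[of "\<lambda>x. \<chi> i. g i x"])
    show "(\<lambda>x. \<chi> i. g i x) \<in> borel_measurable borel"
      unfolding borel_measurable_euclidean_space[of "\<lambda>x. \<chi> i. g i x"]
      using g(1) by (auto simp: Basis_vec_def inner_axis)
    have "AE x in lebesgue. \<forall>i. g i x = f x $ i"
      using g(2) by (simp add: AE_all_countable)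
    then show "AE x in lebesgue. (\<chi> i. g i x) = f x"
      by eventually_elim (auto simp: vec_eq_iff)
  qed
qed

lemma L1_loc_mult_grad:
  fixes u :: "real^'n::finite \<Rightarrow> real"
  assumes u: "L1_loc u" and \<psi>: "test_function \<psi>"
  shows "integrable lebesgue (\<lambda>x. u x *\<^sub>R grad \<psi> x)"
proof -
  have "integrable lebesgue (\<lambda>x. \<Sum>i\<in>UNIV. (partial_deriv i \<psi> x *\<^sub>R u x) *\<^sub>R (axis i 1 :: real^'n))"
    by (intro Bochner_Integration.integrable_sum integrable_scaleR_left
        L1_loc_integrable_mult_test[OF u] test_function_partial_deriv[OF \<psi>])
  moreover have "(\<lambda>x. \<Sum>i\<in>UNIV. (partial_deriv i \<psi> x *\<^sub>R u x) *\<^sub>R axis i 1) = (\<lambda>x. u x *\<^sub>R grad \<psi> x)"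
    by (simp add: vec_eq_iff grad_def axis_def if_distrib fun_eq_iff cong: if_cong)
  ultimately show ?thesis by (simp only:)
qed

lemma has_weak_gradient_mult_test:
  fixes u :: "real^'n::finite \<Rightarrow> real"
  assumes u: "L1_loc u" and G: "has_weak_gradient u G" and \<psi>: "test_function \<psi>"
  shows "has_weak_gradient (\<lambda>x. \<psi> x * u x) (\<lambda>x. \<psi> x *\<^sub>R G x + u x *\<^sub>R grad \<psi> x)"
    and "integrable lebesgue (\<lambda>x. \<psi> x *\<^sub>R G x + u x *\<^sub>R grad \<psi> x)"
proof -
  have GL: "L1_loc G" using G by (simp add: has_weak_gradient_def)
  show i: "integrable lebesgue (\<lambda>x. \<psi> x *\<^sub>R G x + u x *\<^sub>R grad \<psi> x)"
    by (intro Bochner_Integration.integrable_add L1_loc_integrable_mult_test[OF GL \<psi>] L1_loc_mult_grad[OF u \<psi>])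
  show "has_weak_gradient (\<lambda>x. \<psi> x * u x) (\<lambda>x. \<psi> x *\<^sub>R G x + u x *\<^sub>R grad \<psi> x)"
    unfolding has_weak_gradient_def
  proof (intro conjI allI impI)
    show "L1_loc (\<lambda>x. \<psi> x *\<^sub>R G x + u x *\<^sub>R grad \<psi> x)" by (rule L1_loc_integrable[OF i])
    fix \<phi> :: "real^'n \<Rightarrow> real" and i assume \<phi>: "test_function \<phi>"
    note s = test_function_smooth[OF \<psi>] test_function_smooth[OF \<phi>]
    have i1: "integrable lebesgue (\<lambda>x. u x * (\<psi> x * partial_deriv i \<phi> x))"
      using L1_loc_integrable_mult_test[OF u test_function_mult[OF s(1) test_function_partial_deriv[OF \<phi>]]] by (simp add: mult_ac)
    have i2: "integrable lebesgue (\<lambda>x. u x * (partial_deriv i \<psi> x * \<phi> x))"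
      using L1_loc_integrable_mult_test[OF u test_function_mult[OF smooth_partial_deriv[OF s(1)] \<phi>]] by (simp add: mult_ac)
    have i3: "integrable lebesgue (\<lambda>x. G x $ i * (\<psi> x * \<phi> x))"
      using L1_loc_integrable_mult_test[OF L1_loc_vec_nth[OF GL] test_function_mult[OF s(1) \<phi>]] by (simp add: mult_ac)
    have "(LINT x|lebesgue. u x * partial_deriv i (\<lambda>x. \<psi> x * \<phi> x) x) = - (LINT x|lebesgue. G x $ i * (\<psi> x * \<phi> x))"
      using G test_function_mult[OF s(1) \<phi>] by (simp add: has_weak_gradient_def)
    moreover have "(LINT x|lebesgue. u x * partial_deriv i (\<lambda>x. \<psi> x * \<phi> x) x) =
        (LINT x|lebesgue. u x * (\<psi> x * partial_deriv i \<phi> x)) + (LINT x|lebesgue. u x * (partial_deriv i \<psi> x * \<phi> x))"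
      using i1 i2 by (simp add: partial_deriv_mult[OF s] distrib_left)
    moreover have "(LINT x|lebesgue. (\<psi> x *\<^sub>R G x + u x *\<^sub>R grad \<psi> x) $ i * \<phi> x) =
        (LINT x|lebesgue. G x $ i * (\<psi> x * \<phi> x)) + (LINT x|lebesgue. u x * (partial_deriv i \<psi> x * \<phi> x))"
    proof -
      have "(\<psi> x *\<^sub>R G x + u x *\<^sub>R grad \<psi> x) $ i * \<phi> x = G x $ i * (\<psi> x * \<phi> x) + u x * (partial_deriv i \<psi> x * \<phi> x)" for x
        by (simp add: grad_def algebra_simps)
      then show ?thesis using i2 i3 by simp
    qed
    moreover have "(LINT x|lebesgue. \<psi> x * u x * partial_deriv i \<phi> x) = (LINT x|lebesgue. u x * (\<psi> x * partial_deriv i \<phi> x))"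
      by (simp add: mult_ac)
    ultimately show "(LINT x|lebesgue. \<psi> x * u x * partial_deriv i \<phi> x) =
       - (LINT x|lebesgue. (\<psi> x *\<^sub>R G x + u x *\<^sub>R grad \<psi> x) $ i * \<phi> x)" by simp
  qed
qed

lemma has_weak_gradient_diff:
  assumes "L1_loc u" "L1_loc v" and G: "has_weak_gradient u G" and H: "has_weak_gradient v H"
  shows "has_weak_gradient (\<lambda>x. u x - v x) (\<lambda>x. G x - H x)"
  unfolding has_weak_gradient_def
proof (intro conjI allI impI)
  have GL: "L1_loc G" and HL: "L1_loc H" using G H by (auto simp: has_weak_gradient_def)
  then show "L1_loc (\<lambda>x. G x - H x)" by (auto simp: L1_loc_def)
  fix \<phi> :: "real^'a \<Rightarrow> real" and i assume \<phi>: "test_function \<phi>"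
  have "integrable lebesgue (\<lambda>x. u x * partial_deriv i \<phi> x)" "integrable lebesgue (\<lambda>x. v x * partial_deriv i \<phi> x)"
    "integrable lebesgue (\<lambda>x. G x $ i * \<phi> x)" "integrable lebesgue (\<lambda>x. H x $ i * \<phi> x)"
    using L1_loc_integrable_mult_test[OF assms(1) test_function_partial_deriv[OF \<phi>]]
      L1_loc_integrable_mult_test[OF assms(2) test_function_partial_deriv[OF \<phi>]]
      L1_loc_integrable_mult_test[OF L1_loc_vec_nth[OF GL] \<phi>] L1_loc_integrable_mult_test[OF L1_loc_vec_nth[OF HL] \<phi>]
    by (simp_all add: mult.commute)
  then show "(LINT x|lebesgue. (u x - v x) * partial_deriv i \<phi> x) = - (LINT x|lebesgue. (G x - H x) $ i * \<phi> x)"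
    using G H \<phi> by (simp add: left_diff_distrib has_weak_gradient_def)
qed

lemma lebesgue_integral_representative:
  fixes f :: "real^'n::finite \<Rightarrow> real"
  assumes f: "f \<in> borel_measurable borel" "AE x in lebesgue. f x = g x" and g: "g \<in> borel_measurable lebesgue"
    and \<phi>: "test_function \<phi>"
  shows "(LINT x|lborel. f x * \<phi> x) = (LINT x|lebesgue. g x * \<phi> x)"
proof -
  have m: "\<phi> \<in> borel_measurable borel" by (rule test_function_measurable[OF \<phi>])
  have "(LINT x|lborel. f x * \<phi> x) = (LINT x|lebesgue. f x * \<phi> x)"
    using f(1) m by (intro integral_completion[symmetric]) simp
  also have "\<dots> = (LINT x|lebesgue. g x * \<phi> x)"
    using f(2) g measurable_completion[of f lborel borel] f(1) test_function_measurable_lebesgue[OF \<phi>]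
    by (intro integral_cong_AE) auto
  finally show ?thesis .
qed

text \<open>Multiply by a cutoff that is 1 on the ball, and take Borel representatives of the products, so that
  they can be composed with translations.\<close>

lemma weak_gradient_representative:
  fixes u :: "real^'n::finite \<Rightarrow> real" and R :: real
  assumes u: "L1_loc u" and G: "has_weak_gradient u G" and "R > 0"
  obtains w H where "L1_weak_gradient w H" "AE x in lebesgue. x \<in> ball 0 R \<longrightarrow> w x = u x \<and> H x = G x"
proof -
  obtain \<psi> :: "real^'n \<Rightarrow> real" where \<psi>: "test_function \<psi>" "\<And>x. x \<in> ball 0 R \<Longrightarrow> \<psi> x = 1"
    using cutoff_ball[OF \<open>R > 0\<close>] by metis
  define U where "U x = \<psi> x * u x" for x
  define K where "K x = \<psi> x *\<^sub>R G x + u x *\<^sub>R grad \<psi> x" for x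
  have U: "integrable lebesgue U"
    using L1_loc_integrable_mult_test[OF u \<psi>(1)] by (simp add: U_def[abs_def])
  have K: "integrable lebesgue K" "has_weak_gradient U K"
    using has_weak_gradient_mult_test[OF u G \<psi>(1)] by (simp_all add: U_def[abs_def] K_def[abs_def])
  obtain w where w: "w \<in> borel_measurable borel" "AE x in lebesgue. w x = U x"
    using borel_representative_real[of U] U by auto
  obtain H where H: "H \<in> borel_measurable borel" "AE x in lebesgue. H x = K x"
    using borel_representative_vec[of K] K(1) by auto
  have "integrable lebesgue w" "integrable lebesgue H"
    using integrable_cong_AE[of w lebesgue U] integrable_cong_AE[of H lebesgue K] w H U K(1)
    by (auto simp: measurable_completion)
  then have int: "integrable lborel w" "integrable lborel H"
    using w(1) H(1) by (simp_all add: integrable_completion)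
  show ?thesis
  proof (rule that[of w H])
    show "L1_weak_gradient w H"
      unfolding L1_weak_gradient_def
    proof (intro conjI int allI impI)
      fix \<phi> :: "real^'n \<Rightarrow> real" and i assume \<phi>: "test_function \<phi>"
      have Ki: "(\<lambda>x. K x $ i) \<in> borel_measurable lebesgue" "(\<lambda>x. H x $ i) \<in> borel_measurable borel"
        using borel_measurable_continuous_on[OF continuous_on_component[OF continuous_on_id], of K lebesgue i]
          borel_measurable_continuous_on[OF continuous_on_component[OF continuous_on_id], of H borel i] K(1) H(1) by auto
      have "(LINT x|lborel. w x * partial_deriv i \<phi> x) = (LINT x|lebesgue. U x * partial_deriv i \<phi> x)"
        using w U by (intro lebesgue_integral_representative test_function_partial_deriv \<phi>) auto
      also have "\<dots> = - (LINT x|lebesgue. K x $ i * \<phi> x)"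
        using K(2) \<phi> by (simp add: has_weak_gradient_def)
      also have "(LINT x|lebesgue. K x $ i * \<phi> x) = (LINT x|lborel. H x $ i * \<phi> x)"
        using H(2) by (intro lebesgue_integral_representative[symmetric] \<phi> Ki) auto
      finally show "(LINT x|lborel. w x * partial_deriv i \<phi> x) = - (LINT x|lborel. H x $ i * \<phi> x)" .
    qed
    have g0: "grad \<psi> x = 0" if "x \<in> ball 0 R" for x
      unfolding grad_def vec_eq_iff
      using partial_deriv_zero_on_open[OF open_ball that, of \<psi> 1] \<psi>(2) by simp
    show "AE x in lebesgue. x \<in> ball 0 R \<longrightarrow> w x = u x \<and> H x = G x"
      using w(2) H(2)
    proof eventually_elim
      fix x assume "w x = U x" "H x = K x"
      then show "x \<in> ball 0 R \<longrightarrow> w x = u x \<and> H x = G x"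
        using \<psi>(2)[of x] g0[of x] by (auto simp: U_def K_def)
    qed
  qed
qed

lemma has_weak_gradient_positive_part:
  fixes u :: "real^'n::finite \<Rightarrow> real"
  assumes u: "L1_loc u" and G: "has_weak_gradient u G"
  shows "has_weak_gradient (\<lambda>x. max 0 (u x)) (positive_part_gradient u G)"
  unfolding has_weak_gradient_def
proof (intro conjI allI impI)
  have GL: "L1_loc G" using G by (simp add: has_weak_gradient_def)
  have Pm: "positive_part_gradient u G \<in> borel_measurable lebesgue"
    using u GL by (intro positive_part_gradient_measurable) (auto simp: L1_loc_def)
  show PL: "L1_loc (positive_part_gradient u G)"
    using Pm GL positive_part_gradient_component_le[of u G]
    by (intro L1_locI[of "positive_part_gradient u G" G] norm_le_componentwise_cart) auto
  fix \<phi> :: "real^'n \<Rightarrow> real" and i assume \<phi>: "test_function \<phi>"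
  obtain R where R: "R > 0" "\<And>x. x \<notin> ball 0 R \<Longrightarrow> \<phi> x = 0" using test_function_support[OF \<phi>] by blast
  have R': "partial_deriv i \<phi> x = 0" if "x \<notin> ball 0 (R + 1)" for x
    by (rule partial_deriv_zero_on_open[of "- cball 0 R"]) (use that R in auto)
  obtain w H where wH: "L1_weak_gradient w H" "AE x in lebesgue. x \<in> ball 0 (R + 1) \<longrightarrow> w x = u x \<and> H x = G x"
    using weak_gradient_representative[OF u G, of "R + 1"] R(1) by auto
  define P where "P = positive_part_gradient w H"
  have P: "L1_weak_gradient (\<lambda>x. max 0 (w x)) P"
    unfolding P_def by (rule L1_weak_gradient_positive_part[OF wH(1)])
  have m: "w \<in> borel_measurable borel" "(\<lambda>x. P x $ i) \<in> borel_measurable borel"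
    using wH(1) P integrable_vec_nth[of lborel P i] by (auto simp: L1_weak_gradient_def)
  have mP: "(\<lambda>x. positive_part_gradient u G x $ i) \<in> borel_measurable lebesgue"
    using L1_loc_vec_nth[OF PL] by (simp add: L1_loc_def)
  have mw: "w \<in> borel_measurable lebesgue" "(\<lambda>x. P x $ i) \<in> borel_measurable lebesgue"
    using m by (auto intro: measurable_completion)
  have um: "u \<in> borel_measurable lebesgue" using u by (simp add: L1_loc_def)
  have m\<phi>: "\<phi> \<in> borel_measurable borel" "partial_deriv i \<phi> \<in> borel_measurable borel"
    "\<phi> \<in> borel_measurable lebesgue" "partial_deriv i \<phi> \<in> borel_measurable lebesgue"
    using test_function_measurable test_function_measurable_lebesgue \<phi> test_function_partial_deriv by blast+
  have "(LINT x|lebesgue. max 0 (u x) * partial_deriv i \<phi> x) = (LINT x|lebesgue. max 0 (w x) * partial_deriv i \<phi> x)"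
  proof (rule integral_cong_AE)
    show "AE x in lebesgue. max 0 (u x) * partial_deriv i \<phi> x = max 0 (w x) * partial_deriv i \<phi> x"
      using wH(2)
    proof eventually_elim
      fix x assume "x \<in> ball 0 (R + 1) \<longrightarrow> w x = u x \<and> H x = G x"
      then show "max 0 (u x) * partial_deriv i \<phi> x = max 0 (w x) * partial_deriv i \<phi> x"
        by (cases "x \<in> ball 0 (R + 1)") (auto simp: R')
    qed
  qed (use um mw m\<phi> in auto)
  also have "\<dots> = (LINT x|lborel. max 0 (w x) * partial_deriv i \<phi> x)"
    using m m\<phi> by (intro integral_completion) simp
  also have "\<dots> = - (LINT x|lborel. P x $ i * \<phi> x)"
    using P \<phi> by (simp add: L1_weak_gradient_def)
  also have "(LINT x|lborel. P x $ i * \<phi> x) = (LINT x|lebesgue. P x $ i * \<phi> x)"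
    using m m\<phi> by (intro integral_completion[symmetric]) simp
  also have "\<dots> = (LINT x|lebesgue. positive_part_gradient u G x $ i * \<phi> x)"
  proof (rule integral_cong_AE)
    show "AE x in lebesgue. P x $ i * \<phi> x = positive_part_gradient u G x $ i * \<phi> x"
      using wH(2)
    proof eventually_elim
      fix x assume "x \<in> ball 0 (R + 1) \<longrightarrow> w x = u x \<and> H x = G x"
      then show "P x $ i * \<phi> x = positive_part_gradient u G x $ i * \<phi> x"
        using R(2)[of x] by (cases "x \<in> ball 0 R") (auto simp: P_def positive_part_gradient_def)
    qed
  qed (use mP mw m\<phi> in auto)
  finally show "(LINT x|lebesgue. max 0 (u x) * partial_deriv i \<phi> x) = - (LINT x|lebesgue. positive_part_gradient u G x $ i * \<phi> x)" .
qed

lemma AE_ball_imp_AE: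
  assumes "\<And>k::nat. AE x in M. x \<in> ball 0 (real (Suc k)) \<longrightarrow> P x"
  shows "AE x in M. P (x :: 'a::real_normed_vector)"
proof -
  have "AE x in M. \<forall>k::nat. x \<in> ball 0 (real (Suc k)) \<longrightarrow> P x"
    unfolding AE_all_countable using assms by blast
  then show ?thesis
  proof eventually_elim
    fix x :: 'a assume a: "\<forall>k::nat. x \<in> ball 0 (real (Suc k)) \<longrightarrow> P x"
    obtain k :: nat where "norm x < real k" using reals_Archimedean2 by blast
    then have "x \<in> ball 0 (real (Suc k))" by simp
    with a show "P x" by blast
  qed
qed

lemma has_weak_gradient_unique:
  fixes u :: "real^'n::finite \<Rightarrow> real"
  assumes G: "has_weak_gradient u G" and H: "has_weak_gradient u H"
  shows "AE x in lebesgue. G x = H x"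
proof -
  have GL: "L1_loc G" and HL: "L1_loc H" using G H by (auto simp: has_weak_gradient_def)
  have "AE x in lebesgue. x \<in> ball 0 (real (Suc k)) \<longrightarrow> G x $ i = H x $ i" for k i
  proof -
    obtain \<psi> :: "real^'n \<Rightarrow> real" where \<psi>: "test_function \<psi>" "\<And>x. x \<in> ball 0 (real (Suc k)) \<Longrightarrow> \<psi> x = 1"
      using cutoff_ball[of "real (Suc k)"] by (metis of_nat_0_less_iff zero_less_Suc)
    have i: "integrable lebesgue (\<lambda>x. G x $ i * (\<psi> x * \<phi> x))" "integrable lebesgue (\<lambda>x. H x $ i * (\<psi> x * \<phi> x))"
      if "test_function \<phi>" for \<phi>
      using L1_loc_integrable_mult_test[OF L1_loc_vec_nth[OF GL, of i] test_function_mult[OF test_function_smooth[OF \<psi>(1)] that]]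
        L1_loc_integrable_mult_test[OF L1_loc_vec_nth[OF HL, of i] test_function_mult[OF test_function_smooth[OF \<psi>(1)] that]]
      by (simp_all add: mult_ac)
    define D where "D x = \<psi> x * (G x $ i - H x $ i)" for x
    have D: "integrable lebesgue D"
      using L1_loc_integrable_mult_test[OF L1_loc_vec_nth[OF GL, of i] \<psi>(1)]
        L1_loc_integrable_mult_test[OF L1_loc_vec_nth[OF HL, of i] \<psi>(1)]
      by (simp add: D_def[abs_def] right_diff_distrib)
    obtain d where d: "d \<in> borel_measurable borel" "AE x in lebesgue. d x = D x"
      using borel_representative_real[of D] D by auto
    have di: "integrable lborel d"
      using integrable_cong_AE[of d lebesgue D] D d by (simp add: measurable_completion integrable_completion)
    have "AE x in lborel. d x = 0"
    proof (rule zero_AE_if_test_integrals_zero[OF di])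
      fix \<phi> :: "real^'n \<Rightarrow> real" assume \<phi>: "test_function \<phi>"
      have "(LINT x|lborel. d x * \<phi> x) = (LINT x|lebesgue. D x * \<phi> x)"
        using d D by (intro lebesgue_integral_representative \<phi>) auto
      also have "\<dots> = (LINT x|lebesgue. G x $ i * (\<psi> x * \<phi> x)) - (LINT x|lebesgue. H x $ i * (\<psi> x * \<phi> x))"
        using i[OF \<phi>] by (simp add: D_def algebra_simps)
      also have "(LINT x|lebesgue. G x $ i * (\<psi> x * \<phi> x)) = (LINT x|lebesgue. H x $ i * (\<psi> x * \<phi> x))"
        using G H test_function_mult[OF test_function_smooth[OF \<psi>(1)] \<phi>] by (simp add: has_weak_gradient_def)
      finally show "(LINT x|lborel. d x * \<phi> x) = 0" by simp
    qed
    then have "AE x in lebesgue. d x = 0" by (rule AE_completion)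
    with d(2) show ?thesis by eventually_elim (auto simp: D_def \<psi>(2))
  qed
  then have "AE x in lebesgue. x \<in> ball 0 (real (Suc k)) \<longrightarrow> (\<forall>i. G x $ i = H x $ i)" for k
    unfolding all_simps(6)[symmetric] AE_all_countable by blast
  then have "AE x in lebesgue. \<forall>i. G x $ i = H x $ i" by (rule AE_ball_imp_AE)
  then show ?thesis by (simp add: vec_eq_iff)
qed

section \<open>A Poincare inequality for functions with small support\<close>

lemma lborel_Tonelli:
  fixes f :: "'a::euclidean_space \<times> 'b::euclidean_space \<Rightarrow> ennreal"
  assumes "f \<in> borel_measurable borel"
  shows "(\<integral>\<^sup>+x. \<integral>\<^sup>+y. f (x, y) \<partial>lborel \<partial>lborel) = (\<integral>\<^sup>+y. \<integral>\<^sup>+x. f (x, y) \<partial>lborel \<partial>lborel)"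
  using assms by (intro lborel_pair.Fubini'[symmetric]) (simp add: lborel_prod)

text \<open>Jensen's inequality along the segment from \<open>x\<close> to \<open>x + z\<close>, which stays in \<open>B\<close> by convexity; then integrate
  over \<open>x\<close> and translate.\<close>

lemma translate_L2_bound:
  fixes w :: "real^'n::finite \<Rightarrow> real"
  assumes W: "L1_weak_gradient w H" and B: "convex B" "B \<in> sets borel"
  shows "(\<integral>\<^sup>+x. indicator {x. x \<in> B \<and> x + z \<in> B} x * ennreal ((w (x + z) - w x)\<^sup>2) \<partial>lborel)
    \<le> ennreal ((norm z)\<^sup>2) * (\<integral>\<^sup>+x. indicator B x * ennreal ((norm (H x))\<^sup>2) \<partial>lborel)"
proof -
  have [measurable]: "w \<in> borel_measurable borel" "H \<in> borel_measurable borel" "B \<in> sets borel"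
    using W B by (auto simp: L1_weak_gradient_def)
  define E where "E x = indicator B x * ennreal ((norm (H x))\<^sup>2)" for x
  have [measurable]: "E \<in> borel_measurable borel" unfolding E_def[abs_def] by measurable
  have "(\<integral>\<^sup>+x. indicator {x. x \<in> B \<and> x + z \<in> B} x * ennreal ((w (x + z) - w x)\<^sup>2) \<partial>lborel)
    \<le> (\<integral>\<^sup>+x. \<integral>\<^sup>+s. ennreal ((norm z)\<^sup>2) * E (x + s *\<^sub>R z) \<partial>unit_measure \<partial>lborel)"
  proof (rule nn_integral_mono_AE)
    show "AE x in lborel. indicator {x. x \<in> B \<and> x + z \<in> B} x * ennreal ((w (x + z) - w x)\<^sup>2) \<le>
        (\<integral>\<^sup>+s. ennreal ((norm z)\<^sup>2) * E (x + s *\<^sub>R z) \<partial>unit_measure)"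
      using L1_weak_gradient_increment[OF W, of z]
    proof eventually_elim
      fix x assume inc: "w (x + z) - w x = (LINT s|unit_measure. H (x + s *\<^sub>R z) \<bullet> z)"
      show "indicator {x. x \<in> B \<and> x + z \<in> B} x * ennreal ((w (x + z) - w x)\<^sup>2) \<le>
        (\<integral>\<^sup>+s. ennreal ((norm z)\<^sup>2) * E (x + s *\<^sub>R z) \<partial>unit_measure)"
      proof (cases "x \<in> B \<and> x + z \<in> B")
        case True
        have seg: "x + s *\<^sub>R z \<in> B" if "0 \<le> s" "s \<le> 1" for s
        proof -
          have "(1 - s) *\<^sub>R x + s *\<^sub>R (x + z) \<in> B"
            using B(1) True that by (intro convexD) auto
          then show ?thesis by (simp add: algebra_simps)
        qed
        have "ennreal \<bar>LINT s|unit_measure. H (x + s *\<^sub>R z) \<bullet> z\<bar> \<le> (\<integral>\<^sup>+s. ennreal \<bar>H (x + s *\<^sub>R z) \<bullet> z\<bar> \<partial>unit_measure)"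
        proof (cases "integrable unit_measure (\<lambda>s. H (x + s *\<^sub>R z) \<bullet> z)")
          case True
          then show ?thesis using integral_norm_bound_ennreal[OF True] by simp
        next
          case False
          then show ?thesis by (simp add: not_integrable_integral_eq)
        qed
        then have "(ennreal \<bar>LINT s|unit_measure. H (x + s *\<^sub>R z) \<bullet> z\<bar>)\<^sup>2 \<le> (\<integral>\<^sup>+s. ennreal \<bar>H (x + s *\<^sub>R z) \<bullet> z\<bar> * 1 \<partial>unit_measure)\<^sup>2"
          by (intro power_mono) auto
        also have "\<dots> \<le> (\<integral>\<^sup>+s. (ennreal \<bar>H (x + s *\<^sub>R z) \<bullet> z\<bar>)\<^sup>2 \<partial>unit_measure) * (\<integral>\<^sup>+s. 1\<^sup>2 \<partial>unit_measure)"
          by (rule Cauchy_Schwarz_nn_integral) auto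
        also have "\<dots> = (\<integral>\<^sup>+s. (ennreal \<bar>H (x + s *\<^sub>R z) \<bullet> z\<bar>)\<^sup>2 \<partial>unit_measure)"
          using unit_measure.emeasure_space_1 by simp
        also have "\<dots> \<le> (\<integral>\<^sup>+s. ennreal ((norm z)\<^sup>2) * E (x + s *\<^sub>R z) \<partial>unit_measure)"
        proof (rule nn_integral_mono_AE)
          show "AE s in unit_measure. (ennreal \<bar>H (x + s *\<^sub>R z) \<bullet> z\<bar>)\<^sup>2 \<le> ennreal ((norm z)\<^sup>2) * E (x + s *\<^sub>R z)"
            using AE_unit_measure
          proof eventually_elim
            fix s :: real assume "0 \<le> s \<and> s \<le> 1"
            then have "E (x + s *\<^sub>R z) = ennreal ((norm (H (x + s *\<^sub>R z)))\<^sup>2)" using seg by (simp add: E_def)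
            moreover have "\<bar>H (x + s *\<^sub>R z) \<bullet> z\<bar>\<^sup>2 \<le> (norm z * norm (H (x + s *\<^sub>R z)))\<^sup>2"
              using Cauchy_Schwarz_ineq2[of "H (x + s *\<^sub>R z)" z] by (intro power_mono) (auto simp: mult.commute)
            ultimately show "(ennreal \<bar>H (x + s *\<^sub>R z) \<bullet> z\<bar>)\<^sup>2 \<le> ennreal ((norm z)\<^sup>2) * E (x + s *\<^sub>R z)"
              by (simp add: ennreal_power ennreal_mult[symmetric] power_mult_distrib ennreal_leI)
          qed
        qed
        finally show ?thesis using True by (simp add: inc ennreal_power)
      qed simp
    qed
  qed
  also have "\<dots> = (\<integral>\<^sup>+s. \<integral>\<^sup>+x. ennreal ((norm z)\<^sup>2) * E (x + s *\<^sub>R z) \<partial>lborel \<partial>unit_measure)"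
    by (rule unit_lborel.Fubini'[where f="\<lambda>s x. ennreal ((norm z)\<^sup>2) * E (x + s *\<^sub>R z)"]) measurable
  also have "\<dots> = (\<integral>\<^sup>+s. ennreal ((norm z)\<^sup>2) * (\<integral>\<^sup>+x. E x \<partial>lborel) \<partial>unit_measure)"
    by (simp add: nn_integral_cmult lborel_nn_integral_translate)
  also have "\<dots> = ennreal ((norm z)\<^sup>2) * (\<integral>\<^sup>+x. E x \<partial>lborel)"
    using unit_measure.emeasure_space_1 by simp
  finally show ?thesis by (simp add: E_def)
qed

lemma half_ball_in_ball:
  fixes x y :: "'a::real_normed_vector"
  assumes "x \<in> ball y s" "0 < h" "h \<le> s"
  obtains c where "ball c (h / 2) \<subseteq> ball y s \<inter> ball x h"
proof -
  \<comment> \<open>Move \<open>x\<close> towards the centre by the fraction \<open>h/(2s)\<close> of its distance, hence by less than \<open>h/2\<close>.\<close>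
  define c where "c = x + (h / (2 * s)) *\<^sub>R (y - x)"
  have s: "s > 0" using assms by linarith
  have lt: "dist x y < s" using assms by (simp add: dist_commute)
  have "dist c x = h / (2 * s) * dist x y"
    using s assms(2) by (simp add: c_def dist_norm norm_minus_commute)
  also have "\<dots> < h / (2 * s) * s" using lt s assms(2) by (intro mult_strict_left_mono) auto
  finally have cx: "dist c x < h / 2" using s by simp
  have "c - y = (1 - h / (2 * s)) *\<^sub>R (x - y)" by (simp add: c_def algebra_simps)
  then have "dist c y = (1 - h / (2 * s)) * dist x y"
    using s assms(3) by (simp add: dist_norm divide_le_eq)
  also have "\<dots> < (1 - h / (2 * s)) * s" using lt s assms(3) by (intro mult_strict_left_mono) (auto simp: divide_less_eq)
  also have "\<dots> = s - h / 2" using s by (simp add: algebra_simps)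
  finally have cy: "dist c y < s - h / 2" .
  show ?thesis
  proof (rule that[of c], rule subsetI)
    fix v assume "v \<in> ball c (h / 2)"
    then have v: "dist c v < h / 2" by simp
    have "dist y v \<le> dist c y + dist c v" "dist x v \<le> dist c x + dist c v"
      by (metis dist_commute dist_triangle)+
    then show "v \<in> ball y s \<inter> ball x h" using v cx cy by auto
  qed
qed

text \<open>Within distance \<open>h\<close> of every point of the ball there is a ball of radius \<open>h / 2\<close>, on at least half of
  which \<open>w = 0\<close>. So \<open>w\<^sup>2\<close> is controlled by the mean of its squared increments over distances below \<open>h\<close>.\<close>

lemma poincare_small_support_L1:
  fixes w :: "real^'n::finite \<Rightarrow> real" and y :: "real^'n"
  assumes W: "L1_weak_gradient w H" and h: "0 < h" "h \<le> s"
    and small: "measure lborel {x \<in> ball y s. w x \<noteq> 0} \<le> measure lborel (ball (0::real^'n) (h / 2)) / 2"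
  shows "(\<integral>\<^sup>+x. indicator (ball y s) x * ennreal ((w x)\<^sup>2) \<partial>lborel)
    \<le> ennreal (2 ^ (CARD('n) + 1) * h\<^sup>2) * (\<integral>\<^sup>+x. indicator (ball y s) x * ennreal ((norm (H x))\<^sup>2) \<partial>lborel)"
proof -
  have [measurable]: "w \<in> borel_measurable borel" "H \<in> borel_measurable borel"
    using W by (auto simp: L1_weak_gradient_def)
  define B where "B = ball y s"
  have [measurable]: "B \<in> sets borel" by (simp add: B_def)
  define A where "A = {x \<in> B. w x \<noteq> 0}"
  have [measurable]: "A \<in> sets borel" unfolding A_def by measurable
  define c where "c = measure lborel (ball (0::real^'n) (h / 2)) / 2"
  have cvol: "measure lborel (ball a (h / 2)) = 2 * c" for a :: "real^'n"
    using h by (simp add: c_def content_ball)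
  have c: "c > 0" using content_ball_pos[of "h / 2" "0::real^'n"] h by (simp add: c_def)
  have vol: "measure lborel (ball (0::real^'n) h) = 2 ^ CARD('n) * (2 * c)"
    using h by (simp add: c_def content_ball power_divide)
  have A: "measure lborel A \<le> c" using small by (simp add: A_def B_def c_def)
  have Afin: "emeasure lborel A < \<infinity>"
  proof -
    have "A \<subseteq> ball y s" by (auto simp: A_def B_def)
    then show ?thesis
      using le_less_trans[OF emeasure_mono[of A "ball y s" lborel] emeasure_lborel_ball_finite[of y s]] by simp
  qed
  \<comment> \<open>The zeros of \<open>w\<close> near \<open>x\<close>: there the increment from \<open>x\<close> has square \<open>w(x)\<^sup>2\<close>.\<close>
  define Z where "Z x = {v \<in> B. dist x v < h \<and> w v = 0}" for x
  have Zm: "Z x \<in> sets borel" for x unfolding Z_def by measurable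
  have Z: "ennreal c \<le> emeasure lborel (Z x)" if x: "x \<in> B" for x
  proof -
    obtain p where p: "ball p (h / 2) \<subseteq> ball y s \<inter> ball x h"
      using half_ball_in_ball[of x y s h] x h by (auto simp: B_def)
    have fin: "ball p (h / 2) \<in> fmeasurable lborel" "A \<in> fmeasurable lborel"
      using Afin emeasure_lborel_ball_finite[of p "h/2"] by (auto intro!: fmeasurableI)
    have "2 * c = measure lborel (ball p (h / 2))" by (simp add: cvol)
    also have "\<dots> \<le> measure lborel ((ball p (h / 2) - A) \<union> A)"
      using fin by (intro measure_mono_fmeasurable) (auto intro: fmeasurable.Un fmeasurable.Diff)
    also have "\<dots> \<le> measure lborel (ball p (h / 2) - A) + measure lborel A"
      by (rule measure_Un_le) auto
    finally have "c \<le> measure lborel (ball p (h / 2) - A)" using A by simp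
    then have "ennreal c \<le> emeasure lborel (ball p (h / 2) - A)"
      using fin by (simp add: emeasure_eq_measure2[OF fmeasurable.Diff] ennreal_leI)
    also have "\<dots> \<le> emeasure lborel (Z x)"
    proof (rule emeasure_mono)
      show "ball p (h / 2) - A \<subseteq> Z x" using p by (auto simp: Z_def A_def B_def)
    qed (simp add: Zm)
    finally show ?thesis .
  qed
  define E where "E = (\<integral>\<^sup>+x. indicator B x * ennreal ((norm (H x))\<^sup>2) \<partial>lborel)"
  define D where "D x z = indicator {p. fst p \<in> B \<and> fst p + snd p \<in> B \<and> norm (snd p) < h} (x, z) * ennreal ((w (x + z) - w x)\<^sup>2)"
    for x z :: "real^'n"
  have Dm [measurable]: "(\<lambda>(x, z). D x z) \<in> borel_measurable (borel \<Otimes>\<^sub>M borel)"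
    unfolding D_def by measurable
  have "ennreal c * (\<integral>\<^sup>+x. indicator B x * ennreal ((w x)\<^sup>2) \<partial>lborel) = (\<integral>\<^sup>+x. ennreal c * (indicator B x * ennreal ((w x)\<^sup>2)) \<partial>lborel)"
    by (rule nn_integral_cmult[symmetric]) measurable
  also have "\<dots> \<le> (\<integral>\<^sup>+x. \<integral>\<^sup>+z. D x z \<partial>lborel \<partial>lborel)"
  proof (rule nn_integral_mono)
    fix x :: "real^'n"
    show "ennreal c * (indicator B x * ennreal ((w x)\<^sup>2)) \<le> (\<integral>\<^sup>+z. D x z \<partial>lborel)"
    proof (cases "x \<in> B")
      case True
      have "ennreal c * (indicator B x * ennreal ((w x)\<^sup>2)) \<le> emeasure lborel (Z x) * ennreal ((w x)\<^sup>2)"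
        using Z[OF True] True by (simp add: mult_right_mono)
      also have "\<dots> = (\<integral>\<^sup>+v. ennreal ((w x)\<^sup>2) * indicator (Z x) v \<partial>lborel)"
        using Zm[of x] by (subst nn_integral_cmult_indicator) (auto simp: mult.commute)
      also have "\<dots> \<le> (\<integral>\<^sup>+v. D x (v - x) \<partial>lborel)"
      proof (rule nn_integral_mono)
        fix v
        show "ennreal ((w x)\<^sup>2) * indicator (Z x) v \<le> D x (v - x)"
          using True by (auto simp: D_def Z_def indicator_def dist_norm norm_minus_commute)
      qed
      also have "\<dots> = (\<integral>\<^sup>+z. D x z \<partial>lborel)"
        using lborel_nn_integral_translate[of "\<lambda>z. D x z" "- x"] by simp
      finally show ?thesis .
    qed simp
  qed
  also have "\<dots> = (\<integral>\<^sup>+z. \<integral>\<^sup>+x. D x z \<partial>lborel \<partial>lborel)"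
    using lborel_Tonelli[of "\<lambda>(x, z). D x z"] Dm by (simp add: borel_prod)
  also have "\<dots> \<le> (\<integral>\<^sup>+z. (ennreal (h\<^sup>2) * E) * indicator (ball (0::real^'n) h) z \<partial>lborel)"
  proof (rule nn_integral_mono)
    fix z :: "real^'n"
    show "(\<integral>\<^sup>+x. D x z \<partial>lborel) \<le> (ennreal (h\<^sup>2) * E) * indicator (ball 0 h) z"
    proof (cases "norm z < h")
      case True
      have "(\<integral>\<^sup>+x. D x z \<partial>lborel) = (\<integral>\<^sup>+x. indicator {x. x \<in> B \<and> x + z \<in> B} x * ennreal ((w (x + z) - w x)\<^sup>2) \<partial>lborel)"
        using True by (auto simp: D_def indicator_def intro!: nn_integral_cong)
      also have "\<dots> \<le> ennreal ((norm z)\<^sup>2) * E"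
        unfolding E_def by (rule translate_L2_bound[OF W]) (simp_all add: B_def)
      also have "\<dots> \<le> ennreal (h\<^sup>2) * E"
        using True by (intro mult_right_mono ennreal_leI power_mono) auto
      finally show ?thesis using True by simp
    next
      case False
      then have "D x z = 0" for x by (simp add: D_def)
      then show ?thesis by simp
    qed
  qed
  also have "\<dots> = ennreal (h\<^sup>2) * E * emeasure lborel (ball (0::real^'n) h)"
    by (rule nn_integral_cmult_indicator) simp
  also have "emeasure lborel (ball (0::real^'n) h) = ennreal (2 ^ CARD('n) * (2 * c))"
    using emeasure_lborel_ball_finite[of "0::real^'n" h] by (simp add: vol[symmetric] emeasure_eq_ennreal_measure)
  also have "ennreal (h\<^sup>2) * E * ennreal (2 ^ CARD('n) * (2 * c)) = ennreal c * (ennreal (2 ^ (CARD('n) + 1) * h\<^sup>2) * E)"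
    using c by (simp add: ennreal_mult mult_ac)
  finally have "ennreal c * (\<integral>\<^sup>+x. indicator B x * ennreal ((w x)\<^sup>2) \<partial>lborel) \<le> ennreal c * (ennreal (2 ^ (CARD('n) + 1) * h\<^sup>2) * E)" .
  then show ?thesis
    using c by (subst (asm) ennreal_mult_le_mult_iff) (auto simp: B_def E_def)
qed

lemma nn_integral_ball_eq_integral:
  fixes f :: "real^'n::finite \<Rightarrow> real"
  assumes "integrable (lebesgue_on (ball y s)) f" "\<And>x. f x \<ge> 0"
  shows "(\<integral>\<^sup>+x. indicator (ball y s) x * ennreal (f x) \<partial>lebesgue) = ennreal (LINT x|lebesgue_on (ball y s). f x)"
proof -
  have "(\<integral>\<^sup>+x. ennreal (f x) \<partial>lebesgue_on (ball y s)) = ennreal (LINT x|lebesgue_on (ball y s). f x)"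
    using assms by (intro nn_integral_eq_integral) auto
  moreover have "(\<integral>\<^sup>+x. ennreal (f x) \<partial>lebesgue_on (ball y s)) = (\<integral>\<^sup>+x. indicator (ball y s) x * ennreal (f x) \<partial>lebesgue)"
    by (subst nn_integral_restrict_space) (auto simp: mult.commute)
  ultimately show ?thesis by simp
qed

lemma poincare_small_support:
  fixes v :: "real^'n::finite \<Rightarrow> real" and y :: "real^'n"
  assumes v: "L1_loc v" and H: "has_weak_gradient v H" and h: "0 < h" "h \<le> s"
    and iv: "integrable (lebesgue_on (ball y s)) (\<lambda>x. (v x)\<^sup>2)"
    and iH: "integrable (lebesgue_on (ball y s)) (\<lambda>x. (norm (H x))\<^sup>2)"
    and small: "measure lebesgue {x \<in> ball y s. v x \<noteq> 0} \<le> measure lebesgue (ball (0::real^'n) (h / 2)) / 2"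
  shows "(LINT x|lebesgue_on (ball y s). (v x)\<^sup>2) \<le> 2 ^ (CARD('n) + 1) * h\<^sup>2 * (LINT x|lebesgue_on (ball y s). (norm (H x))\<^sup>2)"
proof -
  define R where "R = norm y + s"
  have sub: "ball y s \<subseteq> ball 0 R"
  proof
    fix x assume "x \<in> ball y s"
    then show "x \<in> ball 0 R" using norm_triangle_ineq[of y "x - y"] by (simp add: R_def dist_norm norm_minus_commute)
  qed
  have R: "R > 0" using h by (simp add: R_def add_nonneg_pos)
  obtain w K where W: "L1_weak_gradient w K" "AE x in lebesgue. x \<in> ball 0 R \<longrightarrow> w x = v x \<and> K x = H x"
    using weak_gradient_representative[OF v H R] by blast
  then have ae: "AE x in lebesgue. x \<in> ball y s \<longrightarrow> w x = v x \<and> K x = H x"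
    using sub by (auto elim!: eventually_mono)
  have [measurable]: "w \<in> borel_measurable borel" "K \<in> borel_measurable borel"
    using W by (auto simp: L1_weak_gradient_def)
  have vm: "v \<in> borel_measurable lebesgue" using v by (simp add: L1_loc_def)
  have "measure lborel {x \<in> ball y s. w x \<noteq> 0} = measure lebesgue {x \<in> ball y s. w x \<noteq> 0}"
    by (rule measure_completion[symmetric]) measurable
  also have "\<dots> = measure lebesgue {x \<in> ball y s. v x \<noteq> 0}"
  proof (rule measure_eq_AE)
    show "AE x in lebesgue. x \<in> {x \<in> ball y s. w x \<noteq> 0} \<longleftrightarrow> x \<in> {x \<in> ball y s. v x \<noteq> 0}"
      using ae by eventually_elim auto
    have "{x \<in> ball y s. w x \<noteq> 0} \<in> sets borel" by measurable
    then show "{x \<in> ball y s. w x \<noteq> 0} \<in> sets lebesgue" by auto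
    have "{x \<in> space lebesgue. v x \<noteq> 0} \<in> sets lebesgue" using vm by measurable
    then have "ball y s \<inter> {x. v x \<noteq> 0} \<in> sets lebesgue" by auto
    moreover have "ball y s \<inter> {x. v x \<noteq> 0} = {x \<in> ball y s. v x \<noteq> 0}" by auto
    ultimately show "{x \<in> ball y s. v x \<noteq> 0} \<in> sets lebesgue" by (simp only:)
  qed
  finally have "measure lborel {x \<in> ball y s. w x \<noteq> 0} \<le> measure lborel (ball (0::real^'n) (h / 2)) / 2"
    using small by simp
  from poincare_small_support_L1[OF W(1) h this]
  have "(\<integral>\<^sup>+x. indicator (ball y s) x * ennreal ((w x)\<^sup>2) \<partial>lebesgue)
    \<le> ennreal (2 ^ (CARD('n) + 1) * h\<^sup>2) * (\<integral>\<^sup>+x. indicator (ball y s) x * ennreal ((norm (K x))\<^sup>2) \<partial>lebesgue)"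
    by (simp add: nn_integral_completion)
  also have "(\<integral>\<^sup>+x. indicator (ball y s) x * ennreal ((w x)\<^sup>2) \<partial>lebesgue) = (\<integral>\<^sup>+x. indicator (ball y s) x * ennreal ((v x)\<^sup>2) \<partial>lebesgue)"
    using ae by (intro nn_integral_cong_AE) (auto elim!: eventually_mono simp: indicator_def)
  also have "\<dots> = ennreal (LINT x|lebesgue_on (ball y s). (v x)\<^sup>2)"
    by (rule nn_integral_ball_eq_integral[OF iv]) simp
  also have "(\<integral>\<^sup>+x. indicator (ball y s) x * ennreal ((norm (K x))\<^sup>2) \<partial>lebesgue) = (\<integral>\<^sup>+x. indicator (ball y s) x * ennreal ((norm (H x))\<^sup>2) \<partial>lebesgue)"
    using ae by (intro nn_integral_cong_AE) (auto elim!: eventually_mono simp: indicator_def)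
  also have "\<dots> = ennreal (LINT x|lebesgue_on (ball y s). (norm (H x))\<^sup>2)"
    by (rule nn_integral_ball_eq_integral[OF iH]) simp
  finally show ?thesis
    by (simp add: ennreal_mult[symmetric] ennreal_le_iff)
qed

section \<open>The energy inequality for minimizers\<close>

lemma integrable_on_ball_iff:
  "integrable (lebesgue_on (ball y t)) f \<longleftrightarrow> integrable lebesgue (\<lambda>x. indicator (ball y t) x * f x)"
  for f :: "real^'n::finite \<Rightarrow> real"
  by (subst integrable_restrict_space) auto

lemma integral_on_ball:
  "(LINT x|lebesgue_on (ball y t). f x) = (LINT x|lebesgue. indicator (ball y t) x * f x)"
  for f :: "real^'n::finite \<Rightarrow> real"
  by (subst integral_restrict_space) auto

lemma integrable_on_ball_subset:
  fixes f :: "real^'n::finite \<Rightarrow> real"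
  assumes "integrable (lebesgue_on S) f" "ball y t \<subseteq> S" "S \<in> sets lebesgue"
  shows "integrable (lebesgue_on (ball y t)) f"
proof -
  have "set_integrable lebesgue S f"
    using assms(1,3) by (simp add: set_integrable_def integrable_restrict_space)
  then have "set_integrable lebesgue (ball y t) f"
    by (rule set_integrable_subset) (use assms in auto)
  then show ?thesis by (simp add: set_integrable_def integrable_restrict_space)
qed

lemma integral_on_ball_mono:
  fixes f :: "real^'n::finite \<Rightarrow> real"
  assumes "integrable (lebesgue_on (ball z r)) f" "ball y t \<subseteq> ball z r" "\<And>x. f x \<ge> 0"
  shows "(LINT x|lebesgue_on (ball y t). f x) \<le> (LINT x|lebesgue_on (ball z r). f x)"
  unfolding integral_on_ball
  using assms integrable_on_ball_subset[OF assms(1,2)]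
  by (intro integral_mono) (auto simp: integrable_on_ball_iff indicator_def)

lemma weak_gradient_works:
  assumes "w \<in> W12"
  shows "has_weak_gradient w (weak_gradient w)" "L2 (weak_gradient w)"
proof -
  obtain G where G: "has_weak_gradient w G" "L2 G" using assms by (auto simp: W12_def)
  then show 1: "has_weak_gradient w (weak_gradient w)"
    using someI[of "has_weak_gradient w"] by (simp add: weak_gradient_def)
  have m: "weak_gradient w \<in> borel_measurable lebesgue" using 1 by (simp add: has_weak_gradient_def L1_loc_def)
  have "integrable lebesgue (\<lambda>x. (norm (G x))\<^sup>2) = integrable lebesgue (\<lambda>x. (norm (weak_gradient w x))\<^sup>2)"
    using has_weak_gradient_unique[OF G(1) 1] G(2) m
    by (intro integrable_cong_AE) (auto simp: L2_def elim: eventually_mono)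
  then show "L2 (weak_gradient w)" using G(2) m by (simp add: L2_def)
qed

lemma energy_weak_gradient:
  assumes "has_weak_gradient w H"
  shows "(LINT x|lebesgue. (norm (weak_gradient w x))\<^sup>2) = (LINT x|lebesgue. (norm (H x))\<^sup>2)"
proof (rule integral_cong_AE)
  have 1: "has_weak_gradient w (weak_gradient w)"
    using assms someI[of "has_weak_gradient w"] by (simp add: weak_gradient_def)
  show "AE x in lebesgue. (norm (weak_gradient w x))\<^sup>2 = (norm (H x))\<^sup>2"
    using has_weak_gradient_unique[OF 1 assms] by (auto elim: eventually_mono)
  show "(\<lambda>x. (norm (weak_gradient w x))\<^sup>2) \<in> borel_measurable lebesgue" "(\<lambda>x. (norm (H x))\<^sup>2) \<in> borel_measurable lebesgue"
    using 1 assms by (auto simp: has_weak_gradient_def L1_loc_def)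
qed

lemma set_tuples_hand_over:
  assumes W: "W \<in> set_tuples N \<Omega>" and N: "1 \<le> N" and A: "A \<in> sets borel" "A \<subseteq> W 1"
    and A': "\<And>j. j \<in> {2..N} \<Longrightarrow> A' j \<in> sets borel" "\<And>j. j \<in> {2..N} \<Longrightarrow> A' j \<subseteq> A" "disjoint_family_on A' {2..N}"
  shows "(\<lambda>i\<in>{1..N}. if i = 1 then W 1 - A else W i \<union> A' i) \<in> set_tuples N \<Omega>" (is "?W' \<in> _")
proof -
  have Wi: "W i \<in> sets borel" "W i \<subseteq> \<Omega>" if "i \<in> {1..N}" for i
    using that W by (auto simp: set_tuples_def PiE_def Pi_def)
  have Wd: "disjoint_family_on W {1..N}" using W by (auto simp: set_tuples_def)
  have sets: "?W' i \<in> sets borel" "?W' i \<subseteq> \<Omega>" if i: "i \<in> {1..N}" for i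
  proof -
    have W1: "W 1 \<in> sets borel" "W 1 \<subseteq> \<Omega>" using Wi[of 1] N by auto
    show "?W' i \<in> sets borel" using i Wi(1)[OF i] W1 A A'(1)[of i] by auto
    show "?W' i \<subseteq> \<Omega>" using i Wi(2)[OF i] W1 A A'(2)[of i] by (fastforce split: if_splits)
  qed
  have "disjoint_family_on ?W' {1..N}"
    unfolding disjoint_family_on_def
  proof (intro ballI impI)
    fix i j assume ij: "i \<in> {1..N}" "j \<in> {1..N}" "i \<noteq> j"
    have d: "W i \<inter> W j = {}" using Wd ij by (auto simp: disjoint_family_on_def)
    have d1: "k \<in> {1..N} \<Longrightarrow> k \<noteq> 1 \<Longrightarrow> W k \<inter> W 1 = {}" for k
      using Wd N by (auto simp: disjoint_family_on_def)
    have dA: "i \<noteq> 1 \<Longrightarrow> j \<noteq> 1 \<Longrightarrow> A' i \<inter> A' j = {}"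
      using A'(3) ij by (auto simp: disjoint_family_on_def)
    have sA: "k \<in> {1..N} \<Longrightarrow> k \<noteq> 1 \<Longrightarrow> A' k \<subseteq> A" for k using A'(2)[of k] by auto
    have cross: "k \<in> {1..N} \<Longrightarrow> k \<noteq> 1 \<Longrightarrow> l \<in> {1..N} \<Longrightarrow> l \<noteq> 1 \<Longrightarrow> W k \<inter> A' l = {}" for k l
      using d1[of k] sA[of l] A(2) by blast
    show "?W' i \<inter> ?W' j = {}"
      using d d1[of i] d1[of j] dA sA[of i] sA[of j] cross[of i j] cross[of j i] ij A(2) by auto
  qed
  then show ?thesis using sets by (auto simp: set_tuples_def)
qed

locale nondegenerate_minimizer =
  fixes N :: nat and \<Omega> :: "(real^'n::finite) set" and f g :: "nat \<Rightarrow> real^'n \<Rightarrow> real"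
    and F :: "(nat \<Rightarrow> (real^'n) set) \<Rightarrow> real" and u :: "nat \<Rightarrow> real^'n \<Rightarrow> real" and W :: "nat \<Rightarrow> (real^'n) set"
    and lam \<epsilon> a b :: real
  assumes N: "1 \<le> N" and Omega: "\<Omega> \<in> sets borel"
    and lower: "lower_order_converges N \<Omega> f g"
    and minimizer: "J_minimizer N \<Omega> f g F u W"
    and f_bound: "AE x in lebesgue_on \<Omega>. \<bar>f 1 x\<bar> \<le> a" and g_bound: "AE x in lebesgue_on \<Omega>. \<bar>g 1 x\<bar> \<le> b"
    and a: "0 \<le> a" and b: "0 \<le> b" and lam: "0 < lam"
    and nondegenerate: "nondegenerate1 N F W lam \<epsilon>"
begin

definition v :: "real^'n \<Rightarrow> real" where "v x = max 0 (u 1 x)"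

definition G :: "real^'n \<Rightarrow> real^'n" where "G = weak_gradient (u 1)"

definition P :: "real^'n \<Rightarrow> real^'n" where "P = positive_part_gradient (u 1) G"

lemma admissible: "(u, W) \<in> admissible_pairs N \<Omega>"
  using minimizer by (simp add: J_minimizer_def)

lemma u1: "u 1 \<in> W12" and W1: "W 1 \<in> sets borel" "W 1 \<subseteq> \<Omega>"
  and u1_zero: "AE x in lebesgue. x \<notin> W 1 \<longrightarrow> u 1 x = 0"
  using admissible N by (auto simp: admissible_pairs_def set_tuples_def PiE_def Pi_def)

lemma u1_L2_loc: "L2_loc (u 1)" and u1_L1_loc: "L1_loc (u 1)"
  using u1 L2_loc_imp_L1_loc by (auto simp: W12_def)

lemma G: "has_weak_gradient (u 1) G" "L2 G"
  unfolding G_def by (rule weak_gradient_works[OF u1])+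

lemma P: "has_weak_gradient v P"
  unfolding v_def[abs_def] P_def by (rule has_weak_gradient_positive_part[OF u1_L1_loc G(1)])

lemma v_nonneg: "0 \<le> v x" and v_le: "\<bar>v x\<bar> \<le> \<bar>u 1 x\<bar>" and v_mult_u: "v x * u 1 x = (v x)\<^sup>2"
  by (auto simp: v_def max_def power2_eq_square)

lemma v_measurable: "v \<in> borel_measurable lebesgue"
  using u1_L1_loc by (auto simp: v_def[abs_def] L1_loc_def)

lemma v_L1_loc: "L1_loc v"
  by (rule L1_locI[OF v_measurable u1_L1_loc]) (unfold real_norm_def, rule v_le)

lemma P_G: "P x $ i * G x $ i = (P x $ i)\<^sup>2" and v_G: "v x * G x $ i = v x * P x $ i"
  by (auto simp: P_def v_def positive_part_gradient_def power2_eq_square max_def)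

lemma P_measurable: "P \<in> borel_measurable lebesgue"
  using P by (auto simp: has_weak_gradient_def L1_loc_def)

lemma P_le_G: "norm (P x) \<le> norm (G x)"
  unfolding P_def using positive_part_gradient_component_le[of "u 1" G x]
  by (intro norm_le_componentwise_cart) simp

lemma P_square_integrable: "integrable lebesgue (\<lambda>x. (norm (P x))\<^sup>2)"
proof (rule Bochner_Integration.integrable_bound)
  show "integrable lebesgue (\<lambda>x. (norm (G x))\<^sup>2)" using G(2) by (simp add: L2_def)
  show "AE x in lebesgue. norm ((norm (P x))\<^sup>2) \<le> norm ((norm (G x))\<^sup>2)"
    using P_le_G by (auto intro!: power_mono)
qed (use P_measurable in auto)

lemma P_square_integrable_ball: "integrable (lebesgue_on (ball y t)) (\<lambda>x. (norm (P x))\<^sup>2)"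
  unfolding integrable_on_ball_iff using integrable_mult_indicator[OF _ P_square_integrable, of "ball y t"] by simp

lemma v_square_integrable_ball: "integrable (lebesgue_on (ball y t)) (\<lambda>x. (v x)\<^sup>2)"
proof (rule integrable_on_ball_subset[of "cball y t"])
  show "integrable (lebesgue_on (cball y t)) (\<lambda>x. (v x)\<^sup>2)"
  proof (rule Bochner_Integration.integrable_bound)
    show "integrable (lebesgue_on (cball y t)) (\<lambda>x. (u 1 x)\<^sup>2)" using u1_L2_loc by (simp add: L2_loc_def)
    show "(\<lambda>x. (v x)\<^sup>2) \<in> borel_measurable (lebesgue_on (cball y t))"
      by (intro measurable_restrict_space1 borel_measurable_power v_measurable)
    show "AE x in lebesgue_on (cball y t). norm ((v x)\<^sup>2) \<le> norm ((u 1 x)\<^sup>2)"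
      using v_le by (auto simp: abs_le_square_iff)
  qed
qed auto

lemma v_integrable_ball: "integrable (lebesgue_on (ball y t)) v"
proof (rule integrable_on_ball_subset[of "cball y t"])
  show "integrable (lebesgue_on (cball y t)) v" using v_L1_loc by (simp add: L1_loc_def)
qed auto

lemma v_P_integrable_ball: "integrable (lebesgue_on (ball y t)) (\<lambda>x. v x * norm (P x))"
proof (rule Bochner_Integration.integrable_bound)
  show "integrable (lebesgue_on (ball y t)) (\<lambda>x. (v x)\<^sup>2 + (norm (P x))\<^sup>2)"
    by (intro Bochner_Integration.integrable_add v_square_integrable_ball P_square_integrable_ball)
  show "(\<lambda>x. v x * norm (P x)) \<in> borel_measurable (lebesgue_on (ball y t))"
    using P_measurable by (intro measurable_restrict_space1 borel_measurable_times v_measurable) simp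
  show "AE x in lebesgue_on (ball y t). norm (v x * norm (P x)) \<le> norm ((v x)\<^sup>2 + (norm (P x))\<^sup>2)"
  proof (rule AE_I2)
    fix x
    have "0 \<le> (v x - norm (P x))\<^sup>2" by simp
    then have "2 * (v x * norm (P x)) \<le> (v x)\<^sup>2 + (norm (P x))\<^sup>2"
      by (simp add: power2_diff)
    moreover have "0 \<le> v x * norm (P x)" by (simp add: v_nonneg)
    ultimately show "norm (v x * norm (P x)) \<le> norm ((v x)\<^sup>2 + (norm (P x))\<^sup>2)" by simp
  qed
qed

lemma positive_set_open:
  assumes "continuous_on (ball y t) (u 1)" "s \<le> t"
  shows "open {x \<in> ball y s. u 1 x > 0}"
proof -
  have "continuous_on (ball y s) (u 1)" using assms by (auto intro: continuous_on_subset)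
  then have "open (ball y s \<inter> u 1 -` {0<..})" by (intro continuous_open_preimage) auto
  moreover have "ball y s \<inter> u 1 -` {0<..} = {x \<in> ball y s. u 1 x > 0}" by auto
  ultimately show ?thesis by simp
qed

lemma positive_set_measure_pos:
  assumes "continuous_on (ball y t) (u 1)" "0 < s" "s \<le> t" "u 1 y > 0"
  shows "measure lebesgue {x \<in> ball y s. u 1 x > 0} > 0"
proof -
  have o: "open {x \<in> ball y s. u 1 x > 0}" by (rule positive_set_open[OF assms(1,3)])
  moreover have "y \<in> {x \<in> ball y s. u 1 x > 0}" using assms by simp
  ultimately obtain e where e: "e > 0" "ball y e \<subseteq> {x \<in> ball y s. u 1 x > 0}"
    by (meson openE)
  have "0 < measure lebesgue (ball y e)" using content_ball_pos[OF e(1)] by simp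
  also have "\<dots> \<le> measure lebesgue {x \<in> ball y s. u 1 x > 0}"
    using e(2) o by (intro measure_mono_fmeasurable) (auto intro!: lmeasurable_open bounded_subset[OF bounded_ball[of y s]])
  finally show ?thesis .
qed

text \<open>The pointwise cost of replacing \<open>u\<^sub>1\<close> by \<open>u\<^sub>1 - \<psi>v\<close>, with \<open>p = \<psi>(x)\<close> and \<open>d = \<nabla>\<psi>(x)\<close>. The identities
  \<open>G \<bullet> P = |P|\<^sup>2\<close> and \<open>v G = v P\<close> turn all products with \<open>G\<close> into products with \<open>P\<close>.\<close>

lemma competitor_gradient:
  assumes "0 \<le> p" "p \<le> 1"
  shows "(norm (G x - (p *\<^sub>R P x + v x *\<^sub>R d)))\<^sup>2 \<le> (norm (G x))\<^sup>2 - (2 * p - p\<^sup>2) * (norm (P x))\<^sup>2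
    + 2 * v x * norm d * norm (P x) + (v x)\<^sup>2 * (norm d)\<^sup>2"
proof -
  have GP: "G x \<bullet> P x = (norm (P x))\<^sup>2"
    unfolding power2_norm_eq_inner by (simp add: inner_vec_def P_G mult.commute[of "G x $ _"] power2_eq_square)
  have vG: "v x *\<^sub>R G x = v x *\<^sub>R P x" by (simp add: vec_eq_iff v_G)
  have vd: "v x * (G x \<bullet> d) = v x * (P x \<bullet> d)"
    using arg_cong[OF vG, of "\<lambda>q. q \<bullet> d"] by simp
  have "(norm (G x - (p *\<^sub>R P x + v x *\<^sub>R d)))\<^sup>2 = (norm (G x))\<^sup>2 - 2 * p * (G x \<bullet> P x) - 2 * (v x * (G x \<bullet> d))
      + p\<^sup>2 * (norm (P x))\<^sup>2 + 2 * p * (v x * (P x \<bullet> d)) + (v x)\<^sup>2 * (norm d)\<^sup>2"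
    unfolding power2_norm_eq_inner by (simp add: inner_commute algebra_simps power2_eq_square)
  also have "\<dots> = (norm (G x))\<^sup>2 - (2 * p - p\<^sup>2) * (norm (P x))\<^sup>2 + 2 * - ((1 - p) * (v x * (P x \<bullet> d))) + (v x)\<^sup>2 * (norm d)\<^sup>2"
    unfolding GP vd by (simp add: algebra_simps)
  also have "2 * - ((1 - p) * (v x * (P x \<bullet> d))) \<le> 2 * v x * norm d * norm (P x)"
  proof -
    have "- ((1 - p) * (v x * (P x \<bullet> d))) \<le> \<bar>(1 - p) * (v x * (P x \<bullet> d))\<bar>" by linarith
    also have "\<dots> = (1 - p) * (v x * \<bar>P x \<bullet> d\<bar>)" using assms v_nonneg[of x] by (simp add: abs_mult)
    also have "\<dots> \<le> 1 * (v x * (norm (P x) * norm d))"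
      using assms v_nonneg[of x] Cauchy_Schwarz_ineq2[of "P x" d] by (intro mult_mono) auto
    finally have "2 * - ((1 - p) * (v x * (P x \<bullet> d))) \<le> 2 * (1 * (v x * (norm (P x) * norm d)))"
      by (intro mult_left_mono) auto
    then show ?thesis by (simp add: algebra_simps)
  qed
  finally show ?thesis by simp
qed

lemma competitor_lower_order:
  assumes p: "0 \<le> p" "p \<le> 1" and f: "\<bar>f 1 x\<bar> \<le> a" and g: "\<bar>g 1 x\<bar> \<le> b"
  shows "((u 1 x - p * v x)\<^sup>2 * f 1 x - (u 1 x - p * v x) * g 1 x) - ((u 1 x)\<^sup>2 * f 1 x - u 1 x * g 1 x)
    \<le> a * (v x)\<^sup>2 + b * v x"
proof -
  have sq: "(u 1 x - p * v x)\<^sup>2 = (u 1 x)\<^sup>2 + (p\<^sup>2 - 2 * p) * (v x)\<^sup>2"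
    using v_mult_u[of x] by (simp add: power2_diff power_mult_distrib algebra_simps)
  have "(p\<^sup>2 - 2 * p) * f 1 x \<le> a"
  proof -
    have "p\<^sup>2 - 2 * p = (1 - p)\<^sup>2 - 1" by (simp add: power2_eq_square algebra_simps)
    moreover have "0 \<le> (1 - p)\<^sup>2" "(1 - p)\<^sup>2 \<le> 1" using p by (auto simp: power_le_one)
    ultimately have "\<bar>p\<^sup>2 - 2 * p\<bar> \<le> 1" by linarith
    then have "\<bar>p\<^sup>2 - 2 * p\<bar> * \<bar>f 1 x\<bar> \<le> 1 * a" using f by (intro mult_mono) auto
    then have "\<bar>(p\<^sup>2 - 2 * p) * f 1 x\<bar> \<le> a" by (simp add: abs_mult)
    then show ?thesis by linarith
  qed
  from mult_right_mono[OF this, of "(v x)\<^sup>2"]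
  have 1: "(p\<^sup>2 - 2 * p) * f 1 x * (v x)\<^sup>2 \<le> a * (v x)\<^sup>2" by simp
  have "p * \<bar>g 1 x\<bar> \<le> 1 * b" using g p by (intro mult_mono) auto
  then have "\<bar>p * g 1 x\<bar> \<le> b" using p by (simp add: abs_mult)
  then have "p * g 1 x \<le> b" by linarith
  from mult_right_mono[OF this v_nonneg[of x]] have 2: "p * g 1 x * v x \<le> b * v x" .
  have "((u 1 x - p * v x)\<^sup>2 * f 1 x - (u 1 x - p * v x) * g 1 x) - ((u 1 x)\<^sup>2 * f 1 x - u 1 x * g 1 x)
      = (p\<^sup>2 - 2 * p) * f 1 x * (v x)\<^sup>2 + p * g 1 x * v x"
    unfolding sq by (simp add: algebra_simps)
  with 1 2 show ?thesis by linarith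
qed

text \<open>Minimality against the competitor that gives the positive part of \<open>u\<^sub>1\<close> in \<open>B(y,s)\<close> away. The
  nondegeneracy condition requires the set \<open>A\<close> to have positive measure; it contains almost all of a neighbourhood of \<open>y\<close>,
  where \<open>u\<^sub>1 > 0\<close>. It is intersected with \<open>W\<^sub>1\<close>, which changes it only by a null set.\<close>

lemma energy_inequality:
  assumes cont: "continuous_on (ball y t) (u 1)" and st: "0 < s" "s < t" and y: "u 1 y > 0"
    and eps: "measure lebesgue (ball y s) \<le> \<epsilon>"
    and \<psi>: "test_function \<psi>" "\<And>x. 0 \<le> \<psi> x" "\<And>x. \<psi> x \<le> 1" "\<And>x. x \<in> ball y s \<Longrightarrow> \<psi> x = 1"
    and out: "\<And>x. x \<notin> ball y t \<Longrightarrow> \<psi> x = 0" "\<And>x. x \<notin> ball y t \<Longrightarrow> grad \<psi> x = 0"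
    and L: "\<And>x. norm (grad \<psi> x) \<le> L"
  shows "lam * measure lebesgue {x \<in> ball y s. u 1 x > 0} + (LINT x|lebesgue_on (ball y s). (norm (P x))\<^sup>2) \<le>
    (LINT x|lebesgue_on (ball y t). 2 * L * (v x * norm (P x)) + L\<^sup>2 * (v x)\<^sup>2 + a * (v x)\<^sup>2 + b * v x)"
proof -
  define A where "A = W 1 \<inter> {x \<in> ball y s. u 1 x > 0}"
  have oA: "open {x \<in> ball y s. u 1 x > 0}" using positive_set_open[OF cont] st by simp
  then have Ab: "A \<in> sets borel" using W1 by (auto simp: A_def)
  have mA: "measure lebesgue A = measure lebesgue {x \<in> ball y s. u 1 x > 0}"
  proof (rule measure_eq_AE)
    show "AE x in lebesgue. x \<in> A \<longleftrightarrow> x \<in> {x \<in> ball y s. u 1 x > 0}"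
      using u1_zero by eventually_elim (auto simp: A_def)
  qed (use Ab oA in auto)
  have A0: "0 < measure lebesgue A" unfolding mA using positive_set_measure_pos[OF cont st(1) _ y] st by simp
  have "measure lebesgue A \<le> measure lebesgue (ball y s)"
    using Ab by (intro measure_mono_fmeasurable) (auto simp: A_def)
  then have "A \<subseteq> W 1 \<and> 0 < measure lebesgue A \<and> measure lebesgue A \<le> \<epsilon>"
    using eps A0 by (auto simp: A_def)
  from mp[OF bspec[OF nondegenerate[unfolded nondegenerate1_def] Ab] this]
  obtain A' where A': "\<And>j. j \<in> {2..N} \<Longrightarrow> A' j \<in> sets borel" "\<And>j. j \<in> {2..N} \<Longrightarrow> A' j \<subseteq> A"
      "disjoint_family_on A' {2..N}"
    and FA: "F (\<lambda>i\<in>{1..N}. if i = 1 then W 1 - A else W i \<union> A' i) \<le> F W - lam * measure lebesgue A"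
    by blast
  define W' where "W' = (\<lambda>i\<in>{1..N}. if i = 1 then W 1 - A else W i \<union> A' i)"
  define w where "w x = u 1 x - \<psi> x * v x" for x
  define u' where "u' = u(1 := w)"
  define K where "K x = G x - (\<psi> x *\<^sub>R P x + v x *\<^sub>R grad \<psi> x)" for x
  have W'T: "W' \<in> set_tuples N \<Omega>"
    unfolding W'_def using admissible N Ab A' by (intro set_tuples_hand_over) (auto simp: admissible_pairs_def A_def)
  have wG: "has_weak_gradient w K"
    unfolding w_def[abs_def] K_def[abs_def]
  proof (rule has_weak_gradient_diff[OF u1_L1_loc _ G(1)])
    show "L1_loc (\<lambda>x. \<psi> x * v x)"
      using L1_loc_integrable[OF L1_loc_integrable_mult_test[OF v_L1_loc \<psi>(1)]] by simp
    show "has_weak_gradient (\<lambda>x. \<psi> x * v x) (\<lambda>x. \<psi> x *\<^sub>R P x + v x *\<^sub>R grad \<psi> x)"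
      by (rule has_weak_gradient_mult_test(1)[OF v_L1_loc P \<psi>(1)])
  qed
  have K_measurable: "K \<in> borel_measurable lebesgue" using wG by (simp add: has_weak_gradient_def L1_loc_def)
  have w_le: "\<bar>w x\<bar> \<le> \<bar>u 1 x\<bar>" for x
    using \<psi>(2,3)[of x] mult_left_le_one_le[of "u 1 x" "\<psi> x"] by (auto simp: w_def v_def max_def)
  have w_measurable: "w \<in> borel_measurable lebesgue"
    unfolding w_def[abs_def] using u1_L1_loc v_measurable test_function_measurable_lebesgue[OF \<psi>(1)]
    by (auto simp: L1_loc_def)
  have w_L2_loc: "L2_loc w"
    unfolding L2_loc_def
  proof (intro conjI allI impI)
    fix C :: "(real^'n) set" assume C: "compact C"
    show "integrable (lebesgue_on C) (\<lambda>x. (w x)\<^sup>2)"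
    proof (rule Bochner_Integration.integrable_bound)
      show "integrable (lebesgue_on C) (\<lambda>x. (u 1 x)\<^sup>2)" using u1_L2_loc C by (simp add: L2_loc_def)
      show "(\<lambda>x. (w x)\<^sup>2) \<in> borel_measurable (lebesgue_on C)"
        by (intro measurable_restrict_space1 borel_measurable_power w_measurable)
    qed (use w_le in \<open>auto simp: abs_le_square_iff\<close>)
  qed (rule w_measurable)
  \<comment> \<open>\<open>q1\<close> bounds the increase of the gradient term, \<open>q\<close> includes the lower-order terms.\<close>
  define q where "q x = indicator (ball y t) x * (2 * L * (v x * norm (P x)) + L\<^sup>2 * (v x)\<^sup>2 + a * (v x)\<^sup>2 + b * v x)" for x
  define q1 where "q1 x = indicator (ball y t) x * (2 * L * (v x * norm (P x)) + L\<^sup>2 * (v x)\<^sup>2)" for x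
  have L0: "0 \<le> L" using norm_ge_zero L order_trans by blast
  have q1i: "integrable lebesgue q1"
    unfolding q1_def[abs_def] integrable_on_ball_iff[symmetric]
    by (intro Bochner_Integration.integrable_add integrable_mult_right v_P_integrable_ball v_square_integrable_ball)
  have qi: "integrable lebesgue q"
    unfolding q_def[abs_def] integrable_on_ball_iff[symmetric]
    by (intro Bochner_Integration.integrable_add integrable_mult_right v_P_integrable_ball v_square_integrable_ball v_integrable_ball)
  have K_le: "(norm (K x))\<^sup>2 \<le> (norm (G x))\<^sup>2 - indicator (ball y s) x * (norm (P x))\<^sup>2 + q1 x" for x
  proof (cases "x \<in> ball y t")
    case True
    have "(norm (K x))\<^sup>2 \<le> (norm (G x))\<^sup>2 - (2 * \<psi> x - (\<psi> x)\<^sup>2) * (norm (P x))\<^sup>2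
      + 2 * v x * norm (grad \<psi> x) * norm (P x) + (v x)\<^sup>2 * (norm (grad \<psi> x))\<^sup>2"
      unfolding K_def by (rule competitor_gradient[OF \<psi>(2,3)])
    moreover have "indicator (ball y s) x * (norm (P x))\<^sup>2 \<le> (2 * \<psi> x - (\<psi> x)\<^sup>2) * (norm (P x))\<^sup>2"
    proof (cases "x \<in> ball y s")
      case True then show ?thesis by (simp add: \<psi>(4))
    next
      case False
      have "\<psi> x * \<psi> x \<le> 1 * \<psi> x" by (rule mult_right_mono[OF \<psi>(3) \<psi>(2)])
      then have "0 \<le> 2 * \<psi> x - (\<psi> x)\<^sup>2" using \<psi>(2)[of x] by (simp add: power2_eq_square)
      then show ?thesis using False by simp
    qed
    moreover have "2 * v x * norm (grad \<psi> x) * norm (P x) \<le> 2 * v x * L * norm (P x)"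
      by (intro mult_right_mono mult_left_mono L) (auto simp: v_nonneg)
    moreover have "(v x)\<^sup>2 * (norm (grad \<psi> x))\<^sup>2 \<le> (v x)\<^sup>2 * L\<^sup>2"
      by (intro mult_left_mono power_mono L) auto
    ultimately show ?thesis using True by (simp add: q1_def mult_ac)
  next
    case False
    then have "x \<notin> ball y s" using st by auto
    then show ?thesis using False out[OF False] by (simp add: K_def q1_def)
  qed
  have GI: "integrable lebesgue (\<lambda>x. (norm (G x))\<^sup>2)" using G(2) by (simp add: L2_def)
  have PsI: "integrable lebesgue (\<lambda>x. indicator (ball y s) x * (norm (P x))\<^sup>2)"
    using P_square_integrable_ball[of y s] by (simp add: integrable_on_ball_iff)
  have q1_nonneg: "0 \<le> q1 x" for x
    using L0 v_nonneg[of x] by (auto simp: q1_def indicator_def)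
  have KI: "integrable lebesgue (\<lambda>x. (norm (K x))\<^sup>2)"
  proof (rule Bochner_Integration.integrable_bound)
    show "integrable lebesgue (\<lambda>x. (norm (G x))\<^sup>2 + q1 x)" using GI q1i by auto
    show "AE x in lebesgue. norm ((norm (K x))\<^sup>2) \<le> norm ((norm (G x))\<^sup>2 + q1 x)"
    proof (rule AE_I2)
      fix x
      have "0 \<le> indicator (ball y s) x * (norm (P x))\<^sup>2" by simp
      then show "norm ((norm (K x))\<^sup>2) \<le> norm ((norm (G x))\<^sup>2 + q1 x)"
        using K_le[of x] q1_nonneg[of x] by (smt (verit, best) real_norm_def zero_le_power2)
    qed
  qed (use K_measurable in auto)
  have wW: "w \<in> W12"
    using w_L2_loc wG KI K_measurable by (auto simp: W12_def L2_def)
  have adm': "(u', W') \<in> admissible_pairs N \<Omega>"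
    unfolding admissible_pairs_def
  proof (clarify, intro conjI ballI W'T)
    show "u' \<in> {1..N} \<rightarrow>\<^sub>E W12"
      using admissible wW N by (auto simp: u'_def admissible_pairs_def PiE_def Pi_def extensional_def)
    fix i assume i: "i \<in> {1..N}"
    have z: "AE x in lebesgue. x \<notin> W i \<longrightarrow> u i x = 0"
      using admissible i by (auto simp: admissible_pairs_def)
    show "AE x in lebesgue. x \<notin> W' i \<longrightarrow> u' i x = 0"
    proof (cases "i = 1")
      case True
      show ?thesis
        using u1_zero
      proof eventually_elim
        fix x assume x: "x \<notin> W 1 \<longrightarrow> u 1 x = 0"
        show "x \<notin> W' i \<longrightarrow> u' i x = 0"
        proof
          assume "x \<notin> W' i"
          then have "x \<notin> W 1 \<or> x \<in> A" using i True by (simp add: W'_def)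
          then show "u' i x = 0"
            using x \<psi>(4)[of x] True by (auto simp: A_def u'_def w_def v_def)
        qed
      qed
    next
      case False
      show ?thesis using z by eventually_elim (use i False in \<open>auto simp: W'_def u'_def\<close>)
    qed
  qed
  define Q where "Q h x = (h x)\<^sup>2 * f 1 x - h x * g 1 x" for h :: "real^'n \<Rightarrow> real" and x
  have J: "J_functional N \<Omega> f g F u W \<le> J_functional N \<Omega> f g F u' W'"
    using minimizer adm' by (auto simp: J_minimizer_def)
  have split: "(\<Sum>i=1..N. h i) = h 1 + (\<Sum>i\<in>{1..N} - {1}. h i)" for h :: "nat \<Rightarrow> real"
    using N by (subst sum.remove[of _ 1]) auto
  have rest: "(\<Sum>i\<in>{1..N} - {1}. h (u' i) i) = (\<Sum>i\<in>{1..N} - {1}. h (u i) i)" for h :: "_ \<Rightarrow> nat \<Rightarrow> real"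
    by (intro sum.cong) (auto simp: u'_def)
  have "(LINT x|lebesgue. (norm (weak_gradient (u 1) x))\<^sup>2) + (LINT x|lebesgue_on \<Omega>. Q (u 1) x) + F W \<le>
    (LINT x|lebesgue. (norm (weak_gradient w x))\<^sup>2) + (LINT x|lebesgue_on \<Omega>. Q w x) + F W'"
    using J unfolding J_functional_def split
      rest[of "\<lambda>h i. LINT x|lebesgue. (norm (weak_gradient h x))\<^sup>2"]
      rest[of "\<lambda>h i. LINT x|lebesgue_on \<Omega>. (h x)\<^sup>2 * f i x - h x * g i x"]
    by (simp add: u'_def Q_def)
  then have "lam * measure lebesgue A + (LINT x|lebesgue. (norm (G x))\<^sup>2) + (LINT x|lebesgue_on \<Omega>. Q (u 1) x) \<le>
    (LINT x|lebesgue. (norm (K x))\<^sup>2) + (LINT x|lebesgue_on \<Omega>. Q w x)"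
    using FA unfolding energy_weak_gradient[OF wG] W'_def[symmetric] G_def by simp
  moreover have QI: "integrable lebesgue (\<lambda>x. indicator \<Omega> x * Q h x)"
    if "\<exists>u W. (u, W) \<in> admissible_pairs N \<Omega> \<and> u 1 = h" for h
  proof -
    have "integrable (lebesgue_on \<Omega>) (Q h)"
      using lower that N unfolding lower_order_converges_def Q_def[abs_def] by fastforce
    then show ?thesis using Omega by (simp add: integrable_restrict_space)
  qed
  moreover have QE: "(LINT x|lebesgue_on \<Omega>. Q h x) = (LINT x|lebesgue. indicator \<Omega> x * Q h x)" for h
    using Omega by (simp add: integral_restrict_space)
  moreover have Qu: "integrable lebesgue (\<lambda>x. indicator \<Omega> x * Q (u 1) x)" using QI admissible by blast
  moreover have Qw: "integrable lebesgue (\<lambda>x. indicator \<Omega> x * Q w x)"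
    by (rule QI) (use adm' in \<open>auto simp: u'_def intro!: exI[of _ u'] exI[of _ W']\<close>)
  ultimately have main: "lam * measure lebesgue A \<le>
    (LINT x|lebesgue. ((norm (K x))\<^sup>2 - (norm (G x))\<^sup>2) + (indicator \<Omega> x * Q w x - indicator \<Omega> x * Q (u 1) x))"
    using KI GI by simp
  also have "\<dots> \<le> (LINT x|lebesgue. q x - indicator (ball y s) x * (norm (P x))\<^sup>2)"
  proof (rule integral_mono_AE)
    have "AE x in lebesgue. x \<in> \<Omega> \<longrightarrow> \<bar>f 1 x\<bar> \<le> a" "AE x in lebesgue. x \<in> \<Omega> \<longrightarrow> \<bar>g 1 x\<bar> \<le> b"
      using f_bound g_bound Omega by (auto simp: AE_restrict_space_iff)
    then show "AE x in lebesgue. ((norm (K x))\<^sup>2 - (norm (G x))\<^sup>2) + (indicator \<Omega> x * Q w x - indicator \<Omega> x * Q (u 1) x)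
      \<le> q x - indicator (ball y s) x * (norm (P x))\<^sup>2"
    proof eventually_elim
      fix x assume fb: "x \<in> \<Omega> \<longrightarrow> \<bar>f 1 x\<bar> \<le> a" and gb: "x \<in> \<Omega> \<longrightarrow> \<bar>g 1 x\<bar> \<le> b"
      have "indicator \<Omega> x * Q w x - indicator \<Omega> x * Q (u 1) x \<le> indicator (ball y t) x * (a * (v x)\<^sup>2 + b * v x)"
      proof (cases "x \<in> \<Omega> \<and> x \<in> ball y t")
        case True
        have "Q w x - Q (u 1) x \<le> a * (v x)\<^sup>2 + b * v x"
          unfolding Q_def w_def using fb gb True by (intro competitor_lower_order \<psi>) auto
        then show ?thesis using True by simp
      next
        case False
        have "0 \<le> indicator (ball y t) x * (a * (v x)\<^sup>2 + b * v x)" using a b v_nonneg[of x] by simp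
        moreover have "indicator \<Omega> x * Q w x - indicator \<Omega> x * Q (u 1) x = 0"
          using False out(1)[of x] by (auto simp: Q_def w_def indicator_def)
        ultimately show ?thesis by linarith
      qed
      moreover have "q x = q1 x + indicator (ball y t) x * (a * (v x)\<^sup>2 + b * v x)"
        by (simp add: q_def q1_def algebra_simps)
      ultimately show "((norm (K x))\<^sup>2 - (norm (G x))\<^sup>2) + (indicator \<Omega> x * Q w x - indicator \<Omega> x * Q (u 1) x)
        \<le> q x - indicator (ball y s) x * (norm (P x))\<^sup>2"
        using K_le[of x] by linarith
    qed
  qed (use KI GI Qu Qw qi PsI in auto)
  also have "\<dots> = (LINT x|lebesgue. q x) - (LINT x|lebesgue_on (ball y s). (norm (P x))\<^sup>2)"
    using qi PsI by (simp add: integral_on_ball)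
  finally show ?thesis unfolding mA q_def integral_on_ball[symmetric] by simp
qed

end

section \<open>De Giorgi iteration\<close>

definition cutoff_constant :: "'n::finite itself \<Rightarrow> real" where
  "cutoff_constant n = (SOME C. cutoff_bound n C)"

lemma cutoff_constant: "cutoff_bound TYPE('n::finite) (cutoff_constant TYPE('n))"
  unfolding cutoff_constant_def by (rule someI_ex[OF cutoff_bound_exists])

definition energy_constant :: "'n::finite itself \<Rightarrow> real \<Rightarrow> real \<Rightarrow> real \<Rightarrow> real" where
  "energy_constant n lam a b = 2 * (cutoff_constant n)\<^sup>2 + a + b\<^sup>2 / (4 * lam) + 1"

context nondegenerate_minimizer
begin

definition energy :: "real^'n \<Rightarrow> real \<Rightarrow> real" where
  "energy y t = (LINT x|lebesgue_on (ball y t). (norm (P x))\<^sup>2) + lam * measure lebesgue {x \<in> ball y t. u 1 x > 0}"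

definition mass :: "real^'n \<Rightarrow> real \<Rightarrow> real" where
  "mass y t = (LINT x|lebesgue_on (ball y t). (v x)\<^sup>2)"

lemma positive_set_lmeasurable: "{x \<in> ball y t. u 1 x > 0} \<in> lmeasurable"
proof -
  have "{x \<in> space lebesgue. u 1 x > 0} \<in> sets lebesgue"
    using u1_L1_loc by (intro borel_measurable_less) (auto simp: L1_loc_def)
  then have "ball y t \<inter> {x. u 1 x > 0} \<in> sets lebesgue" by auto
  moreover have "ball y t \<inter> {x. u 1 x > 0} = {x \<in> ball y t. u 1 x > 0}" by auto
  ultimately have "{x \<in> ball y t. u 1 x > 0} \<in> sets lebesgue" by (simp only:)
  then show ?thesis
    by (intro bounded_set_imp_lmeasurable bounded_subset[OF bounded_ball[of y t]]) auto
qed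

lemma mass_nonneg: "0 \<le> mass y t"
  by (simp add: mass_def)

text \<open>Young's inequality splits the products on the right of \<open>energy_inequality\<close>. The linear term \<open>b v\<close> lives on
  \<open>{u\<^sub>1 > 0}\<close>, so it is absorbed by the measure term of the energy. All coefficients of \<open>v\<^sup>2\<close> are
  collected in one constant over \<open>\<theta> (t - s)\<^sup>2 \<le> 1\<close>.\<close>

lemma energy_decay:
  assumes cont: "continuous_on (ball y t) (u 1)" and st: "0 < s" "s < t" "t \<le> 1" and y: "u 1 y > 0"
    and eps: "measure lebesgue (ball y s) \<le> \<epsilon>" and th: "0 < \<theta>" "\<theta> \<le> 1"
  shows "energy y s \<le> \<theta> * energy y t + energy_constant TYPE('n) lam a b / (\<theta> * (t - s)\<^sup>2) * mass y t"
proof -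
  define C where "C = cutoff_constant TYPE('n)"
  define L where "L = C / (t - s)"
  obtain \<psi> where \<psi>: "test_function \<psi>" "\<And>x. 0 \<le> \<psi> x \<and> \<psi> x \<le> 1" "\<And>x. x \<in> ball y s \<Longrightarrow> \<psi> x = 1"
     "\<And>x. x \<notin> ball y t \<Longrightarrow> \<psi> x = 0 \<and> grad \<psi> x = 0" "\<And>x. norm (grad \<psi> x) \<le> L"
    using cutoff_constant[where 'n='n] st unfolding L_def C_def cutoff_bound_def by blast
  define A where "A = {x \<in> ball y t. u 1 x > 0}"
  have Am: "A \<in> lmeasurable" unfolding A_def by (rule positive_set_lmeasurable)
  have indA: "(\<lambda>x. indicator (ball y t) x * indicator A x) = (indicator A :: _ \<Rightarrow> real)"
    by (auto simp: A_def indicator_def)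
  have Ai: "integrable (lebesgue_on (ball y t)) (indicator A :: _ \<Rightarrow> real)"
  proof -
    have "integrable lebesgue (indicator A :: _ \<Rightarrow> real)"
      using Am by (simp add: lmeasurable_iff_integrable)
    then show ?thesis unfolding integrable_on_ball_iff indA .
  qed
  have AI: "(LINT x|lebesgue_on (ball y t). indicator A x) = measure lebesgue A"
    unfolding integral_on_ball indA using Am by simp
  define k where "k = L\<^sup>2 / \<theta> + L\<^sup>2 + a + b\<^sup>2 / (4 * \<theta> * lam)"
  have "energy y s \<le> (LINT x|lebesgue_on (ball y t). 2 * L * (v x * norm (P x)) + L\<^sup>2 * (v x)\<^sup>2 + a * (v x)\<^sup>2 + b * v x)"
  proof -
    have "0 \<le> \<psi> x" "\<psi> x \<le> 1" for x using \<psi>(2)[of x] by blast+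
    moreover have "\<psi> x = 0" "grad \<psi> x = 0" if "x \<notin> ball y t" for x using \<psi>(4)[OF that] by blast+
    ultimately show ?thesis
      unfolding energy_def add.commute[of "LINT x|lebesgue_on (ball y s). (norm (P x))\<^sup>2"]
      using \<psi>(1,3,5) by (intro energy_inequality[OF cont st(1,2) y eps])
  qed
  also have "\<dots> \<le> (LINT x|lebesgue_on (ball y t). \<theta> * (norm (P x))\<^sup>2 + \<theta> * lam * indicator A x + k * (v x)\<^sup>2)"
  proof (rule integral_mono)
    show "integrable (lebesgue_on (ball y t)) (\<lambda>x. 2 * L * (v x * norm (P x)) + L\<^sup>2 * (v x)\<^sup>2 + a * (v x)\<^sup>2 + b * v x)"
      by (intro Bochner_Integration.integrable_add integrable_mult_right v_P_integrable_ball v_square_integrable_ball v_integrable_ball)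
    show "integrable (lebesgue_on (ball y t)) (\<lambda>x. \<theta> * (norm (P x))\<^sup>2 + \<theta> * lam * indicator A x + k * (v x)\<^sup>2)"
      by (intro Bochner_Integration.integrable_add integrable_mult_right P_square_integrable_ball v_square_integrable_ball Ai)
    fix x assume "x \<in> space (lebesgue_on (ball y t))"
    then have x: "x \<in> ball y t" by simp
    have "0 \<le> (\<theta> * norm (P x) - L * v x)\<^sup>2 / \<theta>" using th by simp
    also have "\<dots> = \<theta> * (norm (P x))\<^sup>2 - 2 * L * (v x * norm (P x)) + L\<^sup>2 / \<theta> * (v x)\<^sup>2"
      using th by (simp add: power2_eq_square field_simps)
    finally have 1: "2 * L * (v x * norm (P x)) \<le> \<theta> * (norm (P x))\<^sup>2 + L\<^sup>2 / \<theta> * (v x)\<^sup>2" by simp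
    have 2: "b * v x \<le> \<theta> * lam * indicator A x + b\<^sup>2 / (4 * \<theta> * lam) * (v x)\<^sup>2"
    proof (cases "u 1 x > 0")
      case True
      have p: "0 < \<theta> * lam" using th lam by simp
      have "0 \<le> (2 * (\<theta> * lam) - b * v x)\<^sup>2 / (4 * (\<theta> * lam))" using p by simp
      also have "\<dots> = \<theta> * lam - b * v x + b\<^sup>2 / (4 * \<theta> * lam) * (v x)\<^sup>2"
        using th lam by (simp add: power2_eq_square field_simps)
      finally show ?thesis using True x by (simp add: A_def)
    next
      case False
      then have "v x = 0" by (simp add: v_def)
      then show ?thesis using th lam by simp
    qed
    show "2 * L * (v x * norm (P x)) + L\<^sup>2 * (v x)\<^sup>2 + a * (v x)\<^sup>2 + b * v x \<le>
        \<theta> * (norm (P x))\<^sup>2 + \<theta> * lam * indicator A x + k * (v x)\<^sup>2"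
      using 1 2 by (simp add: k_def algebra_simps)
  qed
  also have "\<dots> = \<theta> * energy y t + k * mass y t"
    using P_square_integrable_ball[of y t] v_square_integrable_ball[of y t] Ai AI
    by (simp add: energy_def mass_def A_def algebra_simps)
  also have "k * mass y t \<le> energy_constant TYPE('n) lam a b / (\<theta> * (t - s)\<^sup>2) * mass y t"
  proof (rule mult_right_mono[OF _ mass_nonneg])
    have d: "0 < t - s" "(t - s)\<^sup>2 \<le> 1" using st by (auto intro: power_le_one)
    have p: "0 < \<theta> * (t - s)\<^sup>2" "\<theta> * (t - s)\<^sup>2 \<le> 1" using th d by (auto intro: mult_le_one)
    have q: "z \<le> z / (\<theta> * (t - s)\<^sup>2)" if "0 \<le> z" for z
      using p that mult_left_le[of "\<theta> * (t - s)\<^sup>2" z] by (simp add: le_divide_eq)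
    have L2: "L\<^sup>2 = C\<^sup>2 / (t - s)\<^sup>2" by (simp add: L_def power_divide)
    have "L\<^sup>2 \<le> L\<^sup>2 / \<theta>" using th by (simp add: le_divide_eq mult_left_le)
    moreover have "L\<^sup>2 / \<theta> = C\<^sup>2 / (\<theta> * (t - s)\<^sup>2)" using th d by (simp add: L2 field_simps)
    moreover have "a \<le> a / (\<theta> * (t - s)\<^sup>2)" by (rule q[OF a])
    moreover have "b\<^sup>2 / (4 * \<theta> * lam) \<le> b\<^sup>2 / (4 * lam) / (\<theta> * (t - s)\<^sup>2)"
    proof -
      have "b\<^sup>2 / (4 * lam) / \<theta> * (t - s)\<^sup>2 \<le> b\<^sup>2 / (4 * lam) / \<theta> * 1"
        using d th lam by (intro mult_left_mono) auto
      then show ?thesis using d th lam by (simp add: field_simps)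
    qed
    moreover have "0 \<le> 1 / (\<theta> * (t - s)\<^sup>2)" using p by simp
    ultimately have "k \<le> 2 * (C\<^sup>2 / (\<theta> * (t - s)\<^sup>2)) + a / (\<theta> * (t - s)\<^sup>2) + b\<^sup>2 / (4 * lam) / (\<theta> * (t - s)\<^sup>2) + 1 / (\<theta> * (t - s)\<^sup>2)"
      unfolding k_def by linarith
    then show "k \<le> energy_constant TYPE('n) lam a b / (\<theta> * (t - s)\<^sup>2)"
      by (simp add: energy_constant_def C_def add_divide_distrib)
  qed
  finally show ?thesis by simp
qed

text \<open>The measure term of the energy makes a small energy imply a small support.\<close>

lemma mass_le_energy:
  assumes h: "0 < h" "h \<le> t" and small: "energy y t \<le> lam * (measure lebesgue (ball (0::real^'n) 1) / 2 ^ (CARD('n) + 1)) * h ^ CARD('n)"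
  shows "mass y t \<le> 2 ^ (CARD('n) + 1) * h\<^sup>2 * energy y t"
proof -
  have Pn: "0 \<le> (LINT x|lebesgue_on (ball y t). (norm (P x))\<^sup>2)" by simp
  have Vh: "measure lebesgue (ball (0::real^'n) (h / 2)) / 2 = measure lebesgue (ball (0::real^'n) 1) / 2 ^ (CARD('n) + 1) * h ^ CARD('n)"
    using h by (simp add: content_ball power_divide)
  have "{x \<in> ball y t. v x \<noteq> 0} = {x \<in> ball y t. u 1 x > 0}" by (auto simp: v_def)
  moreover have "lam * measure lebesgue {x \<in> ball y t. u 1 x > 0} \<le> energy y t" using Pn by (simp add: energy_def)
  then have "lam * measure lebesgue {x \<in> ball y t. u 1 x > 0} \<le> lam * (measure lebesgue (ball (0::real^'n) (h / 2)) / 2)"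
    using small unfolding Vh by (simp add: mult.assoc)
  then have "measure lebesgue {x \<in> ball y t. u 1 x > 0} \<le> measure lebesgue (ball (0::real^'n) (h / 2)) / 2"
    using lam by simp
  ultimately have "mass y t \<le> 2 ^ (CARD('n) + 1) * h\<^sup>2 * (LINT x|lebesgue_on (ball y t). (norm (P x))\<^sup>2)"
    unfolding mass_def using poincare_small_support[OF v_L1_loc P h v_square_integrable_ball P_square_integrable_ball] by simp
  also have "\<dots> \<le> 2 ^ (CARD('n) + 1) * h\<^sup>2 * energy y t"
    using lam by (intro mult_left_mono) (auto simp: energy_def)
  finally show ?thesis .
qed

end

text \<open>The properties of energy \<open>E\<close> and mass \<open>m\<close> that drive the iteration: \<open>energy_decay\<close>,
  \<open>mass_le_energy\<close>, monotonicity and nonnegativity.\<close>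

definition decaying :: "nat \<Rightarrow> real \<Rightarrow> real \<Rightarrow> real \<Rightarrow> (real \<Rightarrow> real) \<Rightarrow> (real \<Rightarrow> real) \<Rightarrow> bool" where
  "decaying n K D \<rho> E m \<longleftrightarrow>
    (\<forall>s t \<theta>. 0 < s \<longrightarrow> s < t \<longrightarrow> t \<le> \<rho> \<longrightarrow> 0 < \<theta> \<longrightarrow> \<theta> \<le> 1 \<longrightarrow> E s \<le> \<theta> * E t + K / (\<theta> * (t - s)\<^sup>2) * m t) \<and>
    (\<forall>t h. 0 < h \<longrightarrow> h \<le> t \<longrightarrow> t \<le> \<rho> \<longrightarrow> E t \<le> D * h ^ n \<longrightarrow> m t \<le> 2 ^ (n + 1) * h\<^sup>2 * E t) \<and>
    (\<forall>s t. 0 < s \<longrightarrow> s \<le> t \<longrightarrow> t \<le> \<rho> \<longrightarrow> E s \<le> E t) \<and> (\<forall>t. 0 \<le> E t)"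

definition decay_threshold :: "nat \<Rightarrow> real \<Rightarrow> real \<Rightarrow> real \<Rightarrow> real \<Rightarrow> bool" where
  "decay_threshold n K D M0 \<delta> \<longleftrightarrow> \<delta> > 0 \<and> (\<forall>\<rho> E m. 0 < \<rho> \<longrightarrow> decaying n K D \<rho> E m \<longrightarrow>
    E \<rho> \<le> M0 * \<rho> ^ n \<longrightarrow> m \<rho> \<le> \<delta> * \<rho> ^ (n + 2) \<longrightarrow> E (\<rho> / 2) \<le> 0)"

text \<open>The iteration uses the radii \<open>\<rho> (1/2 + 1/2\<^bsup>k+2\<^esup>)\<close> and proves geometric decay of the energy with
  ratio \<open>4\<^sup>-\<^sup>n\<close>; then the Poincare inequality applies at scale \<open>H \<rho> / 4\<^sup>k\<close> in the \<open>k\<close>-th ball, which beats the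
  factor \<open>4\<^sup>k\<close> that comes from the distance of consecutive radii.\<close>

lemma decay_threshold_exists:
  fixes K D M0 :: real and n :: nat
  assumes "K \<ge> 1" "D > 0" "M0 \<ge> 0" "n \<ge> 1"
  shows "\<exists>\<delta>. decay_threshold n K D M0 \<delta>"
proof -
  \<comment> \<open>Both terms of the decay estimate shall contribute \<open>4\<^sup>-\<^sup>n/2\<close> to the ratio of consecutive energies.\<close>
  define \<theta> :: real where "\<theta> = 1 / (2 * 4 ^ n)"
  have "(1::real) \<le> 4 ^ n" by simp
  then have "(1::real) \<le> 2 * 4 ^ n" by linarith
  then have \<theta>: "0 < \<theta>" "\<theta> \<le> 1" by (auto simp: \<theta>_def divide_le_eq)
  define B where "B = 64 * K * 2 ^ (n + 1)"
  have B: "B \<ge> 1"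
  proof -
    have "(1::real) \<le> 2 ^ (n + 1)" by (rule one_le_power) simp
    then have "1 * 1 \<le> (64 * K) * 2 ^ (n + 1)" using assms(1) by (intro mult_mono) auto
    then show ?thesis by (simp add: B_def)
  qed
  define H where "H = \<theta> / (2 * B)"
  have H: "0 < H" "H \<le> 1 / 2" using \<theta> B by (auto simp: H_def divide_le_eq)
  have HB: "B * H\<^sup>2 \<le> \<theta>\<^sup>2"
  proof -
    have "B * H\<^sup>2 = \<theta>\<^sup>2 / (4 * B)" using B by (simp add: H_def power2_eq_square field_simps)
    also have "\<dots> \<le> \<theta>\<^sup>2 / 1" using B by (intro divide_left_mono) auto
    finally show ?thesis by simp
  qed
  \<comment> \<open>The energy \<open>\<kappa> \<rho>\<^sup>n\<close> starts the decay; \<open>\<eta>\<close> and \<open>\<delta>\<close> are chosen to reach it in one step from \<open>\<rho>\<close> to \<open>3\<rho>/4\<close>.\<close>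
  define \<kappa> where "\<kappa> = D * H ^ n"
  have \<kappa>: "\<kappa> > 0" using assms H by (simp add: \<kappa>_def)
  define \<eta> where "\<eta> = min 1 (\<kappa> / (2 * (M0 + 1)))"
  have \<eta>: "0 < \<eta>" "\<eta> \<le> 1" using \<kappa> assms(3) by (auto simp: \<eta>_def)
  have \<eta>M: "\<eta> * M0 \<le> \<kappa> / 2"
  proof -
    have "\<eta> * M0 \<le> \<kappa> / (2 * (M0 + 1)) * (M0 + 1)" using assms(3) \<kappa> by (intro mult_mono) (auto simp: \<eta>_def)
    also have "\<dots> = \<kappa> / 2"
    proof -
      have "\<kappa> / (2 * q) * q = \<kappa> / 2" if "q > 0" for q using that by simp
      then show ?thesis using assms(3) by (simp only:)
    qed
    finally show ?thesis .
  qed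
  define \<delta> where "\<delta> = \<kappa> * \<eta> / (32 * K)"
  have \<delta>: "\<delta> > 0" using \<kappa> \<eta> assms(1) by (simp add: \<delta>_def)
  show ?thesis
    unfolding decay_threshold_def
  proof (intro exI[of _ \<delta>] conjI \<delta> allI impI)
    fix \<rho> :: real and E m :: "real \<Rightarrow> real"
    assume \<rho>: "\<rho> > 0" and "decaying n K D \<rho> E m"
      and E0: "E \<rho> \<le> M0 * \<rho> ^ n" and m0: "m \<rho> \<le> \<delta> * \<rho> ^ (n + 2)"
    then have dec: "0 < s \<Longrightarrow> s < t \<Longrightarrow> t \<le> \<rho> \<Longrightarrow> 0 < \<theta> \<Longrightarrow> \<theta> \<le> 1 \<Longrightarrow> E s \<le> \<theta> * E t + K / (\<theta> * (t - s)\<^sup>2) * m t"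
      and poi: "0 < h \<Longrightarrow> h \<le> t \<Longrightarrow> t \<le> \<rho> \<Longrightarrow> E t \<le> D * h ^ n \<Longrightarrow> m t \<le> 2 ^ (n + 1) * h\<^sup>2 * E t"
      and mono: "0 < s \<Longrightarrow> s \<le> t \<Longrightarrow> t \<le> \<rho> \<Longrightarrow> E s \<le> E t" and En: "0 \<le> E t" for s t h \<theta>
      unfolding decaying_def by blast+
    define r where "r k = \<rho> * (1 / 2 + 1 / 2 ^ (k + 2))" for k :: nat
    have r: "\<rho> / 2 < r k" "r k \<le> \<rho>" for k
    proof -
      have "1 / 2 ^ (k + 2) \<le> (1::real) / 2 ^ 1" by (intro divide_left_mono power_increasing) auto
      then have "1 / 2 + 1 / 2 ^ (k + 2) \<le> (1::real)" unfolding power_one_right by linarith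
      then show "r k \<le> \<rho>" unfolding r_def by (rule mult_left_le) (use \<rho> in simp)
      show "\<rho> / 2 < r k" unfolding r_def using \<rho> by (simp add: distrib_left)
    qed
    have rd: "r k - r (Suc k) = \<rho> / (8 * 2 ^ k)" for k
      by (simp add: r_def field_simps)
    have dec': "E (r k) \<le> \<kappa> * \<rho> ^ n / (4 ^ n) ^ k" for k
    proof (induction k)
      case 0
      have sq: "(\<rho> - r 0)\<^sup>2 = \<rho>\<^sup>2 / 16" by (simp add: r_def power2_eq_square)
      have "r 0 < \<rho>" "0 < r 0" using \<rho> by (auto simp: r_def)
      then have "E (r 0) \<le> \<eta> * E \<rho> + K / (\<eta> * (\<rho>\<^sup>2 / 16)) * m \<rho>"
        using dec[of "r 0" \<rho> \<eta>, unfolded sq] \<eta> by blast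
      also have "\<dots> \<le> \<eta> * (M0 * \<rho> ^ n) + K / (\<eta> * (\<rho>\<^sup>2 / 16)) * (\<delta> * \<rho> ^ (n + 2))"
        using E0 m0 \<eta> assms(1) \<rho> by (intro add_mono mult_left_mono) auto
      also have "K / (\<eta> * (\<rho>\<^sup>2 / 16)) * (\<delta> * \<rho> ^ (n + 2)) = \<kappa> / 2 * \<rho> ^ n"
        using \<eta> \<rho> assms(1) by (simp add: \<delta>_def field_simps power_add power2_eq_square)
      also have "\<eta> * (M0 * \<rho> ^ n) \<le> \<kappa> / 2 * \<rho> ^ n"
        unfolding mult.assoc[symmetric] by (rule mult_right_mono[OF \<eta>M]) (use \<rho> in simp)
      finally show ?case by simp
    next
      case (Suc k)
      define h where "h = H * \<rho> / 4 ^ k"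
      have h0: "0 < h" using H \<rho> by (simp add: h_def)
      have "h \<le> H * \<rho>" using H \<rho> by (simp add: h_def divide_le_eq mult_left_le)
      also have "\<dots> \<le> 1 / 2 * \<rho>" using H \<rho> by (intro mult_right_mono) auto
      finally have h1: "h \<le> r k" using r(1)[of k] by simp
      have "D * h ^ n = \<kappa> * \<rho> ^ n / (4 ^ n) ^ k"
        by (simp add: h_def \<kappa>_def power_divide power_mult_distrib power_mult[symmetric] mult.commute)
      then have m: "m (r k) \<le> 2 ^ (n + 1) * h\<^sup>2 * E (r k)"
        using poi h0 h1 r(2)[of k] Suc.IH by simp
      have "0 < r (Suc k)" "r (Suc k) < r k" using r(1)[of "Suc k"] \<rho> rd[of k] by (auto, smt (verit) divide_pos_pos zero_less_power)
      then have "E (r (Suc k)) \<le> \<theta> * E (r k) + K / (\<theta> * (\<rho> / (8 * 2 ^ k))\<^sup>2) * m (r k)"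
        using dec \<theta> r(2)[of k] unfolding rd[symmetric] by blast
      also have "\<dots> \<le> \<theta> * E (r k) + K / (\<theta> * (\<rho> / (8 * 2 ^ k))\<^sup>2) * (2 ^ (n + 1) * h\<^sup>2 * E (r k))"
        using m \<theta> assms(1) by (intro add_left_mono mult_left_mono) auto
      also have "K / (\<theta> * (\<rho> / (8 * 2 ^ k))\<^sup>2) * (2 ^ (n + 1) * h\<^sup>2 * E (r k)) = B * H\<^sup>2 / \<theta> / 4 ^ k * E (r k)"
      proof -
        have 4: "(4::real) ^ k = 2 ^ k * 2 ^ k" by (simp add: power_mult_distrib[symmetric])
        show ?thesis unfolding h_def B_def 4 using \<rho> \<theta> by (simp add: field_simps power2_eq_square)
      qed
      also have "\<dots> \<le> \<theta> * E (r k)"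
      proof (rule mult_right_mono)
        have "B * H\<^sup>2 / \<theta> / 4 ^ k \<le> B * H\<^sup>2 / \<theta> / 1"
          using B \<theta> by (intro divide_left_mono) auto
        also have "\<dots> \<le> \<theta>" using HB \<theta> by (simp add: divide_le_eq power2_eq_square)
        finally show "B * H\<^sup>2 / \<theta> / 4 ^ k \<le> \<theta>" .
      qed (use En in auto)
      also have "\<theta> * E (r k) + \<theta> * E (r k) = E (r k) / 4 ^ n" by (simp add: \<theta>_def)
      also have "\<dots> \<le> \<kappa> * \<rho> ^ n / (4 ^ n) ^ k / 4 ^ n" by (intro divide_right_mono Suc.IH) auto
      finally show ?case by (simp add: mult.commute)
    qed
    have "(4::real) ^ 1 \<le> 4 ^ n" using assms(4) by (intro power_increasing) auto
    then have "(\<lambda>k. (1 / 4 ^ n :: real) ^ k) \<longlonglongrightarrow> 0"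
      by (intro LIMSEQ_realpow_zero) (auto simp: divide_less_eq)
    from tendsto_mult[OF tendsto_const this, of "\<kappa> * \<rho> ^ n"]
    have "(\<lambda>k. \<kappa> * \<rho> ^ n / (4 ^ n) ^ k) \<longlonglongrightarrow> 0" by (simp add: power_divide)
    moreover have "E (\<rho> / 2) \<le> \<kappa> * \<rho> ^ n / (4 ^ n) ^ k" for k
    proof -
      have "E (\<rho> / 2) \<le> E (r k)" using mono r[of k] \<rho> by simp
      then show ?thesis using dec'[of k] by linarith
    qed
    ultimately show "E (\<rho> / 2) \<le> 0" by (intro LIMSEQ_le_const) auto
  qed
qed


section \<open>Nondegeneracy\<close>

definition unit_ball_measure :: "'n::finite itself \<Rightarrow> real" where
  "unit_ball_measure _ = measure lebesgue (ball (0::real^'n) 1)"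

lemma unit_ball_measure_pos: "unit_ball_measure TYPE('n::finite) > 0"
  using content_ball_pos[of 1 "0::real^'n"] by (simp add: unit_ball_measure_def)

lemma measure_ball_eq: "r \<ge> 0 \<Longrightarrow> measure lebesgue (ball (y::real^'n::finite) r) = unit_ball_measure TYPE('n) * r ^ CARD('n)"
  by (simp add: unit_ball_measure_def content_ball)

lemma unit_ball_measure_le: "unit_ball_measure TYPE('n::finite) \<le> 2 ^ CARD('n)"
proof -
  have sub: "ball (0::real^'n) 1 \<subseteq> cbox (- 1) 1"
  proof
    fix x :: "real^'n" assume "x \<in> ball 0 1"
    then have "\<bar>x $ i\<bar> < 1" for i using component_le_norm_cart[of x i] by simp
    then show "x \<in> cbox (- 1) 1" by (auto simp: mem_box_cart abs_less_iff less_imp_le minus_less_iff)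
  qed
  have "measure lebesgue (ball (0::real^'n) 1) \<le> measure lebesgue (cbox (- 1) (1::real^'n))"
    by (rule measure_mono_fmeasurable[OF sub]) auto
  also have "\<dots> = 2 ^ CARD('n)"
    by (subst measure_completion, simp, subst content_cbox_cart) (auto simp: interval_cbox_cart[symmetric] less_eq_vec_def interval_ne_empty_cart)
  finally show ?thesis by (simp add: unit_ball_measure_def)
qed

text \<open>In a ball of radius \<open>\<rho> = r/2\<close> inside \<open>B(x,r)\<close>, the energy is at most
  \<open>M |B(x,r)| + \<lambda> |B(y,\<rho>)| = (2\<^sup>n M + \<lambda>) |B(0,1)| \<rho>\<^sup>n\<close>; this is the bound in the last argument but one.\<close>

definition mass_threshold :: "'n::finite itself \<Rightarrow> real \<Rightarrow> real \<Rightarrow> real \<Rightarrow> real \<Rightarrow> real \<Rightarrow> bool" where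
  "mass_threshold n lam a b M \<delta> \<longleftrightarrow>
     decay_threshold CARD('n) (energy_constant n lam a b) (lam * (unit_ball_measure n / 2 ^ (CARD('n) + 1)))
       (2 ^ CARD('n) * unit_ball_measure n * M + lam * unit_ball_measure n) \<delta>"

text \<open>The division converts the threshold \<open>\<delta> \<rho>\<^sup>n\<^sup>+\<^sup>2\<close> for the mass at radius \<open>\<rho> = r/2\<close> into one for
  the mean over \<open>B(x,r)\<close> relative to \<open>r\<^sup>2\<close>.\<close>

definition mean_square_constant :: "'n::finite itself \<Rightarrow> real \<Rightarrow> real \<Rightarrow> real \<Rightarrow> real \<Rightarrow> real" where
  "mean_square_constant n lam a b M = (SOME \<delta>. mass_threshold n lam a b M \<delta>) / (2 ^ (CARD('n) + 2) * unit_ball_measure n)"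

lemma mean_square_constant:
  assumes "0 < lam" "0 \<le> a" "0 \<le> b" "0 \<le> M"
  shows "mass_threshold TYPE('n::finite) lam a b M
       (mean_square_constant TYPE('n) lam a b M * (2 ^ (CARD('n) + 2) * unit_ball_measure TYPE('n)))" (is ?T)
    and "mean_square_constant TYPE('n) lam a b M > 0"
proof -
  note V = unit_ball_measure_pos[where 'n='n]
  have "1 \<le> energy_constant TYPE('n) lam a b"
    using assms by (simp add: energy_constant_def)
  then have "\<exists>\<delta>. mass_threshold TYPE('n) lam a b M \<delta>"
    unfolding mass_threshold_def using V assms by (intro decay_threshold_exists) (auto simp: Suc_le_eq)
  from someI_ex[OF this] show ?T
    using V by (simp add: mean_square_constant_def)
  then have "0 < mean_square_constant TYPE('n) lam a b M * (2 ^ (CARD('n) + 2) * unit_ball_measure TYPE('n))"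
    unfolding mass_threshold_def decay_threshold_def by blast
  then show "mean_square_constant TYPE('n) lam a b M > 0"
    by (rule zero_less_mult_pos2) (simp add: V)
qed

text \<open>If \<open>v\<close> had a support so small that the Poincare inequality holds at the scale \<open>\<eta> r\<close>, with this \<open>\<eta>\<close>,
  the mean of \<open>v\<^sup>2\<close> would fall below its lower bound.\<close>

definition density_scale :: "'n::finite itself \<Rightarrow> real \<Rightarrow> real \<Rightarrow> real \<Rightarrow> real \<Rightarrow> real" where
  "density_scale n lam a b M = min 1 (mean_square_constant n lam a b M / (2 ^ (CARD('n) + 1) * (M + 1)))"

definition density_constant :: "'n::finite itself \<Rightarrow> real \<Rightarrow> real \<Rightarrow> real \<Rightarrow> real \<Rightarrow> real" where
  "density_constant n lam a b M = unit_ball_measure n * density_scale n lam a b M ^ CARD('n) / 2 ^ (CARD('n) + 1)"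

lemma density_scale:
  assumes "0 < lam" "0 \<le> a" "0 \<le> b" "0 \<le> M"
  shows "0 < density_scale TYPE('n::finite) lam a b M" "density_scale TYPE('n) lam a b M \<le> 1"
    "2 ^ (CARD('n) + 1) * (density_scale TYPE('n) lam a b M)\<^sup>2 * M < mean_square_constant TYPE('n) lam a b M"
proof -
  define c where "c = mean_square_constant TYPE('n) lam a b M"
  define \<eta> where "\<eta> = density_scale TYPE('n) lam a b M"
  have c: "c > 0" unfolding c_def by (rule mean_square_constant(2)[OF assms])
  have \<eta>: "\<eta> = min 1 (c / (2 ^ (CARD('n) + 1) * (M + 1)))" by (simp add: \<eta>_def c_def density_scale_def)
  have p: "0 < 2 ^ (CARD('n) + 1) * (M + 1)" using assms by simp
  show 1: "0 < density_scale TYPE('n) lam a b M" "density_scale TYPE('n) lam a b M \<le> 1"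
    using c p unfolding \<eta>_def[symmetric] \<eta> by auto
  then have "\<eta>\<^sup>2 \<le> \<eta>" unfolding \<eta>_def[symmetric] by (simp add: power2_eq_square mult_left_le)
  also have "\<eta> \<le> c / (2 ^ (CARD('n) + 1) * (M + 1))" unfolding \<eta> by simp
  finally have "2 ^ (CARD('n) + 1) * (M + 1) * \<eta>\<^sup>2 \<le> c" using p by (simp add: le_divide_eq mult.commute)
  moreover have "0 < 2 ^ (CARD('n) + 1) * \<eta>\<^sup>2" using 1 by (simp add: \<eta>_def)
  ultimately show "2 ^ (CARD('n) + 1) * (density_scale TYPE('n) lam a b M)\<^sup>2 * M < mean_square_constant TYPE('n) lam a b M"
    unfolding \<eta>_def[symmetric] c_def[symmetric] by (simp add: algebra_simps)
qed

context nondegenerate_minimizer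
begin

lemma energy_mono:
  assumes "ball y s \<subseteq> ball z t"
  shows "(LINT x|lebesgue_on (ball y s). (norm (P x))\<^sup>2) \<le> (LINT x|lebesgue_on (ball z t). (norm (P x))\<^sup>2)"
    and "mass y s \<le> mass z t" and "energy y s \<le> energy z t"
proof -
  show 1: "(LINT x|lebesgue_on (ball y s). (norm (P x))\<^sup>2) \<le> (LINT x|lebesgue_on (ball z t). (norm (P x))\<^sup>2)"
    by (rule integral_on_ball_mono[OF P_square_integrable_ball assms]) simp
  show "mass y s \<le> mass z t"
    unfolding mass_def by (rule integral_on_ball_mono[OF v_square_integrable_ball assms]) simp
  have "measure lebesgue {x \<in> ball y s. u 1 x > 0} \<le> measure lebesgue {x \<in> ball z t. u 1 x > 0}"
    using assms positive_set_lmeasurable by (intro measure_mono_fmeasurable) (auto dest: fmeasurableD)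
  then show "energy y s \<le> energy z t"
    unfolding energy_def using lam 1 by (intro add_mono mult_left_mono) auto
qed

text \<open>Otherwise the iteration in \<open>B(y,r/2)\<close> would give an energy of 0 in \<open>B(y,r/4)\<close>, although \<open>u\<^sub>1 > 0\<close> near \<open>y\<close>.\<close>

lemma mass_lower_bound:
  assumes r: "0 < r" "r \<le> 1" "r ^ CARD('n) \<le> \<epsilon>" and cont: "continuous_on (ball x r) (u 1)"
    and y: "y \<in> ball x (r / 2)" "u 1 y > 0" and M: "0 \<le> M"
    and grad: "(LINT z|lebesgue_on (ball x r). (norm (P z))\<^sup>2) \<le> M * measure lebesgue (ball x r)"
  shows "mean_square_constant TYPE('n) lam a b M * r\<^sup>2 * measure lebesgue (ball x r) \<le> mass x r"
proof (rule ccontr)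
  define n where "n = CARD('n)"
  define V where "V = unit_ball_measure TYPE('n)"
  define c where "c = mean_square_constant TYPE('n) lam a b M"
  define \<rho> where "\<rho> = r / 2"
  have V: "V > 0" "V \<le> 2 ^ n" using unit_ball_measure_pos unit_ball_measure_le by (auto simp: V_def n_def)
  have \<rho>: "\<rho> > 0" "\<rho> \<le> 1" "r = 2 * \<rho>" using r by (auto simp: \<rho>_def)
  have sub: "ball y \<rho> \<subseteq> ball x r"
  proof
    fix z assume "z \<in> ball y \<rho>"
    then show "z \<in> ball x r" using y(1) dist_triangle[of x z y] by (simp add: \<rho>_def)
  qed
  have vr: "measure lebesgue (ball x r) = V * (2 ^ n * \<rho> ^ n)"
    unfolding measure_ball_eq[OF less_imp_le[OF r(1)]] V_def n_def by (simp add: \<rho>(3) power_mult_distrib)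
  assume "\<not> c * r\<^sup>2 * measure lebesgue (ball x r) \<le> mass x r"
  then have "mass y \<rho> \<le> c * r\<^sup>2 * measure lebesgue (ball x r)"
    using energy_mono(2)[OF sub] by linarith
  also have "\<dots> = c * (2 ^ (n + 2) * V) * \<rho> ^ (n + 2)"
    unfolding vr by (simp add: \<rho>(3) power_add power2_eq_square mult_ac)
  finally have m: "mass y \<rho> \<le> c * (2 ^ (n + 2) * V) * \<rho> ^ (n + 2)" .
  have E: "energy y \<rho> \<le> (2 ^ n * V * M + lam * V) * \<rho> ^ n"
  proof -
    have "(LINT z|lebesgue_on (ball y \<rho>). (norm (P z))\<^sup>2) \<le> M * (V * (2 ^ n * \<rho> ^ n))"
      using energy_mono(1)[OF sub] grad unfolding vr by linarith
    moreover have "measure lebesgue {x \<in> ball y \<rho>. u 1 x > 0} \<le> measure lebesgue (ball y \<rho>)"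
      using positive_set_lmeasurable by (intro measure_mono_fmeasurable) (auto dest: fmeasurableD)
    then have "lam * measure lebesgue {x \<in> ball y \<rho>. u 1 x > 0} \<le> lam * (V * \<rho> ^ n)"
      unfolding measure_ball_eq[OF less_imp_le[OF \<rho>(1)]] V_def n_def using lam by (intro mult_left_mono) auto
    ultimately show ?thesis unfolding energy_def by (simp add: algebra_simps)
  qed
  have cont': "continuous_on (ball y t) (u 1)" if "t \<le> \<rho>" for t
    using that sub by (intro continuous_on_subset[OF cont]) auto
  have eps: "measure lebesgue (ball y s) \<le> \<epsilon>" if "0 < s" "s \<le> \<rho>" for s
  proof -
    have "measure lebesgue (ball y s) = V * s ^ n" unfolding V_def n_def by (rule measure_ball_eq) (use that in simp)
    also have "\<dots> \<le> 2 ^ n * \<rho> ^ n" using V that by (intro mult_mono power_mono) auto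
    also have "\<dots> = r ^ n" by (simp add: \<rho>(3) power_mult_distrib)
    finally show ?thesis using r(3) by (simp add: n_def)
  qed
  have "energy y (\<rho> / 2) \<le> 0"
  proof -
    have dt: "decay_threshold n (energy_constant TYPE('n) lam a b) (lam * (V / 2 ^ (n + 1))) (2 ^ n * V * M + lam * V) (c * (2 ^ (n + 2) * V))"
      using mean_square_constant(1)[where 'n='n, OF lam a b M] unfolding mass_threshold_def n_def V_def c_def .
    have 1: "energy y s \<le> \<theta> * energy y t + energy_constant TYPE('n) lam a b / (\<theta> * (t - s)\<^sup>2) * mass y t"
      if "0 < s" "s < t" "t \<le> \<rho>" "0 < \<theta>" "\<theta> \<le> 1" for s t \<theta>
      using that \<rho> y(2) eps cont' by (intro energy_decay) auto
    have 2: "mass y t \<le> 2 ^ (n + 1) * h\<^sup>2 * energy y t"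
      if "0 < h" "h \<le> t" "energy y t \<le> lam * (V / 2 ^ (n + 1)) * h ^ n" for t h
      using mass_le_energy[of h t y] that by (simp add: n_def V_def unit_ball_measure_def)
    have 3: "energy y s \<le> energy y t" if "s \<le> t" for s t using that by (intro energy_mono) auto
    have 4: "0 \<le> energy y t" for t using lam by (simp add: energy_def)
    have "decaying n (energy_constant TYPE('n) lam a b) (lam * (V / 2 ^ (n + 1))) \<rho> (energy y) (mass y)"
      unfolding decaying_def by (intro conjI allI impI 1 2 3 4)
    then show ?thesis
      using dt \<rho>(1) E m unfolding decay_threshold_def by blast
  qed
  moreover have "0 < lam * measure lebesgue {x \<in> ball y (\<rho> / 2). u 1 x > 0}"
    by (intro mult_pos_pos[OF lam] positive_set_measure_pos[OF cont'[OF order_refl] _ _ y(2)]) (use \<rho>(1) in simp_all)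
  moreover have "0 \<le> (LINT z|lebesgue_on (ball y (\<rho> / 2)). (norm (P z))\<^sup>2)" by simp
  ultimately show False by (simp add: energy_def)
qed

lemma positive_set_lower_bound:
  assumes r: "0 < r" "r \<le> 1" "r ^ CARD('n) \<le> \<epsilon>" and cont: "continuous_on (ball x r) (u 1)"
    and y: "y \<in> ball x (r / 2)" "u 1 y > 0" and M: "0 \<le> M"
    and grad: "(LINT z|lebesgue_on (ball x r). (norm (P z))\<^sup>2) \<le> M * measure lebesgue (ball x r)"
  shows "density_constant TYPE('n) lam a b M * r ^ CARD('n) \<le> measure lebesgue {z \<in> ball x r. u 1 z > 0}"
proof (rule ccontr)
  define \<eta> where "\<eta> = density_scale TYPE('n) lam a b M"
  define c where "c = mean_square_constant TYPE('n) lam a b M"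
  note \<eta> = density_scale[where 'n='n, OF lam a b M, folded \<eta>_def c_def]
  define h where "h = \<eta> * r"
  have h: "0 < h" "h \<le> r" using \<eta> r by (auto simp: h_def mult_le_cancel_right1)
  assume "\<not> density_constant TYPE('n) lam a b M * r ^ CARD('n) \<le> measure lebesgue {z \<in> ball x r. u 1 z > 0}"
  moreover have "density_constant TYPE('n) lam a b M * r ^ CARD('n) = measure lebesgue (ball (0::real^'n) (h / 2)) / 2"
    using h by (subst measure_ball_eq) (auto simp: density_constant_def h_def \<eta>_def power_divide power_mult_distrib)
  moreover have "{z \<in> ball x r. v z \<noteq> 0} = {z \<in> ball x r. u 1 z > 0}" by (auto simp: v_def)
  ultimately have small: "measure lebesgue {z \<in> ball x r. v z \<noteq> 0} \<le> measure lebesgue (ball (0::real^'n) (h / 2)) / 2" by simp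
  have vol: "0 < measure lebesgue (ball x r)" using content_ball_pos[OF r(1)] by simp
  have "c * r\<^sup>2 * measure lebesgue (ball x r) \<le> mass x r"
    unfolding c_def by (rule mass_lower_bound[OF r cont y M grad])
  also have "mass x r \<le> 2 ^ (CARD('n) + 1) * h\<^sup>2 * (LINT z|lebesgue_on (ball x r). (norm (P z))\<^sup>2)"
    unfolding mass_def by (rule poincare_small_support[OF v_L1_loc P h v_square_integrable_ball P_square_integrable_ball small])
  also have "\<dots> \<le> 2 ^ (CARD('n) + 1) * h\<^sup>2 * (M * measure lebesgue (ball x r))"
    by (intro mult_left_mono grad) auto
  also have "\<dots> = (2 ^ (CARD('n) + 1) * \<eta>\<^sup>2 * M) * (r\<^sup>2 * measure lebesgue (ball x r))"
    by (simp add: h_def power_mult_distrib mult_ac)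
  also have "\<dots> < c * (r\<^sup>2 * measure lebesgue (ball x r))"
    using \<eta>(3) vol r(1) by (intro mult_strict_right_mono) auto
  finally show False by (simp add: mult.assoc)
qed

end

text \<open>If \<open>\<Omega>\<close> is a null set, the norm is \<open>-\<infinity>\<close>, its real value is 0, and the bound holds vacuously.\<close>

lemma abs_le_Linf_norm:
  assumes "Linf_norm \<Omega> h < \<infinity>"
  shows "AE x in lebesgue_on \<Omega>. \<bar>h x\<bar> \<le> \<bar>real_of_ereal (Linf_norm \<Omega> h)\<bar>"
proof -
  have ae: "AE x in lebesgue_on \<Omega>. ereal \<bar>h x\<bar> \<le> Linf_norm \<Omega> h"
    unfolding Linf_norm_def by (rule esssup_AE)
  show ?thesis
  proof (cases "Linf_norm \<Omega> h")
    case (real c)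
    then show ?thesis using ae by (auto elim: eventually_mono)
  next
    case PInf then show ?thesis using assms by simp
  next
    case MInf then show ?thesis using ae by (auto elim: eventually_mono)
  qed
qed

theorem theorem15p1:
  assumes "CARD('n::finite) \<ge> 2"
  shows "\<exists>c1 c2 :: real \<Rightarrow> real \<Rightarrow> real \<Rightarrow> real \<Rightarrow> real.
    (\<forall>lam a b M. lam > 0 \<longrightarrow> c1 lam a b M > 0 \<and> c2 lam a b M > 0) \<and>
    (\<forall>(N::nat) (\<Omega>::(real^'n) set) (f::nat \<Rightarrow> real^'n \<Rightarrow> real) (g::nat \<Rightarrow> real^'n \<Rightarrow> real)
       (F::(nat \<Rightarrow> (real^'n) set) \<Rightarrow> real) (u::nat \<Rightarrow> real^'n \<Rightarrow> real) (W::nat \<Rightarrow> (real^'n) set)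
       (lam::real) (\<epsilon>::real) (x::real^'n) (r::real) (M::real).
      N \<ge> 1 \<longrightarrow>
      \<Omega> \<in> sets borel \<longrightarrow> emeasure lebesgue \<Omega> < \<infinity> \<longrightarrow>
      (\<forall>i\<in>{1..N}. f i \<in> borel_measurable (lebesgue_on \<Omega>) \<and> g i \<in> borel_measurable (lebesgue_on \<Omega>)) \<longrightarrow>
      lower_order_converges N \<Omega> f g \<longrightarrow>
      J_minimizer N \<Omega> f g F u W \<longrightarrow>
      Linf_norm \<Omega> (f 1) < \<infinity> \<longrightarrow> Linf_norm \<Omega> (g 1) < \<infinity> \<longrightarrow>
      lam > 0 \<longrightarrow> \<epsilon> > 0 \<longrightarrow> nondegenerate1 N F W lam \<epsilon> \<longrightarrow>
      r > 0 \<longrightarrow> (\<forall>i\<in>{1..N}. continuous_on (ball x r) (u i)) \<longrightarrow>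
      r \<le> min 1 (\<epsilon> powr (1 / real CARD('n))) \<longrightarrow>
      ball x (r / 2) \<inter> frontier {y \<in> \<Omega>. u 1 y > 0} \<noteq> {} \<longrightarrow>
      ball_average x r (\<lambda>y. (norm (weak_gradient (\<lambda>z. max 0 (u 1 z)) y))\<^sup>2) \<le> M \<longrightarrow>
      ball_average x r (\<lambda>y. (max 0 (u 1 y))\<^sup>2)
        \<ge> c1 lam (real_of_ereal (Linf_norm \<Omega> (f 1))) (real_of_ereal (Linf_norm \<Omega> (g 1))) M * r\<^sup>2 \<and>
      measure lebesgue ({y \<in> \<Omega>. u 1 y > 0} \<inter> ball x r)
        \<ge> c2 lam (real_of_ereal (Linf_norm \<Omega> (f 1))) (real_of_ereal (Linf_norm \<Omega> (g 1))) M * r ^ CARD('n))"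
proof (rule exI[of _ "\<lambda>lam a b M. mean_square_constant TYPE('n) lam (\<bar>a\<bar>) (\<bar>b\<bar>) (\<bar>M\<bar>)"],
    rule exI[of _ "\<lambda>lam a b M. density_constant TYPE('n) lam (\<bar>a\<bar>) (\<bar>b\<bar>) (\<bar>M\<bar>)"], intro conjI allI impI)
  fix lam a b M :: real assume lam: "lam > 0"
  show "mean_square_constant TYPE('n) lam (\<bar>a\<bar>) (\<bar>b\<bar>) (\<bar>M\<bar>) > 0"
    using lam by (intro mean_square_constant) auto
  show "density_constant TYPE('n) lam (\<bar>a\<bar>) (\<bar>b\<bar>) (\<bar>M\<bar>) > 0"
    unfolding density_constant_def
    using lam density_scale(1)[where 'n='n, of lam "\<bar>a\<bar>" "\<bar>b\<bar>" "\<bar>M\<bar>"] unit_ball_measure_pos[where 'n='n] by simp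
next
  fix N :: nat and \<Omega> :: "(real^'n) set" and f g :: "nat \<Rightarrow> real^'n \<Rightarrow> real"
    and F :: "(nat \<Rightarrow> (real^'n) set) \<Rightarrow> real" and u :: "nat \<Rightarrow> real^'n \<Rightarrow> real" and W :: "nat \<Rightarrow> (real^'n) set"
    and lam \<epsilon> :: real and x :: "real^'n" and r M :: real
  assume N: "N \<ge> 1" and Om: "\<Omega> \<in> sets borel" and lower: "lower_order_converges N \<Omega> f g"
    and mini: "J_minimizer N \<Omega> f g F u W"
    and fg: "Linf_norm \<Omega> (f 1) < \<infinity>" "Linf_norm \<Omega> (g 1) < \<infinity>"
    and lam: "lam > 0" and eps: "\<epsilon> > 0" and nd: "nondegenerate1 N F W lam \<epsilon>"
    and r: "r > 0" and cont: "\<forall>i\<in>{1..N}. continuous_on (ball x r) (u i)"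
    and r_le: "r \<le> min 1 (\<epsilon> powr (1 / real CARD('n)))"
    and front: "ball x (r / 2) \<inter> frontier {y \<in> \<Omega>. u 1 y > 0} \<noteq> {}"
    and M: "ball_average x r (\<lambda>y. (norm (weak_gradient (\<lambda>z. max 0 (u 1 z)) y))\<^sup>2) \<le> M"
  define a where "a = \<bar>real_of_ereal (Linf_norm \<Omega> (f 1))\<bar>"
  define b where "b = \<bar>real_of_ereal (Linf_norm \<Omega> (g 1))\<bar>"
  interpret nondegenerate_minimizer N \<Omega> f g F u W lam \<epsilon> a b
    using N Om lower mini abs_le_Linf_norm[OF fg(1), folded a_def] abs_le_Linf_norm[OF fg(2), folded b_def] lam nd
    by unfold_locales (simp_all only: a_def b_def abs_ge_zero)
  have vol: "0 < measure lebesgue (ball x r)" using content_ball_pos[OF r] by simp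
  have r1: "r \<le> 1" "r ^ CARD('n) \<le> \<epsilon>"
  proof -
    show "r \<le> 1" using r_le by simp
    have "r powr real CARD('n) \<le> (\<epsilon> powr (1 / real CARD('n))) powr real CARD('n)"
      using r r_le by (intro powr_mono2) auto
    also have "\<dots> = \<epsilon>" using eps by (simp add: powr_powr)
    finally show "r ^ CARD('n) \<le> \<epsilon>" using r by (simp add: powr_realpow)
  qed
  have c1: "continuous_on (ball x r) (u 1)" using cont N by auto
  obtain y where y: "y \<in> ball x (r / 2)" "u 1 y > 0"
  proof -
    have "ball x (r / 2) \<inter> closure {y \<in> \<Omega>. u 1 y > 0} \<noteq> {}" using front by (auto simp: frontier_def)
    then have "ball x (r / 2) \<inter> {y \<in> \<Omega>. u 1 y > 0} \<noteq> {}" using open_Int_closure_eq_empty[OF open_ball] by blast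
    then show ?thesis using that by blast
  qed
  have "(LINT z|lebesgue_on (ball x r). (norm (P z))\<^sup>2) = (LINT z|lebesgue_on (ball x r). (norm (weak_gradient (\<lambda>z. max 0 (u 1 z)) z))\<^sup>2)"
  proof (rule integral_cong_AE)
    have 1: "has_weak_gradient v (weak_gradient v)"
      using P someI[of "has_weak_gradient v"] by (simp add: weak_gradient_def)
    have veq: "(\<lambda>z. max 0 (u 1 z)) = v" by (simp add: v_def[abs_def])
    show "AE z in lebesgue_on (ball x r). (norm (P z))\<^sup>2 = (norm (weak_gradient (\<lambda>z. max 0 (u 1 z)) z))\<^sup>2"
      unfolding veq using has_weak_gradient_unique[OF P 1] by (auto simp: AE_restrict_space_iff elim: eventually_mono)
    have m: "(\<lambda>z. (norm (P z))\<^sup>2) \<in> borel_measurable lebesgue" "(\<lambda>z. (norm (weak_gradient v z))\<^sup>2) \<in> borel_measurable lebesgue"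
      using 1 P_measurable by (auto simp: has_weak_gradient_def L1_loc_def)
    show "(\<lambda>z. (norm (P z))\<^sup>2) \<in> borel_measurable (lebesgue_on (ball x r))"
      "(\<lambda>z. (norm (weak_gradient (\<lambda>z. max 0 (u 1 z)) z))\<^sup>2) \<in> borel_measurable (lebesgue_on (ball x r))"
      unfolding veq by (rule measurable_restrict_space1[OF m(1)], rule measurable_restrict_space1[OF m(2)])
  qed
  also have "\<dots> \<le> M * measure lebesgue (ball x r)"
    using M vol by (simp add: ball_average_def divide_le_eq)
  also have "\<dots> \<le> \<bar>M\<bar> * measure lebesgue (ball x r)" using vol by (intro mult_right_mono) auto
  finally have grad: "(LINT z|lebesgue_on (ball x r). (norm (P z))\<^sup>2) \<le> \<bar>M\<bar> * measure lebesgue (ball x r)" .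
  have mass_eq: "ball_average x r (\<lambda>y. (max 0 (u 1 y))\<^sup>2) = mass x r / measure lebesgue (ball x r)"
    by (simp add: ball_average_def mass_def v_def)
  show "mean_square_constant TYPE('n) lam (\<bar>real_of_ereal (Linf_norm \<Omega> (f 1))\<bar>) (\<bar>real_of_ereal (Linf_norm \<Omega> (g 1))\<bar>) (\<bar>M\<bar>) * r\<^sup>2
    \<le> ball_average x r (\<lambda>y. (max 0 (u 1 y))\<^sup>2)"
    unfolding mass_eq a_def[symmetric] b_def[symmetric]
    using mass_lower_bound[OF r r1 c1 y _ grad] vol by (simp add: le_divide_eq)
  have "measure lebesgue ({y \<in> \<Omega>. u 1 y > 0} \<inter> ball x r) = measure lebesgue {z \<in> ball x r. u 1 z > 0}"
  proof (rule measure_eq_AE)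
    show "AE z in lebesgue. z \<in> {y \<in> \<Omega>. u 1 y > 0} \<inter> ball x r \<longleftrightarrow> z \<in> {z \<in> ball x r. u 1 z > 0}"
      using u1_zero by eventually_elim (use W1 in auto)
    show m: "{z \<in> ball x r. u 1 z > 0} \<in> sets lebesgue" using positive_set_lmeasurable by (auto dest: fmeasurableD)
    have "\<Omega> \<inter> {z \<in> ball x r. u 1 z > 0} \<in> sets lebesgue" using m Om by auto
    moreover have "\<Omega> \<inter> {z \<in> ball x r. u 1 z > 0} = {y \<in> \<Omega>. u 1 y > 0} \<inter> ball x r" by auto
    ultimately show "{y \<in> \<Omega>. u 1 y > 0} \<inter> ball x r \<in> sets lebesgue" by (simp only:)
  qed
  then show "density_constant TYPE('n) lam (\<bar>real_of_ereal (Linf_norm \<Omega> (f 1))\<bar>) (\<bar>real_of_ereal (Linf_norm \<Omega> (g 1))\<bar>) (\<bar>M\<bar>) * r ^ CARD('n)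
    \<le> measure lebesgue ({y \<in> \<Omega>. u 1 y > 0} \<inter> ball x r)"
    unfolding a_def[symmetric] b_def[symmetric]
    using positive_set_lower_bound[OF r r1 c1 y _ grad] by simp
qed

end
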